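(* For every integer $d\ge1$ there is a constant $c=c(d)\in(0,1]$, depending only on $d$, with the following property. Let $b>0$, let $\kappa>0$, and suppose $\omega\in\mathbb{T}^d$ satisfies $$\|k\cdot\omega\|\ge\kappa|k|^{-b}\qquad\text{for all } k\in\mathbb{Z}^d\setminus\{0\}.$$ Then for every $s$ with $1\le s<1+\frac{c}{1+b}$, the Lyapunov exponent $A\mapsto L(A,\omega)$ is a continuous function on the set of $s$-Gevrey cocycles $A:\mathbb{T}^d\to SL(2,\mathbb{C})$ equipped with the $G^s(\mathbb{T}^d)$ topology.
   Context: $\mathbb{T}^d=\mathbb{R}^d/\mathbb{Z}^d$ with Lebesgue probability measure. For $k\in\mathbb{Z}^d$, $|k|=\sum_j|k_j|$, and for real $t$, $\|t\|$ is the distance from $t$ to the nearest integer. For matrices, $\|\cdot\|$ is the operator norm. For $s\ge1$, a smooth function $f:\mathbb{T}^d\to\mathbb{C}$ (viewed as a periodic function on $\mathbb{R}^d$) is $s$-Gevrey, $f\in G^s(\mathbb{T}^d)$, if there is a constant $R=R(f)$ such that $\|D^\alpha f\|_\infty\le R^{|\alpha|+1}(\alpha!)^s$ for all multi-indices $\alpha\in\mathbb{N}^d$. An $s$-Gevrey quasi-periodic cocycle is a map $A:\mathbb{T}^d\to SL(2,\mathbb{C})$ whose matrix entries belong to $G^s(\mathbb{T}^d)$. $G^s$ topology: for $R>0$ let $G^s_R(\mathbb{T}^d)$ be the Banach space of smooth $f$ with finite norm $\sup_\alpha \|D^\alpha f\|_\infty/(R^{|\alpha|}(\alpha!)^s)$,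 so that $G^s(\mathbb{T}^d)=\bigcup_{R>0}G^s_R(\mathbb{T}^d)$. Continuity of a function of $A$ in the $G^s$ topology means: for each $R>0$, it is continuous on the set of $SL(2,\mathbb{C})$ cocycles with entries in $G^s_R(\mathbb{T}^d)$, metrized by the norm of the entries. For $\omega\in\mathbb{T}^d$ and $N\ge1$, the cocycle iterates are $A_N(x)=A(x+(N-1)\omega)\cdots A(x+\omega)A(x)$. The Lyapunov exponent is $L(A,\omega)=\lim_{N\to\infty}\frac1N\int_{\mathbb{T}^d}\ln\|A_N(x)\|\,dx$ (the limit exists by subadditivity). *)

theory Defs
  imports "HOL-Analysis.Analysis"
begin

text \<open>
  Functions on the torus are represented by their \<open>\<int>\<^sup>d\<close>-periodic lifts to \<open>real ^ 'd\<close>,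
  and points of the torus by arbitrary representatives.
\<close>

definition torus_periodic :: "(real ^ 'd \<Rightarrow> 'b) \<Rightarrow> bool" where
  "torus_periodic f \<longleftrightarrow> (\<forall>x. \<forall>k :: int ^ 'd. f (x + (\<chi> i. of_int (k $ i))) = f x)"

definition partial_deriv :: "'d::finite \<Rightarrow> (real ^ 'd \<Rightarrow> complex) \<Rightarrow> real ^ 'd \<Rightarrow> complex" where
  "partial_deriv i f x = vector_derivative (\<lambda>t. f (x + t *\<^sub>R axis i 1)) (at 0)"

definition iter_partial :: "'d::finite list \<Rightarrow> (real ^ 'd \<Rightarrow> complex) \<Rightarrow> real ^ 'd \<Rightarrow> complex" where
  "iter_partial is f = foldr partial_deriv is f"

text \<open>Infinitely differentiable: all iterated partial derivatives are Frechet differentiable.\<close>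

definition smooth :: "(real ^ 'd::finite \<Rightarrow> complex) \<Rightarrow> bool" where
  "smooth f \<longleftrightarrow> (\<forall>is x. iter_partial is f differentiable (at x))"

text \<open>
  \<open>D\<^sup>\<alpha> f\<close>, differentiating \<open>\<alpha> $ i\<close> times in direction \<open>i\<close>. The order chosen for the
  differentiations is immaterial for smooth \<open>f\<close>, by symmetry of mixed partial derivatives.
\<close>

definition multi_deriv :: "nat ^ 'd \<Rightarrow> (real ^ 'd::finite \<Rightarrow> complex) \<Rightarrow> real ^ 'd \<Rightarrow> complex" where
  "multi_deriv \<alpha> f = iter_partial (SOME is. \<forall>i. count_list is i = \<alpha> $ i) f"

definition multi_order :: "nat ^ 'd::finite \<Rightarrow> nat" where
  "multi_order \<alpha> = (\<Sum>i\<in>UNIV. \<alpha> $ i)"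

definition multi_fact :: "nat ^ 'd::finite \<Rightarrow> nat" where
  "multi_fact \<alpha> = (\<Prod>i\<in>UNIV. fact (\<alpha> $ i))"

text \<open>Real-valued suprema; only meaningful for bounded families, cf.\ \<open>gevrey_space\<close>.\<close>

definition sup_norm :: "(real ^ 'd::finite \<Rightarrow> complex) \<Rightarrow> real" where
  "sup_norm f = (SUP x. norm (f x))"

definition gevrey_quot :: "real \<Rightarrow> real \<Rightarrow> (real ^ 'd::finite \<Rightarrow> complex) \<Rightarrow> nat ^ 'd \<Rightarrow> real" where
  "gevrey_quot s R f \<alpha> =
     sup_norm (multi_deriv \<alpha> f) / (R ^ multi_order \<alpha> * real (multi_fact \<alpha>) powr s)"

text \<open>
  The derivatives of a smooth periodic function are continuous and periodic, hence bounded, so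
  that \<open>sup_norm\<close> is a genuine supremum for all functions considered here.
\<close>

definition gevrey_space :: "real \<Rightarrow> real \<Rightarrow> (real ^ 'd::finite \<Rightarrow> complex) set" where
  "gevrey_space s R = {f. torus_periodic f \<and> smooth f \<and> bdd_above (range (gevrey_quot s R f))}"

definition gevrey_norm :: "real \<Rightarrow> real \<Rightarrow> (real ^ 'd::finite \<Rightarrow> complex) \<Rightarrow> real" where
  "gevrey_norm s R f = (SUP \<alpha>. gevrey_quot s R f \<alpha>)"

definition gevrey_cocycles :: "real \<Rightarrow> real \<Rightarrow> (real ^ 'd::finite \<Rightarrow> complex ^ 2 ^ 2) set" where
  "gevrey_cocycles s R =
     {A. (\<forall>x. det (A x) = 1) \<and> (\<forall>i j. (\<lambda>x. A x $ i $ j) \<in> gevrey_space s R)}"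

text \<open>
  The locale \<open>Metric_space\<close> demands non-negativity and symmetry for all arguments, hence the
  value 0 outside of the carrier.
\<close>

definition cocycle_dist ::
    "real \<Rightarrow> real \<Rightarrow> (real ^ 'd::finite \<Rightarrow> complex ^ 2 ^ 2) \<Rightarrow> (real ^ 'd \<Rightarrow> complex ^ 2 ^ 2) \<Rightarrow> real" where
  "cocycle_dist s R A B =
     (if A \<in> gevrey_cocycles s R \<and> B \<in> gevrey_cocycles s R
      then \<Sum>i\<in>UNIV. \<Sum>j\<in>UNIV. gevrey_norm s R (\<lambda>x. A x $ i $ j - B x $ i $ j) else 0)"

text \<open>
  Continuity on the set of all \<open>s\<close>-Gevrey cocycles, i.e.\ on the union over \<open>R > 0\<close> of the
  spaces \<open>gevrey_cocycles s R\<close>, in the \<open>G\<^sup>s\<close> topology. That \<open>cocycle_dist s R\<close> is a metric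
  is shown below.
\<close>

definition gevrey_continuous ::
    "real \<Rightarrow> ((real ^ 'd::finite \<Rightarrow> complex ^ 2 ^ 2) \<Rightarrow> real) \<Rightarrow> bool" where
  "gevrey_continuous s F \<longleftrightarrow>
     (\<forall>R>0. continuous_map
              (Metric_space.mtopology (gevrey_cocycles s R) (cocycle_dist s R)) euclideanreal F)"

text \<open>\<open>cocycle_iterate A \<omega> N x = A (x + (N - 1) \<omega>) ** \<dots> ** A (x + \<omega>) ** A x\<close>.\<close>

primrec cocycle_iterate ::
    "(real ^ 'd::finite \<Rightarrow> complex ^ 2 ^ 2) \<Rightarrow> real ^ 'd \<Rightarrow> nat \<Rightarrow> real ^ 'd \<Rightarrow> complex ^ 2 ^ 2" where
  "cocycle_iterate A \<omega> 0 x = mat 1"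
| "cocycle_iterate A \<omega> (Suc N) x = A (x + real N *\<^sub>R \<omega>) ** cocycle_iterate A \<omega> N x"

text \<open>
  The norm on \<open>complex ^ 2\<close> is the Hermitian one; \<open>cbox 0 1\<close> is the unit cube, a fundamental
  domain of the torus up to a null set.
\<close>

definition lyapunov :: "(real ^ 'd::finite \<Rightarrow> complex ^ 2 ^ 2) \<Rightarrow> real ^ 'd \<Rightarrow> real" where
  "lyapunov A \<omega> =
     lim (\<lambda>N. 1 / real N *
       set_lebesgue_integral lborel (cbox 0 1) (\<lambda>x. ln (onorm ((*v) (cocycle_iterate A \<omega> N x)))))"

definition diophantine :: "real \<Rightarrow> real \<Rightarrow> real ^ 'd::finite \<Rightarrow> bool" where
  "diophantine \<kappa> b \<omega> \<longleftrightarrow>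
     (\<forall>k :: int ^ 'd. k \<noteq> 0 \<longrightarrow>
        infdist (\<Sum>j\<in>UNIV. of_int (k $ j) * \<omega> $ j) \<int>
          \<ge> \<kappa> * real_of_int (\<Sum>j\<in>UNIV. \<bar>k $ j\<bar>) powr (- b))"

subsection \<open>The distance between cocycles is a metric\<close>

lemma periodic_partial:
  assumes "torus_periodic f" shows "torus_periodic (partial_deriv i f)"
proof -
  have "f (x + (\<chi> i. of_int (k $ i)) + t *\<^sub>R axis i 1) = f (x + t *\<^sub>R axis i 1)" for x t and k :: "int ^ 'a"
    using assms unfolding torus_periodic_def by (metis add.assoc add.commute)
  then show ?thesis unfolding torus_periodic_def partial_deriv_def by presburger
qed

lemma periodic_iter: "torus_periodic f \<Longrightarrow> torus_periodic (iter_partial is f)"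
  by (induction "is") (auto simp: iter_partial_def periodic_partial)

lemma smooth_partial_vector_derivative:
  fixes f :: "real ^ 'd::finite \<Rightarrow> complex"
  assumes "f differentiable (at x)"
  shows "((\<lambda>t. f (x + t *\<^sub>R axis i 1)) has_vector_derivative partial_deriv i f x) (at 0)"
proof -
  obtain f' where f': "(f has_derivative f') (at x)"
    using assms by (auto simp: differentiable_def)
  have "((\<lambda>t. f (x + t *\<^sub>R axis i 1)) has_derivative (\<lambda>t. f' (t *\<^sub>R axis i 1))) (at 0)"
    by (rule has_derivative_compose[where f="\<lambda>t. x + t *\<^sub>R axis i 1", simplified])
       (auto intro!: derivative_eq_intros f')
  then have "(\<lambda>t. f (x + t *\<^sub>R axis i 1)) differentiable (at 0)"
    by (auto simp: differentiable_def)
  then show ?thesis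
    unfolding partial_deriv_def by (simp add: vector_derivative_works)
qed

lemma iter_partial_diff:
  assumes "smooth f" "smooth g"
  shows "iter_partial is (\<lambda>x. f x - g x) = (\<lambda>x. iter_partial is f x - iter_partial is g x)"
proof (induction "is")
  case (Cons i "is")
  have "partial_deriv i (\<lambda>x. iter_partial is f x - iter_partial is g x) x =
        partial_deriv i (iter_partial is f) x - partial_deriv i (iter_partial is g) x" for x
    unfolding partial_deriv_def[of i "\<lambda>x. iter_partial is f x - iter_partial is g x"]
    using assms unfolding smooth_def
    by (intro vector_derivative_at has_vector_derivative_diff smooth_partial_vector_derivative) auto
  with Cons show ?case by (auto simp: iter_partial_def)
qed (auto simp: iter_partial_def)

lemma smooth_diff: "smooth f \<Longrightarrow> smooth g \<Longrightarrow> smooth (\<lambda>x. f x - g x)"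
  by (simp add: smooth_def iter_partial_diff)

lemma multi_deriv_diff:
  "smooth f \<Longrightarrow> smooth g \<Longrightarrow> multi_deriv \<alpha> (\<lambda>x. f x - g x) = (\<lambda>x. multi_deriv \<alpha> f x - multi_deriv \<alpha> g x)"
  by (simp add: multi_deriv_def iter_partial_diff)

lemma periodic_continuous_bounded:
  fixes f :: "real ^ 'd::finite \<Rightarrow> complex"
  assumes "torus_periodic f" "continuous_on UNIV f"
  shows "bdd_above (range (\<lambda>x. norm (f x)))"
proof -
  have "compact (f ` cbox 0 1)"
    using assms(2) by (intro compact_continuous_image) (auto intro: continuous_on_subset)
  then obtain B where B: "\<And>x. x \<in> cbox 0 1 \<Longrightarrow> norm (f x) \<le> B"
    by (meson bounded_iff compact_imp_bounded imageI)
  have "norm (f x) \<le> B" for x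
  proof -
    define k :: "int ^ 'd" where "k = (\<chi> i. - \<lfloor>x $ i\<rfloor>)"
    have "x + (\<chi> i. of_int (k $ i)) \<in> cbox 0 1"
      unfolding mem_box_cart k_def by (auto simp: floor_le_iff) linarith
    then show ?thesis using B assms(1) unfolding torus_periodic_def by metis
  qed
  then show ?thesis by (auto simp: bdd_above_def)
qed

lemma multi_deriv_bdd:
  assumes "torus_periodic f" "smooth f"
  shows "bdd_above (range (\<lambda>x. norm (multi_deriv \<alpha> f x)))"
  unfolding multi_deriv_def
  using assms unfolding smooth_def
  by (intro periodic_continuous_bounded periodic_iter)
     (auto simp: continuous_on_eq_continuous_at differentiable_imp_continuous_within)

lemma ex_count_list: "\<exists>is. \<forall>i. count_list is i = (\<alpha> :: nat ^ 'd::finite) $ i"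
proof -
  have "\<exists>is. \<forall>i. count_list is i = (if i \<in> S then \<alpha> $ i else 0)" for S
    using finite[of S]
  proof (induction S rule: finite_induct)
    case empty
    show ?case by (rule exI[of _ "[]"]) simp
  next
    case (insert a S)
    then obtain "is" where *: "\<forall>i. count_list is i = (if i \<in> S then \<alpha> $ i else 0)" by auto
    have "count_list (replicate n a) i = (if i = a then n else 0)" for n i
      by (induction n) auto
    then show ?case using * insert by (intro exI[of _ "replicate (\<alpha> $ a) a @ is"]) auto
  qed
  from this[of UNIV] show ?thesis by simp
qed

lemma multi_deriv_0 [simp]: "multi_deriv 0 f = f"
proof -
  define l :: "'a list" where "l = (SOME is. \<forall>i. count_list is i = (0 :: nat ^ 'a) $ i)"
  have "\<forall>i. count_list l i = (0 :: nat ^ 'a) $ i"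
    unfolding l_def by (rule someI_ex) (rule ex_count_list)
  then have "l = []" by (cases l) (auto dest!: spec[of _ "hd l"])
  then show ?thesis by (simp add: multi_deriv_def l_def iter_partial_def)
qed

lemma sup_norm_ge:
  "torus_periodic f \<Longrightarrow> smooth f \<Longrightarrow> norm (multi_deriv \<alpha> f x) \<le> sup_norm (multi_deriv \<alpha> f)"
  unfolding sup_norm_def by (intro cSUP_upper multi_deriv_bdd) auto

lemma multi_fact_pos: "multi_fact \<alpha> > 0"
  unfolding multi_fact_def by (auto intro: prod_pos)

lemma gevrey_quot_nonneg:
  assumes "R > 0" "torus_periodic f" "smooth f" shows "gevrey_quot s R f \<alpha> \<ge> 0"
  using sup_norm_ge[OF assms(2,3), of \<alpha> 0] norm_ge_zero[of "multi_deriv \<alpha> f 0"] assms(1)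
  unfolding gevrey_quot_def by (intro divide_nonneg_nonneg) (linarith, simp)

lemma periodic_diff: "torus_periodic f \<Longrightarrow> torus_periodic g \<Longrightarrow> torus_periodic (\<lambda>x. f x - g x)"
  by (simp add: torus_periodic_def)

lemma sup_norm_diff_le:
  assumes "torus_periodic f" "smooth f" "torus_periodic g" "smooth g"
  shows "sup_norm (multi_deriv \<alpha> (\<lambda>x. f x - g x)) \<le> sup_norm (multi_deriv \<alpha> f) + sup_norm (multi_deriv \<alpha> g)"
  unfolding sup_norm_def[of "multi_deriv \<alpha> (\<lambda>x. f x - g x)"]
proof (rule cSUP_least)
  fix x
  show "norm (multi_deriv \<alpha> (\<lambda>x. f x - g x) x) \<le> sup_norm (multi_deriv \<alpha> f) + sup_norm (multi_deriv \<alpha> g)"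
    using sup_norm_ge[OF assms(1,2), of \<alpha> x] sup_norm_ge[OF assms(3,4), of \<alpha> x]
      norm_triangle_ineq4[of "multi_deriv \<alpha> f x" "multi_deriv \<alpha> g x"]
    by (simp add: multi_deriv_diff assms)
qed auto

lemma gevrey_quot_diff_le:
  assumes "R > 0" "torus_periodic f" "smooth f" "torus_periodic g" "smooth g"
  shows "gevrey_quot s R (\<lambda>x. f x - g x) \<alpha> \<le> gevrey_quot s R f \<alpha> + gevrey_quot s R g \<alpha>"
  using sup_norm_diff_le[OF assms(2-), of \<alpha>] assms(1) multi_fact_pos[of \<alpha>]
  unfolding gevrey_quot_def add_divide_distrib[symmetric]
  by (intro divide_right_mono) auto

lemma gevrey_quot_le_norm: "f \<in> gevrey_space s R \<Longrightarrow> gevrey_quot s R f \<alpha> \<le> gevrey_norm s R f"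
  unfolding gevrey_norm_def gevrey_space_def by (auto intro: cSUP_upper)

lemma gevrey_space_diff:
  assumes "R > 0" "f \<in> gevrey_space s R" "g \<in> gevrey_space s R"
  shows "(\<lambda>x. f x - g x) \<in> gevrey_space s R"
    and "gevrey_norm s R (\<lambda>x. f x - g x) \<le> gevrey_norm s R f + gevrey_norm s R g"
proof -
  have fg: "torus_periodic f" "smooth f" "torus_periodic g" "smooth g"
    using assms by (auto simp: gevrey_space_def)
  have *: "gevrey_quot s R (\<lambda>x. f x - g x) \<alpha> \<le> gevrey_norm s R f + gevrey_norm s R g" for \<alpha>
    using gevrey_quot_diff_le[OF assms(1) fg, of s \<alpha>] gevrey_quot_le_norm[OF assms(2), of \<alpha>]
      gevrey_quot_le_norm[OF assms(3), of \<alpha>] by linarith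
  then show "(\<lambda>x. f x - g x) \<in> gevrey_space s R"
    by (auto simp: gevrey_space_def fg periodic_diff smooth_diff bdd_above_def)
  show "gevrey_norm s R (\<lambda>x. f x - g x) \<le> gevrey_norm s R f + gevrey_norm s R g"
    unfolding gevrey_norm_def[of s R "\<lambda>x. f x - g x"] using * by (intro cSUP_least) auto
qed

lemma gevrey_norm_nonneg: "R > 0 \<Longrightarrow> f \<in> gevrey_space s R \<Longrightarrow> gevrey_norm s R f \<ge> 0"
  using gevrey_quot_le_norm[of f s R 0] gevrey_quot_nonneg[of R f s 0]
  by (auto simp: gevrey_space_def)

lemma norm_le_gevrey_norm:
  assumes "f \<in> gevrey_space s R" shows "norm (f x) \<le> gevrey_norm s R f"
proof -
  have "norm (f x) \<le> gevrey_quot s R f 0"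
    using sup_norm_ge[of f 0 x] assms
    by (simp add: gevrey_quot_def gevrey_space_def multi_order_def multi_fact_def)
  with gevrey_quot_le_norm[OF assms, of 0] show ?thesis by linarith
qed

lemma gevrey_norm_zero [simp]: "gevrey_norm s R (\<lambda>x. 0) = 0"
proof -
  have "iter_partial is (\<lambda>x. 0) = (\<lambda>x. 0)" for "is" :: "'a list"
    by (induction "is") (auto simp: iter_partial_def partial_deriv_def)
  then show ?thesis by (simp add: gevrey_norm_def gevrey_quot_def sup_norm_def multi_deriv_def)
qed

lemma gevrey_norm_commute:
  assumes "R > 0" "f \<in> gevrey_space s R" "g \<in> gevrey_space s R"
  shows "gevrey_norm s R (\<lambda>x. f x - g x) = gevrey_norm s R (\<lambda>x. g x - f x)"
  using assms unfolding gevrey_norm_def gevrey_quot_def sup_norm_def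
  by (simp add: gevrey_space_def multi_deriv_diff norm_minus_commute)

lemma Metric_space_cocycles:
  assumes R: "R > 0"
  shows "Metric_space (gevrey_cocycles s R) (cocycle_dist s R)"
proof
  fix A B :: "real ^ 'd::finite \<Rightarrow> complex ^ 2 ^ 2"
  have entry: "(\<lambda>x. A x $ i $ j) \<in> gevrey_space s R"
    if "A \<in> gevrey_cocycles s R" for A :: "real ^ 'd \<Rightarrow> complex ^ 2 ^ 2" and i j
    using that by (simp add: gevrey_cocycles_def)
  have nonneg: "0 \<le> gevrey_norm s R (\<lambda>x. A x $ i $ j - B x $ i $ j)"
    if "A \<in> gevrey_cocycles s R" "B \<in> gevrey_cocycles s R"
    for A B :: "real ^ 'd \<Rightarrow> complex ^ 2 ^ 2" and i j
    using that by (intro gevrey_norm_nonneg gevrey_space_diff entry R)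
  show "0 \<le> cocycle_dist s R A B"
    unfolding cocycle_dist_def by (auto intro!: sum_nonneg nonneg)
  show "cocycle_dist s R A B = cocycle_dist s R B A"
    unfolding cocycle_dist_def
    by (auto intro!: sum.cong gevrey_norm_commute entry R)
  assume A: "A \<in> gevrey_cocycles s R" and B: "B \<in> gevrey_cocycles s R"
  show "cocycle_dist s R A B = 0 \<longleftrightarrow> A = B"
  proof
    assume "cocycle_dist s R A B = 0"
    then have *: "gevrey_norm s R (\<lambda>x. A x $ i $ j - B x $ i $ j) = 0" for i j
      using nonneg[OF A B] by (auto simp: cocycle_dist_def A B sum_nonneg_eq_0_iff sum_nonneg)
    have "norm (A x $ i $ j - B x $ i $ j) \<le> 0" for x i j
      using norm_le_gevrey_norm[OF gevrey_space_diff(1)[OF R entry[OF A, of i j] entry[OF B, of i j]], of x]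
      by (simp add: *)
    then show "A = B" by (auto simp: fun_eq_iff vec_eq_iff)
  qed (simp add: cocycle_dist_def)
  fix C :: "real ^ 'd \<Rightarrow> complex ^ 2 ^ 2"
  assume C: "C \<in> gevrey_cocycles s R"
  have "gevrey_norm s R (\<lambda>x. A x $ i $ j - C x $ i $ j) \<le>
        gevrey_norm s R (\<lambda>x. A x $ i $ j - B x $ i $ j) +
        gevrey_norm s R (\<lambda>x. B x $ i $ j - C x $ i $ j)" for i j
  proof -
    have "gevrey_norm s R (\<lambda>x. (A x $ i $ j - B x $ i $ j) - (C x $ i $ j - B x $ i $ j)) \<le>
        gevrey_norm s R (\<lambda>x. A x $ i $ j - B x $ i $ j) +
        gevrey_norm s R (\<lambda>x. C x $ i $ j - B x $ i $ j)"
      by (intro gevrey_space_diff entry R A B C)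
    then show ?thesis
      using gevrey_norm_commute[OF R entry[OF B, of i j] entry[OF C, of i j]] by simp
  qed
  then show "cocycle_dist s R A C \<le> cocycle_dist s R A B + cocycle_dist s R B C"
    by (simp add: cocycle_dist_def A B C sum.distrib[symmetric] sum_mono)
qed

end

theory Submission
  imports Defs "HOL-Complex_Analysis.Cauchy_Integral_Formula"
begin

text \<open>
  Write \<open>u\<^sub>N(x) = ln \<parallel>A\<^sub>N(x)\<parallel> / N\<close> and let \<open>L\<^sub>N\<close> be its mean. The Lyapunov exponent is the infimum of the
  \<open>L\<^sub>N\<close>, hence upper semicontinuous; since it is non-negative, only the case \<open>L(A) > 0\<close> matters.

  Near any point and along any coordinate line, \<open>A\<close> agrees up to an error \<open>e\<^bsup>-CN\<^esup>\<close> with its Taylor polynomial of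
  degree \<open>N\<close> on an interval of length \<open>r \<approx> N\<^bsup>1-s\<^esup>\<close>, and the polynomial is bounded on the complex disc of that
  radius. So \<open>u\<^sub>N\<close> is \<open>O(1/N)\<close>-close to the trace of a bounded smooth subharmonic function. Caccioppoli's inequality
  bounds the Dirichlet energy of that function, and the trace therefore satisfies
  \<open>\<parallel>u\<^sub>N(\<cdot> + y) - u\<^sub>N\<parallel>\<^sub>1 \<lesssim> (\<bar>y\<bar>/r)\<^bsup>1/2\<^esup> + 1/N\<close>. As \<open>u\<^sub>N\<close> moves by \<open>O(1/N)\<close> under the shift by
  \<open>\<omega>\<close>, and the orbit of \<open>\<omega>\<close> of length \<open>K\<close> is \<open>K\<^bsup>-1/(3(b+d))\<^esup>\<close>-dense up to a constant, all translates of \<open>u\<^sub>N\<close> are close to it,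
  so \<open>\<parallel>u\<^sub>N - L\<^sub>N\<parallel>\<^sub>1 \<lesssim> N\<^bsup>-\<sigma>\<^esup>\<close> as long as \<open>s - 1 < 1/(6d(1+b))\<close>.

  With such a bound, uniform on bounded sets of cocycles, the avalanche principle applies to blocks of length \<open>N\<close> outside a set
  of small measure and gives \<open>\<bar>L\<^sub>n\<^sub>N + L\<^sub>N - 2 L\<^sub>2\<^sub>N\<bar> \<lesssim> N\<^bsup>-\<sigma>/2\<^esup>\<close> for \<open>n \<approx> N\<^bsup>\<sigma>/2\<^esup>\<close>. Iterating over
  scales, \<open>L(B)\<close> is determined by \<open>L\<^sub>N(B)\<close> and \<open>L\<^sub>2\<^sub>N(B)\<close> for one fixed \<open>N\<close> up to a small error, and these are
  continuous in \<open>B\<close>.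
\<close>

subsection \<open>Subadditive and two-scale sequences\<close>

text \<open>For \<open>s > 1\<close> a cocycle need not extend holomorphically; only finitely many
  Taylor terms are usable. Since \<open>(j!)^(s-1)\<close> is at most \<open>(N+1)^((s-1)*j)\<close>
  for \<open>j \<le> N+1\<close>, the usable width shrinks like \<open>N^(1-s)\<close>, and this
  limits \<open>s\<close>. A translation by \<eta> is cheap only if \<eta> is small against that
  width, so \<eta> about \<open>N^(-\<tau>)\<close> needs \<open>\<tau> > s - 1\<close>. But an
  \<eta>-dense orbit may have to be of length \<open>K\<close> about
  \<open>\<eta>^(-3*(b+d))\<close>, and moving along it costs \<open>K/N\<close>. Asking for
  \<open>K\<close> of order \<open>N^(1/2)\<close> means \<open>6*(b+d)*\<tau> \<le> 1\<close>, and
  \<open>b + d \<le> d*(1+b)\<close> turns this into the constant \<open>1/(6*d)\<close>. The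
  deviation bound obtained is a power of \<open>N\<close> in L1, not an exponentially small measure
  of bad points. Hence the number of blocks can only be a small power of \<open>N\<close>, and many
  scales are needed. Bad points are absorbed pointwise: there the trivial bound on the logarithms is
  dominated by a multiple of the deviations, which is then integrated.\<close>

lemma fekete:
  fixes a :: "nat \<Rightarrow> real"
  assumes sub: "\<And>m n. a (m + n) \<le> a m + a n" and nn: "\<And>n. a n \<ge> 0"
  shows "\<exists>L\<ge>0. (\<lambda>n. a n / real n) \<longlonglongrightarrow> L \<and> (\<forall>n\<ge>1. L \<le> a n / real n)"
proof -
  define S where "S = (\<lambda>n. a n / real n) ` {1..}"
  define L where "L = Inf S"
  have S: "S \<noteq> {}" "bdd_below S" using nn by (auto simp: S_def intro!: bdd_belowI[of _ 0])
  have lower: "L \<le> a n / real n" if "n \<ge> 1" for n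
    unfolding L_def using that S by (intro cInf_lower) (auto simp: S_def)
  have mult: "a (q * m + r) \<le> real q * a m + a r" for q m r
  proof (induction q)
    case (Suc q)
    have "a (Suc q * m + r) \<le> a m + a (q * m + r)" using sub[of m "q * m + r"] by (simp add: add.assoc)
    with Suc show ?case by (simp add: algebra_simps)
  qed simp
  have "(\<lambda>n. a n / real n) \<longlonglongrightarrow> L"
  proof (rule LIMSEQ_I)
    fix e :: real assume e: "e > 0"
    then obtain z where "z \<in> S" "z < L + e / 2" using cInf_lessD[OF S(1), of "L + e/2"] by (auto simp: L_def)
    then obtain m where m: "m \<ge> 1" "a m / real m < L + e / 2" by (auto simp: S_def)
    define K where "K = (\<Sum>r<m. a r)"
    have K: "a r \<le> K" if "r < m" for r unfolding K_def using that nn by (intro member_le_sum) auto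
    have K0: "K \<ge> 0" unfolding K_def using nn by (intro sum_nonneg) auto
    obtain n0 :: nat where n0: "2 * K / e < real n0" using reals_Archimedean2 by blast
    have "norm (a n / real n - L) < e" if n: "n \<ge> Suc n0" for n
    proof -
      have np: "real n > 0" using n by simp
      have "a n \<le> real (n div m) * a m + a (n mod m)" using mult[of "n div m" m "n mod m"] by simp
      also have "\<dots> \<le> real (n div m) * a m + K" using K[of "n mod m"] m by simp
      also have "real (n div m) * a m \<le> real n * (a m / real m)"
      proof -
        have "real (n div m) \<le> real n / real m" by (rule of_nat_div_le_of_nat)
        from mult_right_mono[OF this nn[of m]] show ?thesis by simp
      qed
      finally have "a n / real n \<le> (real n * (a m / real m) + K) / real n"
        using np by (intro divide_right_mono) auto
      also have "\<dots> = a m / real m + K / real n" using np by (simp add: add_divide_distrib)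
      also have "K / real n < e / 2"
      proof -
        have "2 * K / e < real n" using n0 n by linarith
        then show ?thesis using e np by (simp add: field_simps)
      qed
      finally have "a n / real n < L + e" using m by linarith
      with lower[of n] n show ?thesis by simp
    qed
    then show "\<exists>no. \<forall>n\<ge>no. norm (a n / real n - L) < e" by blast
  qed
  moreover have "L \<ge> 0" unfolding L_def using S nn by (intro cInf_greatest) (auto simp: S_def)
  ultimately show ?thesis using lower by blast
qed

text \<open>Along \<open>N\<^sub>k\<^sub>+\<^sub>1 \<approx> N\<^sub>k\<^bsup>1+\<beta>\<^esup>\<close> the errors of the two-scale relation are summable, and the gap
  \<open>l N - l (2 N)\<close> does not accumulate since it is renewed at each scale.\<close>

lemma two_scale_limit:
  fixes l :: "nat \<Rightarrow> real"
  assumes step: "\<And>N n. N \<ge> N0 \<Longrightarrow> l N \<ge> g \<Longrightarrow> l N - l (2 * N) \<le> g / 8 \<Longrightarrow> 2 \<le> n \<Longrightarrow>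
        real N powr \<beta> \<le> real n \<Longrightarrow> real n \<le> 8 * real N powr \<beta> \<Longrightarrow>
        \<bar>l (n * N) + l N - 2 * l (2 * N)\<bar> \<le> D * real N powr (- \<beta>)"
    and \<beta>: "\<beta> > 0" and D: "D \<ge> 0" and N0: "N0 \<ge> 1" and lim: "l \<longlonglongrightarrow> L"
    and g: "l N0 \<ge> 2 * g"
    and small: "2 * \<bar>l N0 - l (2 * N0)\<bar> + 5 * D * real N0 powr (- \<beta>) / (1 - 2 powr (- \<beta>)) \<le> g / 4"
  shows "\<bar>L - l N0\<bar> \<le> 2 * \<bar>l N0 - l (2 * N0)\<bar> + 5 * D * real N0 powr (- \<beta>) / (1 - 2 powr (- \<beta>))"
proof -
  define q where "q = (2::real) powr (- \<beta>)"
  have q: "0 < q" "q < 1" using \<beta> powr_less_mono[of "-\<beta>" 0 2] by (auto simp: q_def)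
  \<comment> \<open>As \<open>N powr \<beta> \<ge> 1\<close>, the \<open>+ 1\<close> forces
    \<open>m N \<ge> 2\<close>, while \<open>m N \<le> 3 * N powr \<beta>\<close>. So both
    \<open>m N\<close> and \<open>2 * m N\<close> are admissible values of \<open>n\<close> in
    \<open>step\<close>; the second is what gives the gap at the next scale.\<close>
  define m where "m N = nat \<lceil>real N powr \<beta>\<rceil> + 1" for N
  define s where "s k = ((\<lambda>N. m N * N) ^^ k) N0" for k
  have s: "s 0 = N0" "s (Suc k) = m (s k) * s k" for k by (simp_all add: s_def)
  have ge1: "real N powr \<beta> \<ge> 1" if "N \<ge> 1" for N using that \<beta> by (intro ge_one_powr_ge_zero) auto
  have m: "real N powr \<beta> \<le> real (m N)" "real (m N) \<le> 3 * real N powr \<beta>" "m N \<ge> 2" if "N \<ge> 1" for N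
  proof -
    show 1: "real N powr \<beta> \<le> real (m N)" unfolding m_def using real_nat_ceiling_ge[of "real N powr \<beta>"] by linarith
    have "1 \<le> real (nat \<lceil>real N powr \<beta>\<rceil>)" using ge1[OF that] real_nat_ceiling_ge[of "real N powr \<beta>"] by linarith
    then show "m N \<ge> 2" unfolding m_def by linarith
    have "real (nat \<lceil>real N powr \<beta>\<rceil>) \<le> real N powr \<beta> + 1" using ge1[OF that] by linarith
    then show "real (m N) \<le> 3 * real N powr \<beta>" unfolding m_def using ge1[OF that] by linarith
  qed
  have s1: "s k \<ge> 1 \<and> s k \<ge> 2 ^ k * N0" for k
  proof (induction k)
    case (Suc k)
    have "2 * (2 ^ k * N0) \<le> m (s k) * s k" using Suc m(3)[of "s k"] by (intro mult_mono) auto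
    moreover have "1 * 1 \<le> m (s k) * s k" using Suc m(3)[of "s k"] by (intro mult_mono) auto
    ultimately show ?case by (simp add: s)
  qed (use N0 in \<open>simp add: s\<close>)
  have sN0: "s k \<ge> N0" for k
  proof -
    have "1 * N0 \<le> 2 ^ k * N0" by (intro mult_le_mono) auto
    with s1[of k] show ?thesis by linarith
  qed
  define e where "e k = D * real (s k) powr (- \<beta>)" for k
  define E where "E = D * real N0 powr (- \<beta>)"
  have e: "0 \<le> e k" "e k \<le> E * q ^ k" for k
  proof -
    show "0 \<le> e k" using D by (simp add: e_def)
    have "real (2 ^ k * N0) \<le> real (s k)" using s1[of k] by (simp only: of_nat_le_iff)
    then have "real (s k) powr (- \<beta>) \<le> real (2 ^ k * N0) powr (- \<beta>)" using N0 \<beta> by (intro powr_mono2') auto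
    also have "\<dots> = (2 ^ k) powr (- \<beta>) * real N0 powr (- \<beta>)" by (simp add: powr_mult)
    also have "(2 ^ k) powr (- \<beta>) = q ^ k"
      unfolding q_def by (simp add: powr_realpow[symmetric] powr_powr mult.commute)
    finally show "e k \<le> E * q ^ k" unfolding e_def E_def using D by (simp add: mult_left_mono mult.assoc mult.commute[of "real N0 powr - \<beta>"])
  qed
  have Esum: "(\<Sum>i<k. e i) \<le> E / (1 - q)" for k
  proof -
    have E0: "E \<ge> 0" using D by (simp add: E_def)
    have "(\<Sum>i<k. e i) \<le> (\<Sum>i<k. E * q ^ i)" by (intro sum_mono e)
    also have "\<dots> = E * ((1 - q ^ k) / (1 - q))" using q by (simp add: sum_distrib_left[symmetric] sum_gp_strict)
    also have "\<dots> \<le> E * (1 / (1 - q))" using q E0 by (intro mult_left_mono divide_right_mono) auto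
    finally show ?thesis by simp
  qed
  define B where "B = 2 * \<bar>l N0 - l (2 * N0)\<bar> + 5 * (E / (1 - q))"
  have B: "B \<le> g / 4" using small by (simp add: B_def E_def q_def)
  \<comment> \<open>Two instances of \<open>step\<close> put the next value and its double both
    within \<open>e k\<close> of \<open>2 * l (2 * s k) - l (s k)\<close>. Hence the new gap is at
    most \<open>2 * e k\<close>, whatever the old one was, and the value moves by at most twice the
    old gap plus \<open>e k\<close>. The weight 2 on the gap closes the induction, with
    \<open>5 = 1 + 2 * 2\<close>.\<close>
  have inv: "\<bar>l (s k) - l N0\<bar> + 2 * \<bar>l (s k) - l (2 * s k)\<bar> \<le> 2 * \<bar>l N0 - l (2 * N0)\<bar> + 5 * (\<Sum>i<k. e i)" for k
  proof (induction k)
    case (Suc k)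
    have le: "\<bar>l (s k) - l N0\<bar> + 2 * \<bar>l (s k) - l (2 * s k)\<bar> \<le> B"
      using Suc Esum[of k] by (simp add: B_def)
    have a: "l (s k) \<ge> g" "l (s k) - l (2 * s k) \<le> g / 8"
    proof -
      define u v where "u = \<bar>l (s k) - l N0\<bar>" and "v = \<bar>l (s k) - l (2 * s k)\<bar>"
      have "u \<ge> 0" "v \<ge> 0" "l N0 - u \<le> l (s k)" "l (s k) - l (2 * s k) \<le> v" by (auto simp: u_def v_def)
      moreover have "u + 2 * v \<le> B" using le by (simp add: u_def v_def)
      ultimately show "l (s k) \<ge> g" "l (s k) - l (2 * s k) \<le> g / 8" using B g by linarith+
    qed
    have sk: "s k \<ge> 1" using s1 by blast
    have 1: "\<bar>l (m (s k) * s k) + l (s k) - 2 * l (2 * s k)\<bar> \<le> e k"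
      unfolding e_def using m[OF sk] ge1[OF sk] by (intro step sN0 a) auto
    have 2: "\<bar>l ((2 * m (s k)) * s k) + l (s k) - 2 * l (2 * s k)\<bar> \<le> e k"
      unfolding e_def using m[OF sk] ge1[OF sk] by (intro step sN0 a) auto
    have "\<bar>a - c\<bar> + 2 * \<bar>a - b\<bar> \<le> R + 5 * \<epsilon>"
      if "\<bar>a + p - 2 * p'\<bar> \<le> \<epsilon>" "\<bar>b + p - 2 * p'\<bar> \<le> \<epsilon>" "\<bar>p - c\<bar> + 2 * \<bar>p - p'\<bar> \<le> R" for a b c p p' \<epsilon> R :: real
      using that by (smt (verit))
    from this[OF 1 2 Suc] have "\<bar>l (m (s k) * s k) - l N0\<bar> + 2 * \<bar>l (m (s k) * s k) - l ((2 * m (s k)) * s k)\<bar>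
      \<le> 2 * \<bar>l N0 - l (2 * N0)\<bar> + 5 * (\<Sum>i<k. e i) + 5 * e k" .
    then show ?case by (simp add: s(2) mult.assoc)
  qed (simp add: s)
  have close: "\<bar>l (s k) - l N0\<bar> \<le> B" for k
  proof -
    have "\<bar>l (s k) - l N0\<bar> \<le> \<bar>l (s k) - l N0\<bar> + 2 * \<bar>l (s k) - l (2 * s k)\<bar>" by simp
    also note inv[of k]
    also have "2 * \<bar>l N0 - l (2 * N0)\<bar> + 5 * (\<Sum>i<k. e i) \<le> B"
      unfolding B_def using Esum[of k] by (intro add_left_mono mult_left_mono) auto
    finally show ?thesis .
  qed
  have "filterlim s at_top sequentially"
  proof (rule filterlim_at_top_mono[OF _ always_eventually])
    show "filterlim (\<lambda>k. k) at_top (sequentially :: nat filter)" by (rule filterlim_ident)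
    show "\<forall>k. k \<le> s k"
    proof
      fix k
      have "k \<le> 2 ^ k * 1" by (simp add: less_imp_le)
      also have "\<dots> \<le> 2 ^ k * N0" using N0 by (intro mult_le_mono) auto
      also have "\<dots> \<le> s k" using s1 by blast
      finally show "k \<le> s k" .
    qed
  qed
  then have "(\<lambda>k. l (s k)) \<longlonglongrightarrow> L" using lim by (rule filterlim_compose[rotated])
  then have "(\<lambda>k. \<bar>l (s k) - l N0\<bar>) \<longlonglongrightarrow> \<bar>L - l N0\<bar>" by (intro tendsto_intros)
  then have "\<bar>L - l N0\<bar> \<le> B" by (rule LIMSEQ_le_const2) (use close in auto)
  then show ?thesis by (simp add: B_def E_def q_def)
qed

subsection \<open>Integration over the torus\<close>

lemma torus_periodic_shift_axis:
  assumes "torus_periodic f" shows "f (x + of_int n *\<^sub>R axis i 1) = f (x :: real^'d)"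
proof -
  have "of_int n *\<^sub>R axis i 1 = (\<chi> j. real_of_int ((\<chi> j. if j = i then n else 0) $ j))"
    by (auto simp: vec_eq_iff axis_def)
  then show ?thesis using assms unfolding torus_periodic_def
    by metis
qed

text \<open>The shifted cube is cut along \<open>x $ i = 1\<close>; translated back by one period,
  the overhanging piece completes the other one to the unit cube.\<close>

lemma torus_integral_shift_axis01:
  fixes f :: "real ^ 'd::finite \<Rightarrow> real"
  assumes per: "torus_periodic f" and cont: "continuous_on UNIV f" and t: "0 \<le> t" "t \<le> 1"
  shows "integral (cbox 0 1) (\<lambda>x. f (x + t *\<^sub>R axis i 1)) = integral (cbox 0 1) f"
proof -
  define e :: "real^'d" where "e = axis i 1"
  have e: "e \<in> Basis" by (simp add: e_def)
  have ei: "x \<bullet> e = x $ i" for x by (simp add: e_def inner_axis)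
  have int: "f integrable_on cbox a b" for a b
    by (rule integrable_continuous) (rule continuous_on_subset[OF cont], simp)
  have ej: "e $ j = (if j = i then 1 else 0)" for j by (auto simp: e_def axis_def)
  have box: "x \<in> cbox a b \<longleftrightarrow> a$i \<le> x$i \<and> x$i \<le> b$i \<and> (\<forall>j. j \<noteq> i \<longrightarrow> a$j \<le> x$j \<and> x$j \<le> b$j)"
    for a b x :: "real^'d" by (metis mem_box_cart)
  have s1: "cbox (t *\<^sub>R e) (1 + t *\<^sub>R e) \<inter> {x. x \<bullet> e \<le> 1} = cbox (t *\<^sub>R e) 1"
    and s2: "cbox (t *\<^sub>R e) (1 + t *\<^sub>R e) \<inter> {x. x \<bullet> e \<ge> 1} = cbox e (1 + t *\<^sub>R e)"
    and s3: "cbox 0 1 \<inter> {x. x \<bullet> e \<le> t} = cbox 0 (1 - e + t *\<^sub>R e)"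
    and s4: "cbox 0 1 \<inter> {x. x \<bullet> e \<ge> t} = cbox (t *\<^sub>R e) 1"
    unfolding set_eq_iff Int_iff box mem_Collect_eq ei using t by (auto simp: ej)
  have sh: "integral (cbox (a - c) (b - c)) (\<lambda>x. f (x + c)) = integral (cbox a b) f" for a b c
    by (rule integral_shift_cbox)
  have "integral (cbox 0 1) (\<lambda>x. f (x + t *\<^sub>R e)) = integral (cbox (t *\<^sub>R e) (1 + t *\<^sub>R e)) f"
    using sh[of "t *\<^sub>R e" "t *\<^sub>R e" "1 + t *\<^sub>R e"] by simp
  also have "\<dots> = integral (cbox (t *\<^sub>R e) 1) f + integral (cbox e (1 + t *\<^sub>R e)) f"
    using integral_split[OF int e, of "t *\<^sub>R e" "1 + t *\<^sub>R e" 1] unfolding s1 s2 .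
  also have "integral (cbox e (1 + t *\<^sub>R e)) f = integral (cbox 0 (1 - e + t *\<^sub>R e)) (\<lambda>x. f (x + e))"
    using sh[of e e "1 + t *\<^sub>R e"] by (simp add: algebra_simps)
  also have "(\<lambda>x. f (x + e)) = f"
    using torus_periodic_shift_axis[OF per, of _ 1 i] by (simp add: e_def)
  also have "integral (cbox (t *\<^sub>R e) 1) f + integral (cbox 0 (1 - e + t *\<^sub>R e)) f = integral (cbox 0 1) f"
    using integral_split[OF int e, of 0 1 t] unfolding s3 s4 by simp
  finally show ?thesis by (simp add: e_def)
qed

lemma torus_integral_shift:
  fixes f :: "real ^ 'd::finite \<Rightarrow> real"
  assumes per: "torus_periodic f" and cont: "continuous_on UNIV f"
  shows "integral (cbox 0 1) (\<lambda>x. f (x + y)) = integral (cbox 0 1) f"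
proof -
  have shift: "torus_periodic (\<lambda>x. f (x + y))" "continuous_on UNIV (\<lambda>x. f (x + y))"
    if "torus_periodic f" "continuous_on UNIV f" for y and f :: "real^'d \<Rightarrow> real"
  proof -
    show "torus_periodic (\<lambda>x. f (x + y))"
      using that(1) unfolding torus_periodic_def by (metis add.assoc add.commute)
    show "continuous_on UNIV (\<lambda>x. f (x + y))"
      by (rule continuous_on_compose2[OF that(2)]) (auto intro!: continuous_intros)
  qed
  have axis: "integral (cbox 0 1) (\<lambda>x. f (x + t *\<^sub>R axis i 1)) = integral (cbox 0 1) f"
    if f: "torus_periodic f" "continuous_on UNIV f" for t i and f :: "real^'d \<Rightarrow> real"
  proof -
    have "f (x + t *\<^sub>R axis i 1) = f (x + frac t *\<^sub>R axis i 1)" for x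
      using torus_periodic_shift_axis[OF f(1), of "x + frac t *\<^sub>R axis i 1" "\<lfloor>t\<rfloor>" i]
      by (simp add: frac_def algebra_simps)
    then show ?thesis
      using torus_integral_shift_axis01[OF f, of "frac t" i] by (simp add: frac_lt_1 less_imp_le)
  qed
  have "integral (cbox 0 1) (\<lambda>x. f (x + (\<Sum>i\<in>S. y$i *\<^sub>R axis i 1))) = integral (cbox 0 1) f" for S
    using finite[of S]
  proof (induction S rule: finite_induct)
    case (insert i S)
    show ?case
      using axis[OF shift[OF per cont, of "\<Sum>i\<in>S. y$i *\<^sub>R axis i 1"], of "y$i" i] insert
      by (simp add: algebra_simps)
  qed simp
  from this[of UNIV] show ?thesis
    by (simp add: basis_expansion[of y, unfolded scalar_mult_eq_scaleR])
qed

lemma integral_sum_shifts: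
  assumes f: "torus_periodic f" "continuous_on UNIV f" and F: "finite F"
  shows "integral (cbox 0 1) (\<lambda>x::real^'d::finite. \<Sum>j\<in>F. f (x + y j) :: real) = real (card F) * integral (cbox 0 1) f"
proof -
  have "integral (cbox 0 1) (\<lambda>x. \<Sum>j\<in>F. f (x + y j)) = (\<Sum>j\<in>F. integral (cbox 0 1) (\<lambda>x. f (x + y j)))"
    by (intro integral_sum F integrable_continuous continuous_on_compose2[OF f(2)] continuous_intros) auto
  then show ?thesis by (simp add: torus_integral_shift[OF f])
qed

subsection \<open>Products of unimodular matrices\<close>

lemma norm_mat2:
  fixes A :: "complex^2^2"
  shows "(norm A)\<^sup>2 = (cmod (A$1$1))\<^sup>2 + (cmod (A$1$2))\<^sup>2 + (cmod (A$2$1))\<^sup>2 + (cmod (A$2$2))\<^sup>2"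
  by (simp add: norm_vec_def L2_set_def sum_2 sum_nonneg)

lemma mat2_mult:
  fixes A B :: "complex^2^2"
  shows "(A ** B)$i$j = A$i$1 * B$1$j + A$i$2 * B$2$j"
  by (simp add: matrix_matrix_mult_def sum_2)

lemma norm_matrix_mult_le:
  fixes A :: "complex^2^2" and B :: "complex^2^2"
  shows "norm (A ** B) \<le> norm A * norm B"
proof -
  have cs: "(cmod (a*b+c*d))\<^sup>2 \<le> ((cmod a)\<^sup>2 + (cmod c)\<^sup>2) * ((cmod b)\<^sup>2 + (cmod d)\<^sup>2)" for a b c d
  proof -
    have "cmod (a*b+c*d) \<le> cmod a * cmod b + cmod c * cmod d"
      by (metis norm_mult norm_triangle_ineq)
    then have "(cmod (a*b+c*d))\<^sup>2 \<le> (cmod a * cmod b + cmod c * cmod d)\<^sup>2"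
      by (intro power_mono) auto
    also have "\<dots> \<le> ((cmod a)\<^sup>2 + (cmod c)\<^sup>2) * ((cmod b)\<^sup>2 + (cmod d)\<^sup>2)"
      using zero_le_power2[of "cmod a * cmod d - cmod c * cmod b"]
      by (simp add: power2_eq_square algebra_simps)
    finally show ?thesis .
  qed
  have "(norm (A ** B))\<^sup>2 \<le> (norm A * norm B)\<^sup>2"
    unfolding power_mult_distrib norm_mat2 mat2_mult
    using cs[of "A$1$1" "B$1$1" "A$1$2" "B$2$1"] cs[of "A$1$1" "B$1$2" "A$1$2" "B$2$2"]
      cs[of "A$2$1" "B$1$1" "A$2$2" "B$2$1"] cs[of "A$2$1" "B$1$2" "A$2$2" "B$2$2"]
    by (simp add: algebra_simps)
  then show ?thesis by (rule power2_le_imp_le) simp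
qed

lemma norm_ge_1_mat2:
  fixes A :: "complex^2^2"
  assumes "det A = 1"
  shows "norm A \<ge> 1"
proof -
  have "A$1$1 * A$2$2 - A$1$2 * A$2$1 = 1" using assms unfolding det_2 .
  then have "1 = cmod (A$1$1 * A$2$2 - A$1$2 * A$2$1)" by (metis norm_one)
  also have "\<dots> \<le> cmod (A$1$1) * cmod (A$2$2) + cmod (A$1$2) * cmod (A$2$1)"
    unfolding norm_mult[symmetric] by (rule norm_triangle_ineq4)
  finally have *: "1 \<le> cmod (A$1$1) * cmod (A$2$2) + cmod (A$1$2) * cmod (A$2$1)" .
  have "2 * cmod (A$1$1) * cmod (A$2$2) \<le> (cmod (A$1$1))\<^sup>2 + (cmod (A$2$2))\<^sup>2"
    "2 * cmod (A$1$2) * cmod (A$2$1) \<le> (cmod (A$1$2))\<^sup>2 + (cmod (A$2$1))\<^sup>2"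
    by (rule sum_squares_bound)+
  with * have "1 \<le> (cmod (A$1$1))\<^sup>2 + (cmod (A$1$2))\<^sup>2 + (cmod (A$2$1))\<^sup>2 + (cmod (A$2$2))\<^sup>2"
    by linarith
  then have "1\<^sup>2 \<le> (norm A)\<^sup>2" unfolding norm_mat2 by simp
  then show ?thesis by (rule power2_le_imp_le) simp
qed

lemma norm_vec2: "(norm (v :: 'a::real_normed_vector ^2))\<^sup>2 = (norm (v$1))\<^sup>2 + (norm (v$2))\<^sup>2"
  by (simp add: norm_vec_def L2_set_def sum_2 sum_nonneg)
text \<open>The inverse of a unimodular 2x2 matrix is its adjugate \<open>Z\<close>, which has the
  same entries up to order and sign and therefore the same Frobenius norm.\<close>

lemma norm_le_mult_det_1:
  fixes X Y :: "complex^2^2"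
  assumes "det Y = 1"
  shows "norm X \<le> norm (X ** Y) * norm Y" "norm X \<le> norm Y * norm (Y ** X)"
proof -
  define Z :: "complex^2^2" where "Z = (\<chi> i j. if i = j then (if i = 1 then Y$2$2 else Y$1$1) else - Y$i$j)"
  have Z: "Z$1$1 = Y$2$2" "Z$2$2 = Y$1$1" "Z$1$2 = - Y$1$2" "Z$2$1 = - Y$2$1" by (auto simp: Z_def)
  have "(norm Z)\<^sup>2 = (norm Y)\<^sup>2" unfolding norm_mat2 Z by simp
  then have nZ: "norm Z = norm Y" by (simp add: power2_eq_iff_nonneg)
  have dt: "Y$1$1 * Y$2$2 - Y$1$2 * Y$2$1 = 1" using assms by (simp only: det_2)
  have "Y ** Z = mat 1" "Z ** Y = mat 1"
    unfolding vec_eq_iff forall_2 mat2_mult Z mat_def using dt by (simp_all add: algebra_simps)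
  then have "(X ** Y) ** Z = X" "Z ** (Y ** X) = X"
    by (simp_all add: matrix_mul_assoc[symmetric]) (simp add: matrix_mul_assoc)
  then show "norm X \<le> norm (X ** Y) * norm Y" "norm X \<le> norm Y * norm (Y ** X)"
    using norm_matrix_mult_le[of "X ** Y" Z] norm_matrix_mult_le[of Z "Y ** X"] nZ by simp_all
qed

text \<open>Tensor product of two matrices. It turns a product of two norms into a single norm, so
  that two such products can be compared by the triangle inequality.\<close>

definition tens :: "complex^2^2 \<Rightarrow> complex^2^2 \<Rightarrow> complex^2^2^2^2" where
  "tens U V = (\<chi> a b c d. U$a$b * V$c$d)"

lemma norm_tens: "norm (tens U V) = norm U * norm V"
proof -
  have "(norm (tens U V))\<^sup>2 = (norm U * norm V)\<^sup>2"
    unfolding power_mult_distrib norm_vec2 tens_def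
    by (simp add: norm_mult power_mult_distrib distrib_left distrib_right)
  then show ?thesis by (simp add: power2_eq_iff_nonneg)
qed
text \<open>For a rank-one \<open>Y\<close> the two products below agree after permuting tensor factors.\<close>

lemma norm_mult_rank_one_defect:
  fixes X Y Z :: "complex^2^2"
  shows "\<bar>norm (X ** Y ** Z) * norm Y - norm (X ** Y) * norm (Y ** Z)\<bar> \<le> norm X * norm Z * cmod (det Y)"
proof -
  define J :: "complex^2^2" where "J = (\<chi> i j. if i = j then 0 else if i = 1 then 1 else -1)"
  have J: "J$1$1 = 0" "J$1$2 = 1" "J$2$1 = -1" "J$2$2 = 0" by (auto simp: J_def)
  define P where "P = (\<chi> a b c d. (X ** Y) $ a $ d * (Y ** Z) $ c $ b)"
  have nP: "norm P = norm (X ** Y) * norm (Y ** Z)"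
  proof -
    have "(norm P)\<^sup>2 = (norm (X ** Y) * norm (Y ** Z))\<^sup>2"
      unfolding power_mult_distrib norm_vec2 P_def
      by (simp add: norm_mult power_mult_distrib distrib_left distrib_right)
    then show ?thesis by (simp add: power2_eq_iff_nonneg)
  qed
  define Q where "Q = (\<chi> a b c d. det Y * ((X ** J) $ a $ c * (J ** Z) $ d $ b))"
  have "(norm (X ** J))\<^sup>2 = (norm X)\<^sup>2" "(norm (J ** Z))\<^sup>2 = (norm Z)\<^sup>2"
    unfolding norm_mat2 mat2_mult J by simp_all
  then have nJ: "norm (X ** J) = norm X" "norm (J ** Z) = norm Z"
    by (simp_all add: power2_eq_iff_nonneg)
  have nQ: "norm Q = norm X * norm Z * cmod (det Y)"
  proof -
    have "(norm Q)\<^sup>2 = (cmod (det Y) * (norm (X ** J) * norm (J ** Z)))\<^sup>2"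
      unfolding power_mult_distrib norm_vec2 Q_def
      by (simp add: norm_mult power_mult_distrib distrib_left distrib_right)
    then show ?thesis by (simp add: power2_eq_iff_nonneg nJ)
  qed
  \<comment> \<open>This is the minor identity
    \<open>Y$p$q * Y$c$d - Y$p$d * Y$c$q = det Y * J$p$c * J$q$d\<close> contracted with
    \<open>X\<close> and \<open>Z\<close>. The minus sign comes from the antisymmetry of
    \<open>J\<close>, whose indices are exchanged in \<open>J ** Z\<close>.\<close>
  have eq: "tens (X ** Y ** Z) Y - P = - Q"
    unfolding vec_eq_iff forall_2
    by (simp add: tens_def P_def Q_def mat2_mult J det_2 algebra_simps)
  have "\<bar>norm (tens (X ** Y ** Z) Y) - norm P\<bar> \<le> norm (tens (X ** Y ** Z) Y - P)"
    by (rule norm_triangle_ineq3)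
  then show ?thesis by (simp add: eq norm_tens nP nQ)
qed

text \<open>A crude form of the avalanche principle: an error of \<open>ln 2\<close> per factor is affordable here
  because the factors are long products themselves.\<close>

lemma avalanche_principle:
  fixes A P :: "nat \<Rightarrow> complex^2^2"
  assumes P: "P 0 = mat 1" "\<And>j. P (Suc j) = A j ** P j"
    and det: "\<And>j. det (A j) = 1"
    and kap: "0 < k" "k \<le> 1" "\<And>j. Suc j < n \<Longrightarrow> k * (norm (A (Suc j)) * norm (A j)) \<le> norm (A (Suc j) ** A j)"
    and mu: "\<And>j. j < n \<Longrightarrow> 2 \<le> k * norm (A j)"
    and n: "n \<ge> 2"
  shows "\<bar>ln (norm (P n)) + (\<Sum>j=1..<n-1. ln (norm (A j))) - (\<Sum>j<n-1. ln (norm (A (Suc j) ** A j)))\<bar> \<le> n * ln 2"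
proof -
  have detP: "det (P j) = 1" for j by (induction j) (auto simp: P det_mul det)
  have ge1: "norm (A j) \<ge> 1" "norm (P j) \<ge> 1" "norm (A (Suc j) ** A j) \<ge> 1" for j
    by (auto intro!: norm_ge_1_mat2 simp: det detP det_mul)
  define a where "a j = norm (A j)" for j
  define b where "b j = norm (A (Suc j) ** A j)" for j
  define p where "p j = norm (P j)" for j
  have pos: "a j > 0" "b j > 0" "p j > 0" for j
    using ge1[of j] by (auto simp: a_def b_def p_def intro: less_le_trans[of 0 1])
  have P1: "P (Suc 0) = A 0" by (simp add: P)
  \<comment> \<open>Here the middle factor \<open>A j\<close> has determinant 1, and
    \<open>A j ** P j\<close> is \<open>P (Suc j)\<close>.\<close>
  have defect: "\<bar>p (Suc (Suc j)) * a j - b j * p (Suc j)\<bar> \<le> a (Suc j) * p j" for j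
    using norm_mult_rank_one_defect[of "A (Suc j)" "A j" "P j"]
    by (simp add: a_def b_def p_def P det matrix_mul_assoc)
  \<comment> \<open>\<open>main\<close> says that \<open>A j\<close> does not contract the leading
    direction of \<open>P j\<close> much. Together with the lower bounds on
    \<open>k * norm (A j)\<close> and on the products of neighbours it makes the defect at most half
    of \<open>b j * p (Suc j)\<close>; this is \<open>step\<close>, and it returns
    \<open>main\<close> for the next index. The factor 2 in \<open>main\<close> also covers the
    start, where \<open>norm (mat 1) \<le> 2\<close>.\<close>
  have main: "j < n \<Longrightarrow> k * (a j * p j) \<le> 2 * p (Suc j)" 
    and step: "Suc j < n \<Longrightarrow> k * (a j * p j) \<le> 2 * p (Suc j) \<Longrightarrow> a (Suc j) * p j * 2 \<le> b j * p (Suc j)" for j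
  proof -
    show step: "a (Suc j) * p j * 2 \<le> b j * p (Suc j)" if "Suc j < n" "k * (a j * p j) \<le> 2 * p (Suc j)" for j
    proof -
      have 2: "2 \<le> k * a j" using mu[of j] that by (simp add: a_def)
      have "4 * (a (Suc j) * p j) \<le> ((k * a j) * (k * a j)) * (a (Suc j) * p j)"
        using mult_mono[OF 2 2] 2 pos by (intro mult_right_mono mult_nonneg_nonneg) (auto intro: less_imp_le)
      also have "\<dots> = (k * (a (Suc j) * a j)) * (k * (a j * p j))" by (simp add: algebra_simps)
      also have "\<dots> \<le> b j * (2 * p (Suc j))"
        using kap(3)[of j] that pos kap(1) unfolding a_def[symmetric] b_def[symmetric]
        by (intro mult_mono[of "k * (a (Suc j) * a j)" _ "k * (a j * p j)"]) (auto intro!: less_imp_le[OF mult_pos_pos] less_imp_le[OF pos(2)])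
      finally show ?thesis by (simp add: mult_ac)
    qed
    show "k * (a j * p j) \<le> 2 * p (Suc j)" if "j < n" for j
      using that
    proof (induction j)
      case 0
      have "norm (mat 1 :: complex^2^2) \<le> 2"
        by (rule power2_le_imp_le) (simp_all add: norm_mat2 mat_def)
      then have "a 0 * p 0 \<le> 2 * a 0" using pos(1)[of 0] by (simp add: p_def P)
      moreover have "k * (a 0 * p 0) \<le> a 0 * p 0"
        using kap(2) pos[of 0] by (intro mult_left_le_one_le) (auto simp: less_imp_le kap(1))
      moreover have "p (Suc 0) = a 0" by (simp add: p_def a_def P1)
      ultimately show ?case by linarith
    next
      case (Suc j)
      have s: "a (Suc j) * p j * 2 \<le> b j * p (Suc j)" using step Suc by simp
      have "a j * (k * (a (Suc j) * p (Suc j))) = (k * (a (Suc j) * a j)) * p (Suc j)" by simp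
      also have "\<dots> \<le> b j * p (Suc j)"
        using kap(3)[of j] Suc.prems pos(3) unfolding a_def[symmetric] b_def[symmetric]
        by (intro mult_right_mono) (auto intro: less_imp_le)
      also have "\<dots> \<le> a j * (2 * p (Suc (Suc j)))"
        using s defect[of j] by (simp add: algebra_simps abs_le_iff)
      finally show ?case using pos(1)[of j] by (simp add: mult_le_cancel_left_pos)
    qed
  qed
  have est: "\<bar>ln (p (Suc (Suc j))) - ln (p (Suc j)) + ln (a j) - ln (b j)\<bar> \<le> ln 2" if "j < n - 1" for j
  proof -
    have s: "a (Suc j) * p j * 2 \<le> b j * p (Suc j)" using step[OF _ main[of j]] that by simp
    have "b j * p (Suc j) \<le> 2 * (p (Suc (Suc j)) * a j)" "p (Suc (Suc j)) * a j \<le> 2 * (b j * p (Suc j))"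
      using s defect[of j] pos by (simp_all add: algebra_simps abs_le_iff)
    then have "ln (b j * p (Suc j)) \<le> ln (2 * (p (Suc (Suc j)) * a j))"
      "ln (p (Suc (Suc j)) * a j) \<le> ln (2 * (b j * p (Suc j)))"
      using pos by (subst ln_le_cancel_iff; simp)+
    moreover have "a j \<noteq> 0" "b j \<noteq> 0" "p j \<noteq> 0" for j using pos[of j] by auto
    ultimately show ?thesis by (simp add: ln_mult abs_le_iff)
  qed
  have sp: "(\<Sum>j<n-1. ln (a j)) = ln (a 0) + (\<Sum>j=1..<n-1. ln (a j))"
    using n sum.atLeast_Suc_lessThan[of 0 "n-1" "\<lambda>j. ln (a j)"] by (simp add: atLeast0LessThan)
  have tel: "(\<Sum>j<n-1. ln (p (Suc (Suc j))) - ln (p (Suc j))) = ln (p n) - ln (p (Suc 0))"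
    using n sum_lessThan_telescope[of "\<lambda>j. ln (p (Suc j))" "n-1"] by simp
  have "ln (p n) + (\<Sum>j=1..<n-1. ln (a j)) - (\<Sum>j<n-1. ln (b j))
      = (\<Sum>j<n-1. ln (p (Suc (Suc j))) - ln (p (Suc j)) + ln (a j) - ln (b j))"
    using sp tel by (simp add: sum.distrib sum_subtractf p_def a_def P1)
  also have "\<bar>\<dots>\<bar> \<le> (\<Sum>j<n-1. ln 2)"
    by (rule order_trans[OF sum_abs sum_mono]) (use est in auto)
  also have "\<dots> \<le> n * ln 2" by simp
  finally show ?thesis by (simp add: a_def b_def p_def)
qed

subsection \<open>Logarithms of cocycle iterates\<close>

text \<open>Here \<open>norm\<close> is the Frobenius norm. It is comparable to the operator norm, which is all that the
  limit in \<open>lyapunov\<close> sees.\<close>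

definition log_iter :: "(real ^ 'd::finite \<Rightarrow> complex ^ 2 ^ 2) \<Rightarrow> real ^ 'd \<Rightarrow> nat \<Rightarrow> real ^ 'd \<Rightarrow> real" where
  "log_iter A \<omega> N x = ln (norm (cocycle_iterate A \<omega> N x))"

definition bounded_cocycle :: "real \<Rightarrow> (real ^ 'd::finite \<Rightarrow> complex ^ 2 ^ 2) \<Rightarrow> bool" where
  "bounded_cocycle M A \<longleftrightarrow> torus_periodic A \<and> continuous_on UNIV A \<and> (\<forall>x. det (A x) = 1 \<and> norm (A x) \<le> M)"

lemma bounded_cocycle_ge_1: "bounded_cocycle M A \<Longrightarrow> M \<ge> 1"
  unfolding bounded_cocycle_def using norm_ge_1_mat2 by (meson order_trans)

lemma det_iterate:
  assumes "\<And>x. det (A x) = 1" shows "det (cocycle_iterate A \<omega> N x) = 1"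
  by (induction N) (simp_all add: det_mul assms)

lemma iterate_add:
  "cocycle_iterate A \<omega> (N + K) x = cocycle_iterate A \<omega> K (x + real N *\<^sub>R \<omega>) ** cocycle_iterate A \<omega> N x"
  by (induction K) (simp_all add: matrix_mul_assoc algebra_simps)

lemma iterate_periodic: 
  assumes "torus_periodic A" shows "torus_periodic (cocycle_iterate A \<omega> N)"
proof -
  have "A (x + (\<chi> i. of_int (k $ i)) + y) = A (x + y)" for x y and k :: "int ^ 'a"
    using assms unfolding torus_periodic_def by (metis add.assoc add.commute)
  then have "cocycle_iterate A \<omega> N (x + (\<chi> i. of_int (k $ i))) = cocycle_iterate A \<omega> N x" for x and k :: "int ^ 'a"
    by (induction N) simp_all
  then show ?thesis by (simp add: torus_periodic_def)
qed

lemma continuous_on_matrix_mult2: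
  fixes f g :: "'a::topological_space \<Rightarrow> complex^2^2"
  assumes "continuous_on S f" "continuous_on S g"
  shows "continuous_on S (\<lambda>x. f x ** g x)"
  unfolding matrix_matrix_mult_def by (intro continuous_intros assms)

lemma continuous_iterate:
  assumes "continuous_on UNIV A" shows "continuous_on UNIV (cocycle_iterate A \<omega> N)"
proof (induction N)
  case (Suc N)
  have "continuous_on UNIV (\<lambda>x. A (x + real N *\<^sub>R \<omega>))"
    by (rule continuous_on_compose2[OF assms]) (auto intro!: continuous_intros)
  with Suc show ?case by (auto intro!: continuous_on_matrix_mult2)
qed simp

context
  fixes M :: real and A :: "real ^ 'd::finite \<Rightarrow> complex ^ 2 ^ 2"
  assumes A: "bounded_cocycle M A"
begin

lemma cocycle_facts: "det (A x) = 1" "norm (A x) \<le> M" "1 \<le> norm (A x)" "1 \<le> norm (cocycle_iterate A \<omega> N x)"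
  using A norm_ge_1_mat2 det_iterate unfolding bounded_cocycle_def by metis+

lemma log_iter_nonneg: "0 \<le> log_iter A \<omega> N x"
  unfolding log_iter_def using cocycle_facts(4) by simp

lemma log_iter_periodic: "torus_periodic (log_iter A \<omega> N)"
  using iterate_periodic[of A \<omega> N] A unfolding log_iter_def torus_periodic_def bounded_cocycle_def by simp

lemma log_iter_continuous: "continuous_on UNIV (log_iter A \<omega> N)"
proof -
  have "norm (cocycle_iterate A \<omega> N x) \<noteq> 0" for x using cocycle_facts(4)[of \<omega> N x] by auto
  moreover have "continuous_on UNIV (cocycle_iterate A \<omega> N)"
    using A by (intro continuous_iterate) (simp add: bounded_cocycle_def)
  ultimately show ?thesis unfolding log_iter_def[abs_def] by (intro continuous_intros) auto
qed

lemma log_iter_add_le: "log_iter A \<omega> (N + K) x \<le> log_iter A \<omega> K (x + real N *\<^sub>R \<omega>) + log_iter A \<omega> N x"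
proof -
  have p: "norm (cocycle_iterate A \<omega> N x) > 0" for N x using cocycle_facts(4)[of \<omega> N x] by linarith
  have "log_iter A \<omega> (N + K) x \<le> ln (norm (cocycle_iterate A \<omega> K (x + real N *\<^sub>R \<omega>)) * norm (cocycle_iterate A \<omega> N x))"
    unfolding log_iter_def iterate_add using p
    by (intro ln_mono norm_matrix_mult_le) (simp_all add: iterate_add[symmetric])
  also have "\<dots> = log_iter A \<omega> K (x + real N *\<^sub>R \<omega>) + log_iter A \<omega> N x"
    unfolding log_iter_def using p[of K "x + real N *\<^sub>R \<omega>"] p[of N x] by (simp add: ln_mult_pos)
  finally show ?thesis .
qed

lemma log_iter_1: "log_iter A \<omega> (Suc 0) x \<le> ln M"
  unfolding log_iter_def using cocycle_facts(2,3)[of x] by (intro ln_mono) auto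

lemma log_iter_le: "N \<ge> 1 \<Longrightarrow> log_iter A \<omega> N x \<le> real N * ln M"
proof (induction N rule: nat_induct_at_least)
  case base
  show ?case using log_iter_1[of \<omega> x] by simp
next
  case (Suc N)
  have "log_iter A \<omega> (N + 1) x \<le> log_iter A \<omega> 1 (x + real N *\<^sub>R \<omega>) + log_iter A \<omega> N x"
    by (rule log_iter_add_le)
  with Suc log_iter_1[of \<omega> "x + real N *\<^sub>R \<omega>"] show ?case by (simp add: algebra_simps)
qed

text \<open>The iterates at \<open>x + \<omega>\<close> and at \<open>x\<close> satisfy
  \<open>A\<^sub>N(x + \<omega>) A(x) = A(x + N \<omega>) A\<^sub>N(x)\<close>, so they differ by
  one factor on each side. Removing a unimodular factor costs at most its norm, and the bound does
  not grow with \<open>N\<close>.\<close>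

lemma log_iter_step: "\<bar>log_iter A \<omega> N (x + \<omega>) - log_iter A \<omega> N x\<bar> \<le> 2 * ln M"
proof -
  let ?X = "cocycle_iterate A \<omega> N (x + \<omega>)" and ?Y = "cocycle_iterate A \<omega> N x"
  have M: "M > 0" using bounded_cocycle_ge_1[OF A] by simp
  have e: "?X ** A x = A (x + real N *\<^sub>R \<omega>) ** ?Y"
    using iterate_add[of A \<omega> 1 N x] iterate_add[of A \<omega> N 1 x] by (simp add: add.commute)
  have p: "norm ?X > 0" "norm ?Y > 0" using cocycle_facts(4)[of \<omega> N] by (meson less_le_trans zero_less_one)+
  have "norm ?X \<le> norm (A (x + real N *\<^sub>R \<omega>) ** ?Y) * norm (A x)"
    using norm_le_mult_det_1(1)[OF cocycle_facts(1)[of x], of ?X] by (simp add: e)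
  also have "\<dots> \<le> (M * norm ?Y) * M"
    using cocycle_facts(2) M by (intro mult_mono order_trans[OF norm_matrix_mult_le] mult_right_mono) auto
  finally have "ln (norm ?X) \<le> ln (M * norm ?Y * M)" using p by (intro ln_mono) auto
  also have "\<dots> = 2 * ln M + ln (norm ?Y)" using p(2) M by (simp add: ln_mult)
  finally have 1: "ln (norm ?X) \<le> 2 * ln M + ln (norm ?Y)" .
  have "norm ?Y \<le> norm (A (x + real N *\<^sub>R \<omega>)) * norm (?X ** A x)"
    using norm_le_mult_det_1(2)[OF cocycle_facts(1)[of "x + real N *\<^sub>R \<omega>"], of ?Y] by (simp add: e)
  also have "\<dots> \<le> M * (norm ?X * M)"
    using cocycle_facts(2) M by (intro mult_mono order_trans[OF norm_matrix_mult_le] mult_left_mono) auto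
  finally have "ln (norm ?Y) \<le> ln (M * (norm ?X * M))" using p by (intro ln_mono) auto
  also have "\<dots> = 2 * ln M + ln (norm ?X)" using p(1) M by (simp add: ln_mult)
  finally show ?thesis using 1 by (simp add: log_iter_def abs_le_iff)
qed

lemma log_iter_steps: "\<bar>log_iter A \<omega> N (x + real j *\<^sub>R \<omega>) - log_iter A \<omega> N x\<bar> \<le> 2 * ln M * real j"
proof (induction j)
  case (Suc j)
  have "x + real (Suc j) *\<^sub>R \<omega> = (x + real j *\<^sub>R \<omega>) + \<omega>" by (simp add: algebra_simps)
  with Suc log_iter_step[of \<omega> N "x + real j *\<^sub>R \<omega>"] show ?case by (simp add: algebra_simps)
qed simp

end

subsection \<open>A quantitative Kronecker theorem\<close>

lemma sin_ge_chord:
  assumes "0 \<le> x" "x \<le> pi / 2" shows "2 * x / pi \<le> sin x"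
proof -
  have cv: "convex_on {0..pi/2} (\<lambda>x. - sin x)"
  proof (rule f''_ge0_imp_convex)
    show "((\<lambda>x. - sin x) has_real_derivative - cos x) (at x)" for x :: real
      by (auto intro!: derivative_eq_intros)
    show "((\<lambda>x. - cos x) has_real_derivative sin x) (at x)" for x :: real
      by (auto intro!: derivative_eq_intros)
  qed (auto intro: sin_ge_zero)
  define t where "t = 2 * x / pi"
  have t: "0 \<le> t" "t \<le> 1" using assms by (auto simp: t_def field_simps)
  have "- sin ((1 - t) *\<^sub>R 0 + t *\<^sub>R (pi/2)) \<le> (1 - t) * (- sin 0) + t * (- sin (pi/2))"
    using t by (intro convex_onD[OF cv]) auto
  then show ?thesis by (simp add: t_def)
qed

lemma abs_sin_pi_ge:
  "2 * \<bar>x - of_int (round x)\<bar> \<le> \<bar>sin (pi * x)\<bar>"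
proof -
  define u where "u = x - of_int (round x)"
  have u: "\<bar>u\<bar> \<le> 1/2" using of_int_round_abs_le[of x] by (simp add: u_def abs_minus_commute)
  have "sin (pi * x) = sin (pi * u + of_int (round x) * pi)" by (simp add: u_def algebra_simps)
  also have "\<bar>\<dots>\<bar> = \<bar>sin (pi * u)\<bar>"
  proof -
    have s: "sin (of_int (round x) * pi) = 0" by (auto simp: sin_zero_iff_int2)
    then have "(cos (of_int (round x) * pi))\<^sup>2 = 1"
      using sin_cos_squared_add2[of "of_int (round x) * pi"] by (simp add: power2_eq_square)
    then have "\<bar>cos (of_int (round x) * pi)\<bar> = 1" by (metis abs_1 power2_eq_1_iff abs_minus)
    then show ?thesis by (simp add: sin_add s abs_mult)
  qed
  also have "\<dots> = \<bar>sin (pi * \<bar>u\<bar>)\<bar>" by (cases "u \<ge> 0") auto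
  also have "2 * (pi * \<bar>u\<bar>) / pi \<le> \<bar>sin (pi * \<bar>u\<bar>)\<bar>"
    using u by (intro order_trans[OF sin_ge_chord]) (auto simp: field_simps)
  finally show ?thesis by (simp add: u_def)
qed

lemma abs_sin_pi_ge_infdist: "2 * infdist x \<int> \<le> \<bar>sin (pi * x)\<bar>"
  using abs_sin_pi_ge[of x] infdist_le[of "of_int (round x)" \<int> x] by (simp add: dist_real_def)

lemma cmod_one_minus_cis: "cmod (1 - cis (2 * pi * x)) = 2 * \<bar>sin (pi * x)\<bar>"
proof -
  have "1 - cis (2 * pi * x) = - (2 * \<i> * of_real (sin (pi * x)) * cis (pi * x))"
    using sin_double[of "pi * x"] cos_double_sin[of "pi * x"]
    by (simp add: complex_eq_iff power2_eq_square mult.assoc)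
  then show ?thesis by (simp add: norm_mult)
qed

lemma norm_sum_cis_le:
  assumes "sin (pi * x) \<noteq> 0"
  shows "cmod (\<Sum>j<K. cis (2 * pi * (real j * x))) \<le> 1 / \<bar>sin (pi * x)\<bar>"
proof -
  define z where "z = cis (2 * pi * x)"
  have n: "cmod (1 - z) = 2 * \<bar>sin (pi * x)\<bar>" unfolding z_def by (rule cmod_one_minus_cis)
  then have z1: "z \<noteq> 1" using assms by auto
  have "(\<Sum>j<K. cis (2 * pi * (real j * x))) = (\<Sum>j<K. z ^ j)"
    unfolding z_def by (intro sum.cong refl) (simp add: Complex.DeMoivre mult_ac)
  also have "\<dots> = (1 - z ^ K) / (1 - z)" using z1 by (simp add: sum_gp_strict)
  also have "cmod \<dots> \<le> 2 / (2 * \<bar>sin (pi * x)\<bar>)"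
  proof -
    have "cmod (1 - z ^ K) \<le> 1 + 1"
      by (rule order_trans[OF norm_triangle_ineq4]) (simp add: z_def norm_power)
    then show ?thesis unfolding norm_divide n by (intro divide_right_mono) auto
  qed
  finally show ?thesis by simp
qed

text \<open>A non-negative kernel that concentrates at the integers as \<open>m\<close> grows. Its
  Fourier weights are binomial probabilities on the frequencies from \<open>-m\<close> to
  \<open>m\<close>, with weight \<open>(2m choose m) / 4^m\<close> at frequency zero.\<close>

lemma cos_power_expansion:
  "complex_of_real (cos (pi * x) ^ (2 * m)) =
     (\<Sum>l\<le>2*m. of_real (real (2 * m choose l) / 4 ^ m) * cis (2 * pi * ((real l - real m) * x)))"
proof -
  have c: "complex_of_real (cos (pi * x)) = cis (- (pi * x)) * ((1 + cis (2 * pi * x)) / 2)"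
  proof -
    have "1 + cis (2 * (pi * x)) = 2 * of_real (cos (pi * x)) * cis (pi * x)"
      unfolding complex_eq_iff by (simp add: sin_double cos_double_cos power2_eq_square)
    then show ?thesis by (simp add: cis_mult mult.assoc mult.left_commute[of "cis (- (pi * x))"])
  qed
  have "complex_of_real (cos (pi * x) ^ (2 * m)) = cis (- (pi * x)) ^ (2*m) * ((cis (2 * pi * x) + 1) ^ (2*m) / 4 ^ m)"
    unfolding of_real_power c power_mult_distrib power_divide by (simp add: power_mult add.commute)
  also have "\<dots> = (\<Sum>l\<le>2*m. of_real (real (2 * m choose l) / 4 ^ m) * (cis (- (pi * x)) ^ (2*m) * cis (2 * pi * x) ^ l))"
    by (simp add: binomial_ring sum_distrib_left sum_divide_distrib mult_ac)
  also have "\<dots> = (\<Sum>l\<le>2*m. of_real (real (2 * m choose l) / 4 ^ m) * cis (2 * pi * ((real l - real m) * x)))"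
    by (intro sum.cong refl) (simp add: Complex.DeMoivre cis_mult algebra_simps)
  finally show ?thesis .
qed

text \<open>Sum the product kernel centred at \<open>y\<close> along the orbit. Frequency zero
  contributes the left-hand side. At any other frequency \<open>k\<close> the orbit sum is
  geometric, hence at most \<open>1 / \<bar>sin (pi * (k \<bullet> \<omega>))\<bar>\<close>, which
  the Diophantine condition controls; the weights sum to 1, so the number of frequencies does not
  enter.\<close>

lemma diophantine_trig_average:
  fixes \<omega> y :: "real ^ 'd::finite"
  assumes dio: "diophantine \<kappa> b \<omega>" and \<kappa>: "\<kappa> > 0" and b: "b > 0" and m: "m > 0"
  shows "real K * (real (2 * m choose m) / 4 ^ m) ^ CARD('d) \<le>
     (\<Sum>j<K. \<Prod>i\<in>UNIV. cos (pi * (real j * \<omega>$i - y$i)) ^ (2 * m)) + (real CARD('d) * real m) powr b / (2 * \<kappa>)"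
proof -
  define c where "c l = real (2 * m choose l) / 4 ^ m" for l
  have c0: "c l \<ge> 0" for l by (simp add: c_def)
  have csum: "(\<Sum>l\<le>2*m. c l) = 1"
    unfolding c_def sum_divide_distrib[symmetric] of_nat_sum[symmetric]
    using choose_row_sum[of "2*m"] by (simp add: power_mult)
  define P where "P = PiE (UNIV :: 'd set) (\<lambda>_. {..2*m})"
  have finP: "finite P" unfolding P_def by (auto intro: finite_PiE)
  define Q where "Q g = (\<Prod>i\<in>UNIV. c (g i))" for g :: "'d \<Rightarrow> nat"
  have Q0: "Q g \<ge> 0" for g by (simp add: Q_def c0 prod_nonneg)
  have Qsum: "(\<Sum>g\<in>P. Q g) = 1"
    using prod_sum_PiE[of "UNIV :: 'd set" "\<lambda>_. {..2*m}" "\<lambda>_ l. c l"] by (simp add: P_def Q_def csum)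
  define k where "k g = ((\<chi> i. int (g i) - int m) :: int ^ 'd)" for g :: "'d \<Rightarrow> nat"
  define D where "D g = (\<Sum>i\<in>UNIV. of_int (k g $ i) * \<omega>$i)" for g
  define e where "e g = (\<Sum>i\<in>UNIV. of_int (k g $ i) * y$i)" for g
  define I where "I g = (\<Sum>j<K. cis (2 * pi * (real j * D g)))" for g
  have cisprod: "(\<Prod>i\<in>A. cis (u i)) = cis (\<Sum>i\<in>A. u i)" if "finite A" for A :: "'d set" and u
    using that by (induction A rule: finite_induct) (auto simp: cis_mult)
  have "complex_of_real (\<Sum>j<K. \<Prod>i\<in>UNIV. cos (pi * (real j * \<omega>$i - y$i)) ^ (2 * m)) =
     (\<Sum>j<K. \<Sum>g\<in>P. of_real (Q g) * cis (2 * pi * (real j * D g - e g)))"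
    unfolding of_real_sum of_real_prod
  proof (rule sum.cong[OF refl])
    fix j
    have "(\<Prod>i\<in>UNIV. complex_of_real (cos (pi * (real j * \<omega>$i - y$i)) ^ (2 * m))) =
       (\<Sum>g\<in>P. \<Prod>i\<in>UNIV. of_real (c (g i)) * cis (2 * pi * ((real (g i) - real m) * (real j * \<omega>$i - y$i))))"
      unfolding cos_power_expansion c_def[symmetric] P_def by (subst prod_sum_PiE) auto
    also have "\<dots> = (\<Sum>g\<in>P. of_real (Q g) * cis (2 * pi * (real j * D g - e g)))"
      by (simp add: prod.distrib Q_def cisprod D_def e_def k_def sum_distrib_left sum_subtractf[symmetric] algebra_simps)
    finally show "(\<Prod>i\<in>UNIV. complex_of_real (cos (pi * (real j * \<omega>$i - y$i)) ^ (2 * m))) =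
       (\<Sum>g\<in>P. of_real (Q g) * cis (2 * pi * (real j * D g - e g)))" .
  qed
  also have "\<dots> = (\<Sum>g\<in>P. of_real (Q g) * cis (- (2 * pi * e g)) * I g)"
    by (subst sum.swap) (simp add: I_def sum_distrib_left cis_mult mult.assoc algebra_simps)
  finally have eq: "complex_of_real (\<Sum>j<K. \<Prod>i\<in>UNIV. cos (pi * (real j * \<omega>$i - y$i)) ^ (2 * m)) =
     (\<Sum>g\<in>P. of_real (Q g) * cis (- (2 * pi * e g)) * I g)" .
  \<comment> \<open>The constant index \<open>m\<close> stands for frequency zero, because
    \<open>k\<close> shifts the binomial index by \<open>m\<close>.\<close>
  define g0 :: "'d \<Rightarrow> nat" where "g0 = (\<lambda>_. m)"
  have g0: "g0 \<in> P" by (auto simp: g0_def P_def)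
  have I0: "D g0 = 0" "e g0 = 0" "I g0 = of_nat K" "Q g0 = c m ^ CARD('d)"
    by (auto simp: D_def e_def I_def k_def g0_def Q_def)
  have small: "cmod (I g) \<le> (real CARD('d) * real m) powr b / (2 * \<kappa>)" if g: "g \<in> P - {g0}" for g
  proof -
    have kn: "k g \<noteq> 0"
    proof
      assume "k g = 0"
      then have "g i = m" for i by (auto simp: k_def vec_eq_iff dest: spec[of _ i])
      then have "g = g0" by (auto simp: g0_def)
      with g show False by simp
    qed
    define s where "s = real_of_int (\<Sum>j\<in>UNIV. \<bar>k g $ j\<bar>)"
    have "(\<Sum>j\<in>UNIV. \<bar>k g $ j\<bar>) \<noteq> 0"
      using kn by (auto simp: sum_nonneg_eq_0_iff vec_eq_iff)
    moreover have "(\<Sum>j\<in>UNIV. \<bar>k g $ j\<bar>) \<ge> 0" by (auto intro: sum_nonneg)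
    ultimately have s0: "s > 0" unfolding s_def by linarith
    have "g j \<le> 2 * m" for j using g by (auto simp: P_def PiE_def Pi_def)
    then have "int (g j) \<le> int (2 * m)" for j by (simp only: of_nat_le_iff)
    then have "\<bar>k g $ j\<bar> \<le> int m" for j by (simp add: k_def abs_le_iff diff_le_eq)
    then have "(\<Sum>j\<in>UNIV. \<bar>k g $ j\<bar>) \<le> (\<Sum>j\<in>(UNIV::'d set). int m)" by (intro sum_mono)
    then have "real_of_int (\<Sum>j\<in>UNIV. \<bar>k g $ j\<bar>) \<le> real_of_int (\<Sum>j\<in>(UNIV::'d set). int m)" by (simp only: of_int_le_iff)
    then have sm: "s \<le> real CARD('d) * real m" by (simp add: s_def)
    have "\<kappa> * s powr (-b) \<le> infdist (D g) \<int>"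
      using dio kn unfolding diophantine_def D_def s_def by blast
    then have sn: "2 * (\<kappa> * s powr (-b)) \<le> \<bar>sin (pi * D g)\<bar>"
      using abs_sin_pi_ge_infdist[of "D g"] by linarith
    have pos: "0 < \<kappa> * s powr (-b)" using \<kappa> s0 by simp
    then have ne: "sin (pi * D g) \<noteq> 0" using sn by auto
    have "cmod (I g) \<le> 1 / \<bar>sin (pi * D g)\<bar>"
      unfolding I_def by (rule norm_sum_cis_le[OF ne])
    also have "\<dots> \<le> 1 / (2 * (\<kappa> * s powr (-b)))"
      using sn pos by (intro divide_left_mono) auto
    also have "\<dots> = s powr b / (2 * \<kappa>)" by (simp add: powr_minus divide_simps)
    also have "\<dots> \<le> (real CARD('d) * real m) powr b / (2 * \<kappa>)"
      using s0 sm b \<kappa> by (intro divide_right_mono powr_mono2) auto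
    finally show ?thesis .
  qed
  have "real K * c m ^ CARD('d) - (\<Sum>j<K. \<Prod>i\<in>UNIV. cos (pi * (real j * \<omega>$i - y$i)) ^ (2 * m)) =
     Re (of_real (Q g0) * cis (- (2 * pi * e g0)) * I g0 - (\<Sum>g\<in>P. of_real (Q g) * cis (- (2 * pi * e g)) * I g))"
    unfolding eq[symmetric] minus_complex.simps Re_complex_of_real by (simp add: I0)
  also have "\<dots> = Re (- (\<Sum>g\<in>P - {g0}. of_real (Q g) * cis (- (2 * pi * e g)) * I g))"
    by (subst sum.remove[OF finP g0]) simp
  also have "\<dots> \<le> cmod (\<Sum>g\<in>P - {g0}. of_real (Q g) * cis (- (2 * pi * e g)) * I g)"
    by (rule order_trans[OF complex_Re_le_cmod]) (simp only: norm_minus_cancel order_refl)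
  also have "\<dots> \<le> (\<Sum>g\<in>P - {g0}. Q g * ((real CARD('d) * real m) powr b / (2 * \<kappa>)))"
  proof (rule order_trans[OF norm_sum sum_mono])
    fix g assume g: "g \<in> P - {g0}"
    have "cmod (of_real (Q g) * cis (- (2 * pi * e g)) * I g) = Q g * cmod (I g)"
      using Q0[of g] by (simp add: norm_mult)
    also have "\<dots> \<le> Q g * ((real CARD('d) * real m) powr b / (2 * \<kappa>))"
      by (rule mult_left_mono[OF small[OF g] Q0])
    finally show "cmod (of_real (Q g) * cis (- (2 * pi * e g)) * I g) \<le> Q g * ((real CARD('d) * real m) powr b / (2 * \<kappa>))" .
  qed
  also have "\<dots> \<le> (\<Sum>g\<in>P. Q g * ((real CARD('d) * real m) powr b / (2 * \<kappa>)))"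
    using Q0 \<kappa> finP by (intro sum_mono2) auto
  also have "\<dots> = (real CARD('d) * real m) powr b / (2 * \<kappa>)"
    by (simp only: sum_distrib_right[symmetric] Qsum)
  finally show ?thesis by (simp add: c_def)
qed

text \<open>If the orbit avoids the \<eta>-cube around \<open>y\<close>, then at every time some
  coordinate factor has squared cosine at most \<open>1 - 4 * \<eta>\<^sup>2\<close>, so the kernel
  sum is at most \<open>K * exp (-4 * \<eta>\<^sup>2 * m)\<close>. Taking \<open>m\<close> of order
  \<open>\<eta>^(-3)\<close>, more than the critical order \<open>\<eta>^(-2)\<close>, makes this
  exponentially small in \<open>1/\<eta>\<close> and thus negligible against the main term, which is
  at least \<open>K / (2*m)^d\<close>. The remaining error bounds \<open>K\<close> by a multiple of
  \<open>m^(d+b)\<close>, whence the exponent \<open>3 * (b + d)\<close>.\<close>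

lemma quantitative_kronecker:
  fixes \<omega> :: "real ^ 'd::finite"
  assumes dio: "diophantine \<kappa> b \<omega>" and \<kappa>: "\<kappa> > 0" and b: "b > 0"
  shows "\<exists>C>0. \<forall>\<eta> y K. 0 < \<eta> \<longrightarrow> \<eta> \<le> 1 \<longrightarrow> C * \<eta> powr (- 3 * (b + real CARD('d))) \<le> real K \<longrightarrow>
     (\<exists>j<K. \<forall>i. \<bar>y$i - real j * \<omega>$i - of_int (round (y$i - real j * \<omega>$i))\<bar> \<le> \<eta>)"
proof -
  define d where "d = CARD('d)"
  have d: "d \<ge> 1" by (simp add: d_def Suc_le_eq)
  \<comment> \<open>The first entry gives \<open>u ^ (3 * d) \<le> exp (2 * L * u)\<close> through
    \<open>ln u \<le> u\<close>, the second gives \<open>eL\<close>. Together they let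
    \<open>exp (-4 * L * u)\<close> beat half of \<open>(1 / (2 * m)) ^ d\<close> for every
    \<open>u \<ge> 1\<close>.\<close>
  define L where "L = max (3 * real d / 2) (ln (2 * (2 * real d) ^ d))"
  have L: "L > 0" "3 * real d / 2 \<le> L" "ln (2 * (2 * real d) ^ d) \<le> L" using d by (auto simp: L_def less_max_iff_disj)
  have eL: "2 * (2 * (L + 1)) ^ d \<le> exp (2 * L)"
  proof -
    have "(L + 1) \<le> real d * exp (L / real d)"
    proof -
      have "real d * (1 + L / real d) \<le> real d * exp (L / real d)"
        by (intro mult_left_mono exp_ge_add_one_self) auto
      moreover have "L + 1 \<le> real d * (1 + L / real d)" using d by (simp add: field_simps)
      ultimately show ?thesis by linarith
    qed
    then have "(L + 1) ^ d \<le> (real d * exp (L / real d)) ^ d"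
      using L by (intro power_mono) auto
    also have "\<dots> = real d ^ d * exp L"
      using d by (simp add: power_mult_distrib exp_of_nat_mult[symmetric])
    finally have "2 ^ d * (L + 1) ^ d \<le> 2 ^ d * (real d ^ d * exp L)"
      by (rule mult_left_mono) simp
    then have "2 * (2 * (L + 1)) ^ d \<le> (2 * (2 * real d) ^ d) * exp L"
      unfolding power_mult_distrib by simp
    also have "2 * (2 * real d) ^ d \<le> exp L"
    proof -
      have "0 < 2 * (2 * real d) ^ d" using d by simp
      then have "2 * (2 * real d) ^ d = exp (ln (2 * (2 * real d) ^ d))" by (simp only: exp_ln)
      also have "\<dots> \<le> exp L" using L(3) by (simp only: exp_le_cancel_iff)
      finally show ?thesis .
    qed
    then have "(2 * (2 * real d) ^ d) * exp L \<le> exp L * exp L" by (intro mult_right_mono) auto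
    also have "\<dots> = exp (2 * L)" by (simp add: exp_double power2_eq_square)
    finally show ?thesis .
  qed
  \<comment> \<open>The first summand is the bound that avoidance imposes on \<open>K\<close>; the
    \<open>+ 1\<close> makes the final contradiction strict.\<close>
  define C where "C = (2 * (L + 1)) ^ d * (real d * (L + 1)) powr b / \<kappa> + 1"
  have C: "C > 0" using L \<kappa> by (auto simp: C_def intro!: add_nonneg_pos divide_nonneg_pos)
  have "\<exists>j<K. \<forall>i. \<bar>y$i - real j * \<omega>$i - of_int (round (y$i - real j * \<omega>$i))\<bar> \<le> \<eta>"
    if \<eta>: "0 < \<eta>" "\<eta> \<le> 1" and K: "C * \<eta> powr (- 3 * (b + real d)) \<le> real K" for \<eta> y K
  proof (rule ccontr)
    assume neg: "\<not> ?thesis"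
    define u where "u = 1 / \<eta>"
    have u: "u \<ge> 1" using \<eta> by (simp add: u_def)
    define m where "m = nat \<lceil>L * u ^ 3\<rceil>"
    have m0: "L * u ^ 3 > 0" using L u by simp
    have m1: "L * u ^ 3 \<le> real m" "real m \<le> L * u ^ 3 + 1" using m0 by (auto simp: m_def of_nat_nat)
    have u3: "u ^ 3 \<ge> 1" using u by simp
    have m2: "real m \<le> (L + 1) * u ^ 3" using m1(2) u3 by (simp add: algebra_simps)
    have mpos: "m > 0" using m0 m1 by (simp add: gr0_conv_Suc) (metis not0_implies_Suc of_nat_0 not_less)
    have "(\<Sum>j<K. \<Prod>i\<in>UNIV. cos (pi * (real j * \<omega>$i - y$i)) ^ (2 * m)) \<le> (\<Sum>j<K. exp (- 4 * L * u))"
    proof (rule sum_mono)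
      fix j assume "j \<in> {..<K}"
      then obtain i where i: "\<eta> < \<bar>y$i - real j * \<omega>$i - of_int (round (y$i - real j * \<omega>$i))\<bar>"
        using neg by (auto simp: not_le)
      define x where "x = y$i - real j * \<omega>$i"
      have "2 * \<eta> \<le> \<bar>sin (pi * x)\<bar>" using abs_sin_pi_ge[of x] i by (simp add: x_def)
      then have "(2 * \<eta>)\<^sup>2 \<le> \<bar>sin (pi * x)\<bar>\<^sup>2" using \<eta> by (intro power_mono) auto
      then have cs: "(cos (pi * x))\<^sup>2 \<le> 1 - 4 * \<eta>\<^sup>2" by (simp add: cos_squared_eq power_mult_distrib)
      have sym: "cos (pi * (real j * \<omega>$i - y$i)) = cos (pi * x)"
        unfolding x_def by (subst cos_minus[symmetric]) (simp add: algebra_simps)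
      have "(\<Prod>i\<in>UNIV. cos (pi * (real j * \<omega>$i - y$i)) ^ (2 * m)) =
          cos (pi * x) ^ (2 * m) * (\<Prod>i\<in>UNIV - {i}. cos (pi * (real j * \<omega>$i - y$i)) ^ (2 * m))"
        by (subst prod.remove[of _ i]) (auto simp: sym)
      also have "\<dots> \<le> cos (pi * x) ^ (2 * m) * 1"
        by (intro mult_left_mono prod_le_1) (auto simp: power_mult power_le_one abs_square_le_1 zero_le_even_power)
      also have "\<dots> = ((cos (pi * x))\<^sup>2) ^ m" by (simp add: power_mult)
      also have "\<dots> \<le> (exp (- 4 * \<eta>\<^sup>2)) ^ m"
        using cs exp_ge_add_one_self[of "- 4 * \<eta>\<^sup>2"] by (intro power_mono) auto
      also have "\<dots> = exp (- 4 * \<eta>\<^sup>2 * real m)" by (simp add: exp_of_nat_mult[symmetric] mult_ac)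
      also have "\<dots> \<le> exp (- 4 * L * u)"
      proof -
        have "\<eta>\<^sup>2 * (L * u ^ 3) = L * u" using \<eta> by (simp add: u_def power2_eq_square power3_eq_cube)
        moreover have "\<eta>\<^sup>2 * (L * u ^ 3) \<le> \<eta>\<^sup>2 * real m" using m1 by (intro mult_left_mono) auto
        ultimately have "L * u \<le> \<eta>\<^sup>2 * real m" by linarith
        then show ?thesis by simp
      qed
      finally show "(\<Prod>i\<in>UNIV. cos (pi * (real j * \<omega>$i - y$i)) ^ (2 * m)) \<le> exp (- 4 * L * u)" .
    qed
    then have T: "(\<Sum>j<K. \<Prod>i\<in>UNIV. cos (pi * (real j * \<omega>$i - y$i)) ^ (2 * m)) \<le> real K * exp (- 4 * L * u)" by simp
    have "real K * (1 / (2 * real m)) ^ d \<le> real K * (real (2 * m choose m) / 4 ^ m) ^ d"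
      using central_binomial_lower_bound[OF mpos] mpos
      by (intro mult_left_mono power_mono) (auto simp: field_simps)
    with T diophantine_trig_average[OF dio \<kappa> b mpos, of K y]
    have A: "real K * (1 / (2 * real m)) ^ d \<le> real K * exp (- 4 * L * u) + (real d * real m) powr b / (2 * \<kappa>)"
      by (simp add: d_def)
    have B: "exp (- 4 * L * u) \<le> (1 / 2) * (1 / (2 * real m)) ^ d"
    proof -
      have "2 * (2 * real m) ^ d \<le> 2 * (2 * (L + 1) * u ^ 3) ^ d"
      proof -
        have "2 * real m \<le> 2 * (L + 1) * u ^ 3" using m2 by linarith
        then show ?thesis by (intro mult_left_mono power_mono) auto
      qed
      also have "\<dots> = (2 * (2 * (L + 1)) ^ d) * u ^ (3 * d)" by (simp add: power_mult_distrib power_mult)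
      also have "\<dots> \<le> exp (2 * L) * exp (2 * L * u)"
      proof (intro mult_mono eL)
        have "u ^ (3 * d) = exp (real (3 * d) * ln u)" by (subst exp_of_nat_mult) (use u in simp)
        also have "\<dots> \<le> exp (2 * L * u)"
        proof -
          have "real (3 * d) * ln u \<le> (2 * L) * u"
            using L(2) u ln_bound[of u] by (intro mult_mono) auto
          then show ?thesis by simp
        qed
        finally show "u ^ (3 * d) \<le> exp (2 * L * u)" .
      qed (use u in auto)
      also have "\<dots> \<le> exp (2 * L * u) * exp (2 * L * u)"
        using u L by (intro mult_right_mono) auto
      also have "\<dots> = exp (4 * L * u)" by (simp add: exp_add[symmetric])
      finally have "1 / exp (4 * L * u) \<le> 1 / (2 * (2 * real m) ^ d)"
        using mpos by (intro divide_left_mono) auto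
      moreover have "exp (- 4 * L * u) = 1 / exp (4 * L * u)"
        using exp_minus[of "4 * L * u"] by (simp add: inverse_eq_divide)
      moreover have "(1 / 2) * (1 / (2 * real m)) ^ d = 1 / (2 * (2 * real m) ^ d)"
        by (simp only: power_one_over times_divide_times_eq mult_1)
      ultimately show ?thesis by (simp only:)
    qed
    have "real K * exp (- 4 * L * u) \<le> real K * ((1 / 2) * (1 / (2 * real m)) ^ d)"
      using B by (intro mult_left_mono) auto
    with A have "real K * (1 / (2 * real m)) ^ d \<le> (real d * real m) powr b / \<kappa>"
      by (simp add: field_simps)
    then have "real K \<le> (2 * real m) ^ d * ((real d * real m) powr b / \<kappa>)"
      using mpos by (simp add: power_divide divide_le_eq mult.commute)
    also have "\<dots> \<le> (2 * ((L + 1) * u ^ 3)) ^ d * ((real d * ((L + 1) * u ^ 3)) powr b / \<kappa>)"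
      using m2 mpos b \<kappa> L u by (intro mult_mono power_mono divide_right_mono powr_mono2 mult_left_mono) auto
    also have "\<dots> = (C - 1) * ((u ^ 3) ^ d * (u ^ 3) powr b)"
    proof -
      have "(2 * ((L + 1) * u ^ 3)) ^ d = (2 * (L + 1)) ^ d * (u ^ 3) ^ d"
        by (simp only: power_mult_distrib[symmetric] mult.assoc)
      moreover have "(real d * ((L + 1) * u ^ 3)) powr b = (real d * (L + 1)) powr b * (u ^ 3) powr b"
        by (simp only: powr_mult[symmetric] mult.assoc)
      moreover have "C - 1 = (2 * (L + 1)) ^ d * (real d * (L + 1)) powr b / \<kappa>" by (simp add: C_def)
      ultimately show ?thesis by (simp only: divide_inverse mult_ac)
    qed
    also have "(u ^ 3) ^ d * (u ^ 3) powr b = \<eta> powr (- 3 * (b + real d))"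
    proof -
      have u0: "u > 0" using u by simp
      have "(u ^ 3) ^ d = u powr (3 * real d)"
        using powr_realpow[OF u0, of "3 * d"] by (simp add: power_mult)
      moreover have "(u ^ 3) powr b = u powr (3 * b)"
        using powr_realpow[OF u0, of 3] powr_powr[of u 3 b] by simp
      ultimately have "(u ^ 3) ^ d * (u ^ 3) powr b = u powr (3 * real d + 3 * b)"
        by (simp add: powr_add)
      also have "\<dots> = \<eta> powr (- (3 * real d + 3 * b))"
      proof -
        have "(1 / \<eta>) powr z = \<eta> powr (- z)" for z using \<eta> by (simp add: powr_minus_divide powr_divide)
        then show ?thesis by (simp only: u_def)
      qed
      finally show ?thesis by (simp add: algebra_simps)
    qed
    also have "(C - 1) * \<eta> powr (- 3 * (b + real d)) < C * \<eta> powr (- 3 * (b + real d))"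
      using \<eta> by (intro mult_strict_right_mono) auto
    finally show False using K by simp
  qed
  then show ?thesis using C unfolding d_def by blast
qed

subsection \<open>Boundary regularity of logarithms of holomorphic functions\<close>

text \<open>It vanishes to second order at both ends of \<open>{-1..1}\<close>, so integrating by
  parts twice leaves no boundary terms, and its second derivative is
  \<open>12 * x\<^sup>2 - 4\<close>.\<close>

definition cutoff :: "real \<Rightarrow> real" where "cutoff x = (1 - x\<^sup>2)\<^sup>2"

lemma integral_cutoff_second_deriv:
  fixes F F' F'' :: "real \<Rightarrow> real"
  assumes F: "\<And>x. (F has_real_derivative F' x) (at x)"
    and F': "\<And>x. (F' has_real_derivative F'' x) (at x)"
    and F'': "continuous_on {-1..1} F''"
  shows "integral {-1..1} (\<lambda>x. cutoff x * F'' x) = integral {-1..1} (\<lambda>x. (12 * x\<^sup>2 - 4) * F x)"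
proof -
  have "((\<lambda>x. (1 - x\<^sup>2)\<^sup>2 * F' x + 4 * x * (1 - x\<^sup>2) * F x) has_real_derivative
        (cutoff x * F'' x - (12 * x\<^sup>2 - 4) * F x)) (at x within {-1..1})" for x
    unfolding cutoff_def
    by (rule derivative_eq_intros DERIV_subset[OF F] DERIV_subset[OF F'] refl subset_UNIV)+
       (simp add: algebra_simps power2_eq_square)
  then have I: "((\<lambda>x. cutoff x * F'' x - (12 * x\<^sup>2 - 4) * F x) has_integral 0) {-1..1}"
    using fundamental_theorem_of_calculus[of "-1" 1 "\<lambda>x. (1 - x\<^sup>2)\<^sup>2 * F' x + 4 * x * (1 - x\<^sup>2) * F x"
        "\<lambda>x. cutoff x * F'' x - (12 * x\<^sup>2 - 4) * F x"]
    by (simp add: has_real_derivative_iff_has_vector_derivative)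
  have cF: "continuous_on {-1..1} F"
    using F by (meson DERIV_isCont continuous_at_imp_continuous_on)
  have "(\<lambda>x. cutoff x * F'' x) integrable_on {-1..1}" "(\<lambda>x. (12 * x\<^sup>2 - 4) * F x) integrable_on {-1..1}"
    by (intro integrable_continuous_interval continuous_intros cF F''; simp add: cutoff_def; intro continuous_intros)+
  from integral_diff[OF this] integral_unique[OF I] show ?thesis by simp
qed

lemma cutoff_bounds:
  assumes "\<bar>x\<bar> \<le> 1"
  shows "0 \<le> cutoff x" "cutoff x \<le> 1" "\<bar>12 * x\<^sup>2 - 4\<bar> \<le> 8"
proof -
  have x: "0 \<le> x\<^sup>2" "x\<^sup>2 \<le> 1" using assms by (auto simp: abs_square_le_1)
  show "0 \<le> cutoff x" by (simp add: cutoff_def)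
  show "cutoff x \<le> 1" unfolding cutoff_def using x by (intro power_le_one) auto
  show "\<bar>12 * x\<^sup>2 - 4\<bar> \<le> 8" using x unfolding abs_le_iff by linarith
qed

lemma cutoff_half: "\<bar>x\<bar> \<le> 1/2 \<Longrightarrow> 9/16 \<le> cutoff x"
proof -
  assume "\<bar>x\<bar> \<le> 1/2"
  then have "x\<^sup>2 \<le> (1/2)\<^sup>2" by (metis abs_ge_zero power2_abs power_mono)
  then have "(3/4)\<^sup>2 \<le> (1 - x\<^sup>2)\<^sup>2" by (intro power_mono) (auto simp: power2_eq_square)
  then show ?thesis by (simp add: cutoff_def power2_eq_square)
qed

lemma cutoff_continuous [continuous_intros]:
  "continuous_on S f \<Longrightarrow> continuous_on S (\<lambda>x. cutoff (f x))"
  unfolding cutoff_def by (intro continuous_intros)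

text \<open>The bracket is the second derivative of \<open>w\<^sup>2\<close> in \<open>y\<close>.
  Moving it onto the cutoff leaves a factor of size at most 8 on a square of area 4, hence
  \<open>32 * S\<^sup>2\<close>. The other direction follows by exchanging the coordinates.\<close>

lemma cutoff_energy_half:
  fixes w b q :: "real \<times> real \<Rightarrow> real"
  assumes dy: "\<And>x y. ((\<lambda>y. w (x, y)) has_real_derivative b (x, y)) (at y)"
    and dyy: "\<And>x y. ((\<lambda>y. b (x, y)) has_real_derivative q (x, y)) (at y)"
    and cont: "continuous_on UNIV w" "continuous_on UNIV b" "continuous_on UNIV q"
    and bnd: "\<And>x y. \<bar>x\<bar> \<le> 1 \<Longrightarrow> \<bar>y\<bar> \<le> 1 \<Longrightarrow> 0 \<le> w (x, y) \<and> w (x, y) \<le> S"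
  shows "integral (cbox (-1,-1) (1,1)) (\<lambda>z. cutoff (fst z) * cutoff (snd z) * (2 * (b z)\<^sup>2 + 2 * w z * q z)) \<le> 32 * S\<^sup>2"
proof -
  note c = continuous_on_subset[OF cont(1) subset_UNIV] continuous_on_subset[OF cont(2) subset_UNIV]
    continuous_on_subset[OF cont(3) subset_UNIV]
  have "integral (cbox (-1,-1) (1,1)) (\<lambda>z. cutoff (fst z) * cutoff (snd z) * (2 * (b z)\<^sup>2 + 2 * w z * q z))
      = integral (cbox (-1) 1) (\<lambda>x. integral (cbox (-1) 1) (\<lambda>y. cutoff x * cutoff y * (2 * (b (x, y))\<^sup>2 + 2 * w (x, y) * q (x, y))))"
    by (subst integral_prod_continuous) (auto intro!: continuous_intros c)
  also have "\<dots> = integral (cbox (-1) 1) (\<lambda>x. integral (cbox (-1) 1) (\<lambda>y. cutoff x * ((12 * y\<^sup>2 - 4) * (w (x, y))\<^sup>2)))"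
  proof -
    have "integral {-1..1} (\<lambda>y. cutoff y * (2 * (b (x, y))\<^sup>2 + 2 * w (x, y) * q (x, y))) =
       integral {-1..1} (\<lambda>y. (12 * y\<^sup>2 - 4) * (w (x, y))\<^sup>2)" for x
    proof (rule integral_cutoff_second_deriv[where F' = "\<lambda>y. 2 * w (x, y) * b (x, y)"])
      show "((\<lambda>y. (w (x, y))\<^sup>2) has_real_derivative 2 * w (x, y) * b (x, y)) (at y)" for y
        by (rule derivative_eq_intros dy refl)+ simp
      show "((\<lambda>y. 2 * w (x, y) * b (x, y)) has_real_derivative 2 * (b (x, y))\<^sup>2 + 2 * w (x, y) * q (x, y)) (at y)" for y
        by (rule derivative_eq_intros dy dyy refl)+ (simp add: power2_eq_square)
      show "continuous_on {-1..1} (\<lambda>y. 2 * (b (x, y))\<^sup>2 + 2 * w (x, y) * q (x, y))"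
        by (intro continuous_intros continuous_on_compose2[OF cont(1)] continuous_on_compose2[OF cont(2)]
            continuous_on_compose2[OF cont(3)]) auto
    qed
    then show ?thesis by (simp add: mult.assoc)
  qed
  also have "\<dots> = integral (cbox (-1,-1) (1,1)) (\<lambda>z. cutoff (fst z) * ((12 * (snd z)\<^sup>2 - 4) * (w z)\<^sup>2))"
    by (subst integral_prod_continuous) (auto intro!: continuous_intros c)
  also have "\<dots> \<le> integral (cbox (-1,-1) (1,1)) (\<lambda>z::real\<times>real. 8 * S\<^sup>2)"
  proof (rule integral_le)
    show "(\<lambda>z. cutoff (fst z) * ((12 * (snd z)\<^sup>2 - 4) * (w z)\<^sup>2)) integrable_on cbox (-1,-1) (1,1)"
      by (intro integrable_continuous continuous_intros c)
    fix z :: "real \<times> real" assume "z \<in> cbox (-1,-1) (1,1)"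
    then obtain x y where z: "z = (x, y)" "\<bar>x\<bar> \<le> 1" "\<bar>y\<bar> \<le> 1" by (cases z) (auto simp: abs_le_iff)
    have w: "(w z)\<^sup>2 \<le> S\<^sup>2" using bnd[OF z(2,3)] by (auto simp: z intro: power_mono)
    have "(12 * y\<^sup>2 - 4) * (w z)\<^sup>2 \<le> 8 * S\<^sup>2"
      using cutoff_bounds(3)[OF z(3)] w by (intro mult_mono) auto
    then have "cutoff x * ((12 * y\<^sup>2 - 4) * (w z)\<^sup>2) \<le> cutoff x * (8 * S\<^sup>2)"
      by (rule mult_left_mono) (rule cutoff_bounds(1)[OF z(2)])
    also have "\<dots> \<le> 1 * (8 * S\<^sup>2)"
      using cutoff_bounds[OF z(2)] by (intro mult_right_mono) auto
    finally show "cutoff (fst z) * ((12 * (snd z)\<^sup>2 - 4) * (w z)\<^sup>2) \<le> 8 * S\<^sup>2" by (simp add: z)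
  qed auto
  also have "\<dots> = 32 * S\<^sup>2" by (simp add: content_Pair)
  finally show ?thesis .
qed

text \<open>Integrate \<open>\<Delta>(w\<^sup>2) \<ge> 2 \<bar>\<nabla>w\<bar>\<^sup>2\<close> against a cutoff.\<close>

lemma caccioppoli:
  fixes w a b p q :: "real \<times> real \<Rightarrow> real"
  assumes dx: "\<And>x y. ((\<lambda>x. w (x, y)) has_real_derivative a (x, y)) (at x)"
    and dy: "\<And>x y. ((\<lambda>y. w (x, y)) has_real_derivative b (x, y)) (at y)"
    and dxx: "\<And>x y. ((\<lambda>x. a (x, y)) has_real_derivative p (x, y)) (at x)"
    and dyy: "\<And>x y. ((\<lambda>y. b (x, y)) has_real_derivative q (x, y)) (at y)"
    and cont: "continuous_on UNIV w" "continuous_on UNIV a" "continuous_on UNIV b"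
      "continuous_on UNIV p" "continuous_on UNIV q"
    and sub: "\<And>z. p z + q z \<ge> 0"
    and bnd: "\<And>x y. \<bar>x\<bar> \<le> 1 \<Longrightarrow> \<bar>y\<bar> \<le> 1 \<Longrightarrow> 0 \<le> w (x, y) \<and> w (x, y) \<le> S"
  shows "integral (cbox (-1/2,-1/2) (1/2,1/2)) (\<lambda>z. (a z)\<^sup>2 + (b z)\<^sup>2) \<le> 102 * S\<^sup>2"
proof -
  note c = continuous_on_subset[OF cont(1) subset_UNIV] continuous_on_subset[OF cont(2) subset_UNIV]
    continuous_on_subset[OF cont(3) subset_UNIV] continuous_on_subset[OF cont(4) subset_UNIV]
    continuous_on_subset[OF cont(5) subset_UNIV]
  define U where "U z = cutoff (fst z) * cutoff (snd z) * (2 * (a z)\<^sup>2 + 2 * w z * p z)" for z :: "real \<times> real"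
  define V where "V z = cutoff (fst z) * cutoff (snd z) * (2 * (b z)\<^sup>2 + 2 * w z * q z)" for z :: "real \<times> real"
  have cU: "continuous_on A U" "continuous_on A V" for A
    unfolding U_def V_def by (intro continuous_intros c)+
  have V: "integral (cbox (-1,-1) (1,1)) V \<le> 32 * S\<^sup>2"
    unfolding V_def using cutoff_energy_half[OF dy dyy cont(1,3,5) bnd] by simp
  have "continuous_on UNIV (\<lambda>z. f (prod.swap z))" if "continuous_on UNIV f" for f :: "real \<times> real \<Rightarrow> real"
    by (rule continuous_on_compose2[OF that]) (auto intro!: continuous_intros simp: prod.swap_def)
  then have "integral (cbox (-1,-1) (1,1)) (\<lambda>z. cutoff (fst z) * cutoff (snd z) *
      (2 * ((a \<circ> prod.swap) z)\<^sup>2 + 2 * (w \<circ> prod.swap) z * (p \<circ> prod.swap) z)) \<le> 32 * S\<^sup>2"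
    using cont dx dxx bnd by (intro cutoff_energy_half) (auto simp: o_def)
  also have "(\<lambda>z. cutoff (fst z) * cutoff (snd z) *
      (2 * ((a \<circ> prod.swap) z)\<^sup>2 + 2 * (w \<circ> prod.swap) z * (p \<circ> prod.swap) z)) = (\<lambda>(x,y). U (y, x))"
    by (auto simp: U_def fun_eq_iff mult.commute)
  also have "integral (cbox (-1,-1) (1,1)) (\<lambda>(x,y). U (y, x)) = integral (cbox (-1,-1) (1,1)) (\<lambda>(x,y). U (x, y))"
    by (rule integral_swap_2dim[symmetric]) (use cU in auto)
  finally have U: "integral (cbox (-1,-1) (1,1)) U \<le> 32 * S\<^sup>2" by simp
  have sub': "cbox (-1/2,-1/2) (1/2,1/2) \<subseteq> cbox (-1::real,-1::real) (1,1)" by auto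
  \<comment> \<open>On the inner square the product of the cutoffs is at least
    \<open>(9/16)\<^sup>2 = 81/256\<close>, and the Laplacian of \<open>w\<^sup>2\<close> is at
    least twice the energy density, since \<open>w\<close> and \<open>p + q\<close> are
    non-negative. The final constant rounds up \<open>64 * 128 / 81\<close>.\<close>
  have nn: "0 \<le> U z + V z" "(81/128) * ((a z)\<^sup>2 + (b z)\<^sup>2) \<le> U z + V z \<or> z \<notin> cbox (-1/2,-1/2) (1/2,1/2)"
    if "z \<in> cbox (-1,-1) (1,1)" for z
  proof -
    obtain x y where "z = (x, y)" by (cases z)
    then have z: "z = (x, y)" "\<bar>x\<bar> \<le> 1" "\<bar>y\<bar> \<le> 1" using that by (auto simp: abs_le_iff)
    have "0 \<le> 2 * (w z * (p z + q z))"
      using bnd[OF z(2,3)] sub[of z] by (simp add: z)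
    then have e: "2 * ((a z)\<^sup>2 + (b z)\<^sup>2) \<le> (2 * (a z)\<^sup>2 + 2 * w z * p z) + (2 * (b z)\<^sup>2 + 2 * w z * q z)"
      by (simp add: algebra_simps)
    have UV: "U z + V z = cutoff x * cutoff y * ((2 * (a z)\<^sup>2 + 2 * w z * p z) + (2 * (b z)\<^sup>2 + 2 * w z * q z))"
      by (simp add: U_def V_def z algebra_simps)
    have cc: "0 \<le> cutoff x * cutoff y" using cutoff_bounds(1) z by simp
    have le: "cutoff x * cutoff y * (2 * ((a z)\<^sup>2 + (b z)\<^sup>2)) \<le> U z + V z"
      unfolding UV by (rule mult_left_mono[OF e cc])
    have "0 \<le> cutoff x * cutoff y * (2 * ((a z)\<^sup>2 + (b z)\<^sup>2))" using cc by simp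
    then show "0 \<le> U z + V z" using le by linarith
    show "(81/128) * ((a z)\<^sup>2 + (b z)\<^sup>2) \<le> U z + V z \<or> z \<notin> cbox (-1/2,-1/2) (1/2,1/2)"
    proof (cases "z \<in> cbox (-1/2,-1/2) (1/2,1/2)")
      case True
      then have "9/16 \<le> cutoff x" "9/16 \<le> cutoff y"
        using cutoff_half[of x] cutoff_half[of y] by (auto simp: z abs_le_iff)
      then have "(9/16) * (9/16) \<le> cutoff x * cutoff y" by (intro mult_mono) auto
      then have "(81/256) * (2 * ((a z)\<^sup>2 + (b z)\<^sup>2)) \<le> cutoff x * cutoff y * (2 * ((a z)\<^sup>2 + (b z)\<^sup>2))"
        by (intro mult_right_mono) auto
      with le show ?thesis by simp
    qed simp
  qed
  have "(81/128) * integral (cbox (-1/2,-1/2) (1/2,1/2)) (\<lambda>z. (a z)\<^sup>2 + (b z)\<^sup>2) =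
      integral (cbox (-1/2,-1/2) (1/2,1/2)) (\<lambda>z. (81/128) * ((a z)\<^sup>2 + (b z)\<^sup>2))"
    by (rule integral_mult_right[symmetric])
  also have "\<dots> \<le> integral (cbox (-1/2,-1/2) (1/2,1/2)) (\<lambda>z. U z + V z)"
    using nn(2) sub' by (intro integral_le integrable_continuous continuous_intros c cU) blast
  also have "\<dots> \<le> integral (cbox (-1,-1) (1,1)) (\<lambda>z. U z + V z)"
    using nn(1) sub' by (intro integral_subset_le integrable_continuous continuous_intros cU) auto
  also have "\<dots> = integral (cbox (-1,-1) (1,1)) U + integral (cbox (-1,-1) (1,1)) V"
    by (intro integral_add integrable_continuous cU)
  also have "\<dots> \<le> 64 * S\<^sup>2" using U V by simp
  finally show ?thesis using zero_le_power2[of S] by linarith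
qed

text \<open>The boundary trace: \<open>(t,0)\<close> and \<open>(t+h,0)\<close> are joined by two diagonal segments of height \<open>h/2\<close>,
  so that only the energy in a strip of height \<open>h/2\<close> enters.\<close>

lemma L1_modulus_of_trace:
  fixes w a b p q :: "real \<times> real \<Rightarrow> real"
  assumes dir: "\<And>x y c d s. ((\<lambda>s. w (x + c * s, y + d * s)) has_real_derivative
        a (x + c * s, y + d * s) * c + b (x + c * s, y + d * s) * d) (at s)"
    and dxx: "\<And>x y. ((\<lambda>x. a (x, y)) has_real_derivative p (x, y)) (at x)"
    and dyy: "\<And>x y. ((\<lambda>y. b (x, y)) has_real_derivative q (x, y)) (at y)"
    and cont: "continuous_on UNIV w" "continuous_on UNIV a" "continuous_on UNIV b"
      "continuous_on UNIV p" "continuous_on UNIV q"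
    and sub: "\<And>z. p z + q z \<ge> 0"
    and bnd: "\<And>x y. \<bar>x\<bar> \<le> 1 \<Longrightarrow> \<bar>y\<bar> \<le> 1 \<Longrightarrow> 0 \<le> w (x, y) \<and> w (x, y) \<le> S"
    and S: "S > 0" and h: "0 < h" "h \<le> 1/4"
  shows "integral {-1/4..1/4} (\<lambda>t. \<bar>w (t + h, 0) - w (t, 0)\<bar>) \<le> 21 * S * sqrt h"
proof -
  define E where "E z = (a z)\<^sup>2 + (b z)\<^sup>2" for z
  define G where "G z = \<bar>a z\<bar> + \<bar>b z\<bar>" for z
  note c = continuous_on_subset[OF cont(1) subset_UNIV] continuous_on_subset[OF cont(2) subset_UNIV]
    continuous_on_subset[OF cont(3) subset_UNIV]
  note cc = continuous_on_compose2[OF cont(1)] continuous_on_compose2[OF cont(2)] continuous_on_compose2[OF cont(3)]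
  have cG: "continuous_on UNIV G" and cE: "continuous_on A E" for A
    unfolding G_def E_def by (intro continuous_intros c)+
  note cGc = continuous_on_compose2[OF cG]
  have en: "integral (cbox (-1/2,-1/2) (1/2,1/2)) E \<le> 102 * S\<^sup>2"
    unfolding E_def
  proof (rule caccioppoli[where w=w and p=p and q=q])
    show "((\<lambda>x. w (x, y)) has_real_derivative a (x, y)) (at x)" for x y using dir[of 0 1 y 0 x] by simp
    show "((\<lambda>y. w (x, y)) has_real_derivative b (x, y)) (at y)" for x y using dir[of x 0 0 1 y] by simp
  qed (use assms in auto)
  \<comment> \<open>The parameter of the pointwise inequality
    \<open>\<bar>u\<bar> \<le> l/2 + u\<^sup>2/(2*l)\<close>. This choice balances the area term
    \<open>l * h / 2 = 5 * S * sqrt h\<close> against the energy term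
    \<open>102 * S\<^sup>2 / (2 * l) = 5.1 * S * sqrt h\<close>.\<close>
  define l where "l = 10 * S / sqrt h"
  have l: "l > 0" using S h by (simp add: l_def)
  have Gl: "G z \<le> l + E z / (2 * l)" for z
  proof -
    have "\<bar>u\<bar> \<le> l / 2 + u\<^sup>2 / (2 * l)" for u
      using zero_le_power2[of "\<bar>u\<bar> - l"] l by (simp add: field_simps power2_eq_square)
    from this[of "a z"] this[of "b z"] show ?thesis by (simp add: G_def E_def add_divide_distrib)
  qed
  have strip: "integral (cbox (-1/2,0) (1/2,h/2)) G \<le> 10.1 * S * sqrt h"
  proof -
    have "integral (cbox (-1/2,0) (1/2,h/2)) G \<le> integral (cbox (-1/2,0) (1/2,h/2)) (\<lambda>z. l + E z / (2 * l))"
      by (intro integral_le integrable_continuous continuous_intros cE continuous_on_subset[OF cG] Gl) (use l in auto)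
    also have "\<dots> = integral (cbox (-1/2::real,0::real) (1/2,h/2)) (\<lambda>z. l) + integral (cbox (-1/2,0) (1/2,h/2)) E / (2 * l)"
      by (subst integral_add) (use l in \<open>auto intro!: integrable_continuous continuous_intros cE\<close>)
    also have "integral (cbox (-1/2::real,0::real) (1/2,h/2)) (\<lambda>z. l) = l * (h / 2)"
      using h by (simp add: content_Pair)
    also have "integral (cbox (-1/2,0) (1/2,h/2)) E \<le> integral (cbox (-1/2,-1/2) (1/2,1/2)) E"
      using h by (intro integral_subset_le integrable_continuous cE) (auto simp: E_def)
    also note en
    also have "l * (h / 2) + 102 * S\<^sup>2 / (2 * l) = 10.1 * S * sqrt h"
    proof -
      have "sqrt h * sqrt h = h" using h by simp
      then show ?thesis using S h
        by (simp add: l_def field_simps power2_eq_square)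
    qed
    finally show ?thesis using l by (simp add: divide_right_mono)
  qed
  \<comment> \<open>For fixed height \<open>s\<close> the family of paths is a horizontal translate
    by at most \<open>1/4\<close>, which keeps it inside the strip. It is used for the two
    diagonals, \<open>k s = s\<close> and \<open>k s = h - s\<close>.\<close>
  have slant: "integral {-1/4..1/4} (\<lambda>t. integral {0..h/2} (\<lambda>s. G (t + k s, s))) \<le> 10.1 * S * sqrt h"
    if k: "continuous_on UNIV k" "\<And>s. 0 \<le> s \<Longrightarrow> s \<le> h/2 \<Longrightarrow> \<bar>k s\<bar> \<le> 1/4" for k :: "real \<Rightarrow> real"
  proof -
    have ck: "continuous_on A (\<lambda>z. k (f z))" if "continuous_on A f" for A and f :: "'z::topological_space \<Rightarrow> real"
      by (rule continuous_on_compose2[OF k(1) that]) simp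
    have "integral (cbox (-1/4) (1/4)) (\<lambda>t. integral (cbox 0 (h/2)) (\<lambda>s. G (t + k s, s)))
        = integral (cbox 0 (h/2)) (\<lambda>s. integral (cbox (-1/4) (1/4)) (\<lambda>t. G (t + k s, s)))"
      by (rule integral_swap_continuous) (auto simp: case_prod_unfold intro!: cGc continuous_intros ck)
    also have "\<dots> \<le> integral (cbox 0 (h/2)) (\<lambda>s. integral (cbox (-1/2) (1/2)) (\<lambda>x. G (x, s)))"
    proof (rule integral_le)
      show "(\<lambda>s. integral (cbox (-1/4) (1/4)) (\<lambda>t. G (t + k s, s))) integrable_on cbox 0 (h/2)"
        by (intro integrable_continuous integral_continuous_on_param)
           (auto simp: case_prod_unfold intro!: cGc continuous_intros ck)
      show "(\<lambda>s. integral (cbox (-1/2) (1/2)) (\<lambda>t. G (t, s))) integrable_on cbox 0 (h/2)"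
        by (intro integrable_continuous integral_continuous_on_param)
           (auto simp: case_prod_unfold intro!: cGc continuous_intros ck)
      fix s assume s: "s \<in> cbox 0 (h/2)"
      have "integral (cbox (-1/4) (1/4)) (\<lambda>t. G (t + k s, s)) = integral (cbox (-1/4 + k s) (1/4 + k s)) (\<lambda>t. G (t, s))"
        using integral_shift_cbox[of "-1/4 + k s" "k s" "1/4 + k s" "\<lambda>t. G (t, s)"] by simp
      also have "\<dots> \<le> integral (cbox (-1/2) (1/2)) (\<lambda>t. G (t, s))"
        using k(2)[of s] s
        by (intro integral_subset_le integrable_continuous cGc continuous_intros) (auto simp: G_def abs_le_iff)
      finally show "integral (cbox (-1/4) (1/4)) (\<lambda>t. G (t + k s, s)) \<le> integral (cbox (-1/2) (1/2)) (\<lambda>t. G (t, s))" .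
    qed
    also have "\<dots> = integral (cbox (-1/2) (1/2)) (\<lambda>x. integral (cbox 0 (h/2)) (\<lambda>s. G (x, s)))"
      by (rule integral_swap_continuous[symmetric]) (auto simp: case_prod_unfold intro!: cGc continuous_intros)
    also have "\<dots> = integral (cbox (-1/2,0) (1/2,h/2)) G"
      by (rule integral_prod_continuous[symmetric]) (rule continuous_on_subset[OF cG], simp)
    finally show ?thesis using strip by simp
  qed
  have ftc: "\<bar>w (x + c * (h/2), h/2) - w (x, 0)\<bar> \<le> integral {0..h/2} (\<lambda>s. G (x + c * s, s))"
    if c: "c = 1 \<or> c = -1" for x c
  proof -
    have "((\<lambda>s. a (x + c * s, s) * c + b (x + c * s, s)) has_integral
        (w (x + c * (h/2), h/2) - w (x + c * 0, 0))) {0..h/2}"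
    proof (rule fundamental_theorem_of_calculus)
      show "((\<lambda>s. w (x + c * s, s)) has_vector_derivative a (x + c * s, s) * c + b (x + c * s, s)) (at s within {0..h/2})" for s
        using has_field_derivative_at_within[OF dir[of x c 0 1 s]]
        by (simp add: has_real_derivative_iff_has_vector_derivative)
    qed (use h in auto)
    then have "w (x + c * (h/2), h/2) - w (x, 0) = integral {0..h/2} (\<lambda>s. a (x + c * s, s) * c + b (x + c * s, s))"
      by (simp add: integral_unique)
    also have "norm \<dots> \<le> integral {0..h/2} (\<lambda>s. G (x + c * s, s))"
    proof (rule integral_norm_bound_integral)
      show "(\<lambda>s. a (x + c * s, s) * c + b (x + c * s, s)) integrable_on {0..h/2}"
        "(\<lambda>s. G (x + c * s, s)) integrable_on {0..h/2}"
        by (intro integrable_continuous_interval continuous_intros cc cGc; simp)+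
      show "norm (a (x + c * s, s) * c + b (x + c * s, s)) \<le> G (x + c * s, s)" for s
        using c by (auto simp: G_def)
    qed
    finally show ?thesis by simp
  qed
  have I1: "(\<lambda>t. integral {0..h/2} (\<lambda>s. G (t + k s, s))) integrable_on {-1/4..1/4}"
    if k: "continuous_on UNIV k" for k :: "real \<Rightarrow> real"
  proof -
    have ck: "continuous_on A (\<lambda>z. k (f z))" if "continuous_on A f" for A and f :: "'z::topological_space \<Rightarrow> real"
      by (rule continuous_on_compose2[OF k(1) that]) simp
    have "(\<lambda>t. integral (cbox 0 (h/2)) (\<lambda>s. G (t + k s, s))) integrable_on cbox (-1/4) (1/4)"
      by (intro integrable_continuous integral_continuous_on_param)
         (auto simp: case_prod_unfold intro!: cGc continuous_intros ck)
    then show ?thesis by simp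
  qed
  have "integral {-1/4..1/4} (\<lambda>t. \<bar>w (t + h, 0) - w (t, 0)\<bar>) \<le>
      integral {-1/4..1/4} (\<lambda>t. integral {0..h/2} (\<lambda>s. G (t + s, s)) + integral {0..h/2} (\<lambda>s. G (t + (h - s), s)))"
  proof (rule integral_le)
    show "(\<lambda>t. \<bar>w (t + h, 0) - w (t, 0)\<bar>) integrable_on {-1/4..1/4}"
      by (intro integrable_continuous_interval continuous_intros cc; simp)
    show "(\<lambda>t. integral {0..h/2} (\<lambda>s. G (t + s, s)) + integral {0..h/2} (\<lambda>s. G (t + (h - s), s))) integrable_on {-1/4..1/4}"
      by (intro integrable_add I1 continuous_intros)
    show "\<bar>w (t + h, 0) - w (t, 0)\<bar> \<le> integral {0..h/2} (\<lambda>s. G (t + s, s)) + integral {0..h/2} (\<lambda>s. G (t + (h - s), s))" for t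
      using ftc[of 1 t] ftc[of "-1" "t + h"] by (simp add: algebra_simps)
  qed
  also have "\<dots> = integral {-1/4..1/4} (\<lambda>t. integral {0..h/2} (\<lambda>s. G (t + s, s))) +
      integral {-1/4..1/4} (\<lambda>t. integral {0..h/2} (\<lambda>s. G (t + (h - s), s)))"
    by (intro integral_add I1 continuous_intros)
  also have "\<dots> \<le> 10.1 * S * sqrt h + 10.1 * S * sqrt h"
    using h by (intro add_mono slant continuous_intros) auto
  also have "\<dots> \<le> 21 * S * sqrt h" using S h by simp
  finally show ?thesis .
qed

text \<open>The logarithm of one plus a sum of squared moduli is smooth, non-negative and
  subharmonic; the summand 1 removes the singularities at common zeros. The bound is asked for on
  \<open>cmod z \<le> 2\<close> because that disc contains the square of side 2 used by the trace
  estimate.\<close>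

lemma L1_modulus_log_holomorphic:
  fixes f :: "'k::finite \<Rightarrow> complex \<Rightarrow> complex"
  assumes hol: "\<And>k. f k holomorphic_on UNIV"
    and bnd: "\<And>z. cmod z \<le> 2 \<Longrightarrow> ln (1 + (\<Sum>k\<in>UNIV. (cmod (f k z))\<^sup>2)) \<le> S"
    and S: "S > 0" and h: "0 < h" "h \<le> 1/4"
  shows "integral {-1/4..1/4} (\<lambda>t. \<bar>ln (1 + (\<Sum>k\<in>UNIV. (cmod (f k (of_real (t + h))))\<^sup>2)) -
            ln (1 + (\<Sum>k\<in>UNIV. (cmod (f k (of_real t)))\<^sup>2))\<bar>) \<le> 21 * S * sqrt h"
proof -
  define Z where "Z v = Complex (fst v) (snd v)" for v :: "real \<times> real"
  define f' where "f' k = deriv (f k)" for k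
  define f'' where "f'' k = deriv (f' k)" for k
  have hol': "f' k holomorphic_on UNIV" "f'' k holomorphic_on UNIV" for k
    unfolding f''_def f'_def by (auto intro!: holomorphic_deriv hol)
  have cZ: "continuous_on A Z" for A
    unfolding Z_def complex_eq by (intro continuous_intros)
  have cf: "continuous_on A (\<lambda>v. f k (Z v))" "continuous_on A (\<lambda>v. f' k (Z v))" "continuous_on A (\<lambda>v. f'' k (Z v))" for A k
    by (rule continuous_on_compose2[OF holomorphic_on_imp_continuous_on cZ], rule hol hol', simp)+
  have d: "(f k has_field_derivative f' k z) (at z)" "(f' k has_field_derivative f'' k z) (at z)" for k z
    using hol hol' unfolding f'_def f''_def by (auto intro: holomorphic_derivI)
  define n where "n v = 1 + (\<Sum>k\<in>UNIV. f k (Z v) \<bullet> f k (Z v))" for v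
  have n1: "n v \<ge> 1" for v unfolding n_def by (auto intro: sum_nonneg)
  then have n0: "n v > 0" "n v \<noteq> 0" for v by (smt (verit))+
  \<comment> \<open>\<open>2 * g1\<close> and \<open>2 * g2\<close> are the partial derivatives of
    \<open>n\<close>. By the Cauchy-Riemann equations the second derivative in \<open>y\<close> has
    \<open>- f''\<close> where the one in \<open>x\<close> has \<open>f''\<close>, so
    \<open>r\<close> cancels in the Laplacian and only \<open>e\<close> survives.\<close>
  define g1 where "g1 v = (\<Sum>k\<in>UNIV. f k (Z v) \<bullet> f' k (Z v))" for v
  define g2 where "g2 v = (\<Sum>k\<in>UNIV. f k (Z v) \<bullet> (\<i> * f' k (Z v)))" for v
  define e where "e v = (\<Sum>k\<in>UNIV. f' k (Z v) \<bullet> f' k (Z v))" for v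
  define r where "r v = (\<Sum>k\<in>UNIV. f k (Z v) \<bullet> f'' k (Z v))" for v
  define w where "w v = ln (n v)" for v
  define a where "a v = 2 * g1 v / n v" for v
  define b where "b v = 2 * g2 v / n v" for v
  define p where "p v = 2 * (e v + r v) / n v - (a v)\<^sup>2" for v
  define q where "q v = 2 * (e v - r v) / n v - (b v)\<^sup>2" for v
  have cont0: "continuous_on UNIV n" "continuous_on UNIV g1" "continuous_on UNIV g2" "continuous_on UNIV e" "continuous_on UNIV r"
    unfolding n_def g1_def g2_def e_def r_def by (intro continuous_intros cf)+
  have cont1: "continuous_on UNIV w" "continuous_on UNIV a" "continuous_on UNIV b"
    unfolding w_def a_def b_def using n0 by (auto intro!: continuous_intros cont0)
  have cont2: "continuous_on UNIV p" "continuous_on UNIV q"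
    unfolding p_def q_def using n0 by (auto intro!: continuous_intros cont0 cont1)
  have path: "((\<lambda>s. F (Z (x + c * s, y + d * s))) has_vector_derivative F' * Complex c d) (at s)"
    if "(F has_field_derivative F') (at (Z (x + c * s, y + d * s)))" for F F' x y c d s
  proof -
    have "((\<lambda>s. Z (x + c * s, y + d * s)) has_vector_derivative Complex c d) (at s)"
    proof -
      have "(\<lambda>s. Z (x + c * s, y + d * s)) = (\<lambda>s. Complex x y + s *\<^sub>R Complex c d)"
        by (simp add: Z_def complex_eq_iff fun_eq_iff)
      then show ?thesis by (auto intro!: derivative_eq_intros)
    qed
    from field_vector_diff_chain_at[OF this that] show ?thesis by (simp add: o_def mult.commute)
  qed
  have inner_path: "((\<lambda>s. F (Z (x + c * s, y + d * s)) \<bullet> H (Z (x + c * s, y + d * s))) has_real_derivative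
       F (Z (x + c * s, y + d * s)) \<bullet> (H' * Complex c d) + (F' * Complex c d) \<bullet> H (Z (x + c * s, y + d * s))) (at s)"
    if "(F has_field_derivative F') (at (Z (x + c * s, y + d * s)))" "(H has_field_derivative H') (at (Z (x + c * s, y + d * s)))"
    for F F' H H' x y c d s
    using has_derivative_inner[OF path[OF that(1), unfolded has_vector_derivative_def] path[OF that(2), unfolded has_vector_derivative_def]]
    unfolding has_field_derivative_def
    by (rule has_derivative_eq_rhs) (auto simp: algebra_simps)
  have lin: "F \<bullet> (G * Complex c d) = c * (F \<bullet> G) + d * (F \<bullet> (\<i> * G))" for F G c d
    by (simp add: inner_complex_def algebra_simps)
  have lin': "(G * Complex c d) \<bullet> F = c * (F \<bullet> G) + d * (F \<bullet> (\<i> * G))" for F G c d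
    by (simp add: inner_complex_def algebra_simps)
  have dn: "((\<lambda>s. n (x + c * s, y + d * s)) has_real_derivative
       2 * (c * g1 (x + c * s, y + d * s) + d * g2 (x + c * s, y + d * s))) (at s)" for x y c d s
    unfolding n_def
    by (rule derivative_eq_intros inner_path d refl)+
       (simp only: lin lin' g1_def g2_def, simp add: sum_distrib_left sum.distrib[symmetric] algebra_simps)
  have dg1: "((\<lambda>x. g1 (x, y)) has_real_derivative e (x, y) + r (x, y)) (at x)" for x y
    unfolding g1_def
    by (rule derivative_eq_intros inner_path[of _ _ 0 1 _ y 0, simplified] d refl)+
       (simp only: lin lin', simp add: e_def r_def sum.distrib[symmetric] add.commute)
  have dg2: "((\<lambda>y. g2 (x, y)) has_real_derivative e (x, y) - r (x, y)) (at y)" for x y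
    unfolding g2_def
    by (rule derivative_eq_intros inner_path[of _ _ x 0 _ 0 1, simplified] DERIV_cmult d refl)+
       (simp only: lin lin', simp add: e_def r_def sum_subtractf[symmetric] inner_complex_def algebra_simps)
  have "integral {-1/4..1/4} (\<lambda>t. \<bar>w (t + h, 0) - w (t, 0)\<bar>) \<le> 21 * S * sqrt h"
  proof (rule L1_modulus_of_trace[OF _ _ _ cont1 cont2 _ _ S h])
    show "((\<lambda>s. w (x + c * s, y + d * s)) has_real_derivative
        a (x + c * s, y + d * s) * c + b (x + c * s, y + d * s) * d) (at s)" for x y c d s
      using DERIV_chain2[OF DERIV_ln[OF n0(1)] dn, of x c y d s]
      by (simp add: w_def a_def b_def divide_inverse algebra_simps)
    have quot: "((2 * E) * N - 2 * G * (2 * G)) / (N * N) = 2 * E / N - (2 * G / N)\<^sup>2" if "N \<noteq> 0" for E N G :: real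
      using that by (simp add: field_simps power2_eq_square)
    have dnx: "((\<lambda>s. n (s, y)) has_real_derivative 2 * g1 (x, y)) (at x)" for x y using dn[of 0 1 y 0 x] by simp
    show "((\<lambda>x. a (x, y)) has_real_derivative p (x, y)) (at x)" for x y
      unfolding a_def p_def quot[OF n0(2), symmetric] by (intro DERIV_divide DERIV_cmult dg1 dnx n0)
    have dny: "((\<lambda>s. n (x, s)) has_real_derivative 2 * g2 (x, y)) (at y)" for x y using dn[of x 0 0 1 y] by simp
    show "((\<lambda>y. b (x, y)) has_real_derivative q (x, y)) (at y)" for x y
      unfolding b_def q_def quot[OF n0(2), symmetric] by (intro DERIV_divide DERIV_cmult dg2 dny n0)
    show "0 \<le> p v + q v" for v
    proof -
      \<comment> \<open>Up to conjugation the gradient is one complex sum, so a single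
        Cauchy-Schwarz estimate bounds both components together; this is exactly what
        \<open>p + q \<ge> 0\<close> requires.\<close>
      have *: "(g1 v)\<^sup>2 + (g2 v)\<^sup>2 = (cmod (\<Sum>k\<in>UNIV. cnj (f k (Z v)) * f' k (Z v)))\<^sup>2"
        (is "_ = (cmod ?s)\<^sup>2")
      proof -
        have "Re (\<Sum>k\<in>UNIV. cnj (f k (Z v)) * f' k (Z v)) = g1 v"
          by (simp add: g1_def inner_complex_def)
        moreover have "Im (\<Sum>k\<in>UNIV. cnj (f k (Z v)) * f' k (Z v)) = - g2 v"
          by (simp add: g2_def inner_complex_def sum_negf[symmetric])
        ultimately show ?thesis by (simp add: cmod_power2)
      qed
      have "cmod ?s \<le> (\<Sum>k\<in>UNIV. cmod (f k (Z v)) * cmod (f' k (Z v)))"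
        by (rule order_trans[OF norm_sum]) (simp add: norm_mult)
      then have "(cmod ?s)\<^sup>2 \<le> (\<Sum>k\<in>UNIV. cmod (f k (Z v)) * cmod (f' k (Z v)))\<^sup>2"
        by (rule power_mono) simp
      also have "\<dots> \<le> (\<Sum>k\<in>UNIV. (cmod (f k (Z v)))\<^sup>2) * (\<Sum>k\<in>UNIV. (cmod (f' k (Z v)))\<^sup>2)"
        by (rule Cauchy_Schwarz_ineq_sum)
      also have "\<dots> \<le> n v * e v"
        by (intro mult_mono) (use n0(1)[of v] in \<open>auto simp: n_def e_def power2_norm_eq_inner intro: sum_nonneg\<close>)
      finally have "4 * ((g1 v)\<^sup>2 + (g2 v)\<^sup>2) \<le> 4 * e v * n v" using * by (simp add: mult.commute)
      then have "4 * ((g1 v)\<^sup>2 + (g2 v)\<^sup>2) / (n v)\<^sup>2 \<le> 4 * e v * n v / (n v)\<^sup>2"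
        by (rule divide_right_mono) simp
      then have "4 * ((g1 v)\<^sup>2 + (g2 v)\<^sup>2) / (n v)\<^sup>2 \<le> 4 * e v / n v"
        using n0(2)[of v] by (simp add: power2_eq_square)
      moreover have "(a v)\<^sup>2 + (b v)\<^sup>2 = 4 * ((g1 v)\<^sup>2 + (g2 v)\<^sup>2) / (n v)\<^sup>2"
        by (simp add: a_def b_def power_divide power_mult_distrib add_divide_distrib)
      moreover have "p v + q v = 4 * e v / n v - ((a v)\<^sup>2 + (b v)\<^sup>2)"
        by (simp add: p_def q_def add_divide_distrib diff_divide_distrib algebra_simps)
      ultimately show ?thesis by linarith
    qed
    fix x y :: real assume xy: "\<bar>x\<bar> \<le> 1" "\<bar>y\<bar> \<le> 1"
    have "cmod (Z (x, y)) \<le> 2" using cmod_le[of "Z (x, y)"] xy by (simp add: Z_def)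
    from bnd[OF this] show "0 \<le> w (x, y) \<and> w (x, y) \<le> S"
      using n1[of "(x, y)"] by (simp add: w_def n_def power2_norm_eq_inner)
  qed
  then show ?thesis
    by (simp add: w_def n_def Z_def power2_norm_eq_inner complex_of_real_def)
qed

subsection \<open>Gevrey functions along coordinate lines\<close>

lemma iter_partial_line_deriv:
  assumes "smooth f"
  shows "((\<lambda>t. r ^ j *\<^sub>R iter_partial (replicate j i) f (x + (r * t) *\<^sub>R axis i 1)) has_vector_derivative
      r ^ Suc j *\<^sub>R iter_partial (replicate (Suc j) i) f (x + (r * t) *\<^sub>R axis i 1)) (at t)"
proof -
  define g where "g = iter_partial (replicate j i) f"
  define x' where "x' = x + (r * t) *\<^sub>R axis i (1::real)"
  have "g differentiable (at x')" using assms unfolding smooth_def g_def by blast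
  then have "((\<lambda>u. g (x' + u *\<^sub>R axis i 1)) has_vector_derivative partial_deriv i g x') (at (r * (t - t)))"
    using smooth_partial_vector_derivative by simp
  moreover have "((\<lambda>v. r * (v - t)) has_vector_derivative r) (at t)"
    by (auto intro!: derivative_eq_intros)
  ultimately have "((\<lambda>u. g (x' + u *\<^sub>R axis i 1)) \<circ> (\<lambda>v. r * (v - t)) has_vector_derivative r *\<^sub>R partial_deriv i g x') (at t)"
    by (rule vector_diff_chain_at[rotated])
  also have "(\<lambda>u. g (x' + u *\<^sub>R axis i 1)) \<circ> (\<lambda>v. r * (v - t)) = (\<lambda>t. g (x + (r * t) *\<^sub>R axis i 1))"
    by (simp add: x'_def fun_eq_iff algebra_simps)
  finally have "((\<lambda>t. r ^ j *\<^sub>R g (x + (r * t) *\<^sub>R axis i 1)) has_vector_derivative r ^ j *\<^sub>R (r *\<^sub>R partial_deriv i g x')) (at t)"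
    by (intro derivative_eq_intros) auto
  then show ?thesis by (simp add: g_def x'_def iter_partial_def mult.commute)
qed

text \<open>Turns real derivatives of complex-valued functions into derivatives within the convex
  set \<open>\<real>\<close> of the complex plane, the form in which \<open>field_Taylor\<close> is
  applied below.\<close>

lemma has_field_derivative_of_Re:
  assumes "(g has_vector_derivative v) (at t)"
  shows "((\<lambda>z. g (Re z)) has_field_derivative v) (at (of_real t) within \<real>)"
proof -
  have "((\<lambda>z. g (Re z)) has_derivative (\<lambda>h. Re h *\<^sub>R v)) (at (of_real t) within \<real>)"
    by (rule has_derivative_compose[OF bounded_linear_imp_has_derivative[OF bounded_linear_Re]])
       (use assms in \<open>simp add: has_vector_derivative_def\<close>)
  then have l: "((\<lambda>y. (1 / norm (y - of_real t)) *\<^sub>R (g (Re y) - (g t + Re (y - of_real t) *\<^sub>R v))) \<longlongrightarrow> 0) (at (of_real t) within \<real>)"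
    unfolding has_derivative_within by simp
  have "((\<lambda>y. (1 / norm (y - of_real t)) *\<^sub>R (g (Re y) - (g t + v * (y - of_real t)))) \<longlongrightarrow> 0) (at (of_real t) within \<real>)"
  proof (rule Lim_transform_within[OF l zero_less_one])
    fix y :: complex assume "y \<in> \<real>"
    then have "y - of_real t = of_real (Re (y - of_real t))" by (auto elim!: Reals_cases)
    then have "v * (y - of_real t) = Re (y - of_real t) *\<^sub>R v" by (metis mult.commute scaleR_conv_of_real)
    then show "(1 / norm (y - of_real t)) *\<^sub>R (g (Re y) - (g t + Re (y - of_real t) *\<^sub>R v)) =
       (1 / norm (y - of_real t)) *\<^sub>R (g (Re y) - (g t + v * (y - of_real t)))" by simp
  qed
  then show ?thesis
    unfolding has_field_derivative_def has_derivative_within by (simp add: bounded_linear_mult_right)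
qed

text \<open>For a multi-index supported on one axis the \<open>SOME\<close> in
  \<open>multi_deriv\<close> has a single list to choose from.\<close>

lemma multi_deriv_axis:
  "multi_deriv (\<chi> k. if k = i then j else 0) f = iter_partial (replicate j i) f"
proof -
  let ?P = "\<lambda>is. \<forall>k. count_list is k = (\<chi> k. if k = i then j else 0) $ k"
  define l where "l = (SOME is. ?P is)"
  have "?P l" unfolding l_def by (rule someI_ex) (rule ex_count_list)
  then have c: "count_list l k = (if k = i then j else 0)" for k by simp
  have s: "y = i" if "y \<in> set l" for y using c[of y] that by (metis count_list_0_iff)
  then have r: "l = replicate (length l) i" by (simp add: replicate_length_same)
  have "count_list (replicate n i) i = n" for n by (induction n) auto
  with r c[of i] have "length l = j" by metis
  with r have "l = replicate j i" by simp
  then show ?thesis by (simp add: multi_deriv_def l_def)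
qed

lemma gevrey_derivative_bound:
  assumes "f \<in> gevrey_space s R" "gevrey_norm s R f \<le> G" "R > 0"
  shows "cmod (iter_partial (replicate j i) f x) \<le> G * (R ^ j * fact j powr s)"
proof -
  define \<alpha> :: "nat ^ 'a" where "\<alpha> = (\<chi> k. if k = i then j else 0)"
  have "multi_order \<alpha> = j" by (simp add: multi_order_def \<alpha>_def)
  moreover have "multi_fact \<alpha> = fact j"
    unfolding multi_fact_def \<alpha>_def by (subst prod.remove[of _ i]) auto
  ultimately have "sup_norm (multi_deriv \<alpha> f) / (R ^ j * fact j powr s) \<le> G"
    using gevrey_quot_le_norm[OF assms(1), of \<alpha>] assms(2) by (simp add: gevrey_quot_def)
  then have "sup_norm (multi_deriv \<alpha> f) \<le> G * (R ^ j * fact j powr s)"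
    using assms(3) by (simp add: pos_divide_le_eq)
  moreover have "cmod (multi_deriv \<alpha> f x) \<le> sup_norm (multi_deriv \<alpha> f)"
    using assms(1) by (intro sup_norm_ge) (auto simp: gevrey_space_def)
  ultimately show ?thesis by (simp add: \<alpha>_def multi_deriv_axis)
qed

text \<open>For \<open>j \<le> n + 1\<close> the excess \<open>fact j powr (s - 1)\<close> is at
  most the \<open>j\<close>-th power of \<open>(n + 1) powr (s - 1)\<close>. After rescaling by
  \<open>r\<close> the Taylor coefficients up to that order are therefore bounded by
  \<open>G * q ^ j\<close>, as for an analytic function. Since \<open>2 * q \<le> 1/2\<close>, the
  polynomial is dominated by a geometric series even on the disc of radius 2.\<close>

lemma gevrey_taylor:
  fixes f :: "real ^ 'd::finite \<Rightarrow> complex"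
  assumes f: "f \<in> gevrey_space s R" "gevrey_norm s R f \<le> G" and R: "R > 0" and s: "s \<ge> 1" and r: "r > 0"
    and Q: "2 * R * r * real (n + 1) powr (s - 1) \<le> Q" "Q \<le> 1/2"
  shows "\<exists>p. p holomorphic_on UNIV \<and> (\<forall>z. cmod z \<le> 2 \<longrightarrow> cmod (p z) \<le> 2 * G) \<and>
     (\<forall>t. \<bar>t\<bar> \<le> 1 \<longrightarrow> cmod (f (x + (r * t) *\<^sub>R axis i 1) - p (of_real t)) \<le> G * real (n + 1) * Q ^ (n + 1))"
proof -
  define F where "F j z = r ^ j *\<^sub>R iter_partial (replicate j i) f (x + (r * Re z) *\<^sub>R axis i 1)" for j z
  define p where "p z = (\<Sum>j\<le>n. F j 0 * z ^ j / fact j)" for z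
  define q where "q = R * r * real (n + 1) powr (s - 1)"
  have q: "q > 0" "2 * q \<le> Q" using R r Q by (auto simp: q_def)
  have sm: "smooth f" using f by (simp add: gevrey_space_def)
  have G: "G \<ge> 0" using gevrey_norm_nonneg[OF R f(1)] f(2) by linarith
  have bound: "cmod (F j z) \<le> G * q ^ j * fact j" if "j \<le> n + 1" for j z
  proof -
    have "cmod (F j z) = r ^ j * cmod (iter_partial (replicate j i) f (x + (r * Re z) *\<^sub>R axis i 1))"
      using r by (simp add: F_def)
    also have "\<dots> \<le> r ^ j * (G * (R ^ j * fact j powr s))"
      using r by (intro mult_left_mono gevrey_derivative_bound f R) auto
    also have "fact j powr s = fact j * fact j powr (s - 1)"
      using powr_add[of "fact j" 1 "s - 1"] by simp
    also have "r ^ j * (G * (R ^ j * (fact j * fact j powr (s - 1)))) \<le>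
        r ^ j * (G * (R ^ j * (fact j * (real (n + 1) powr (s - 1)) ^ j)))"
    proof -
      have "fact j \<le> real j ^ j" by (metis fact_le_power order_refl of_nat_fact of_nat_power of_nat_le_iff)
      also have "\<dots> \<le> real (n + 1) ^ j" using that by (intro power_mono) auto
      finally have "fact j powr (s - 1) \<le> (real (n + 1) ^ j) powr (s - 1)"
        using s by (intro powr_mono2) auto
      also have "\<dots> = (real (n + 1) powr (s - 1)) ^ j"
        by (simp add: powr_realpow[symmetric] powr_powr mult.commute)
      finally show ?thesis using r R G by (intro mult_left_mono) auto
    qed
    also have "\<dots> = G * q ^ j * fact j" by (simp add: q_def power_mult_distrib mult_ac)
    finally show ?thesis .
  qed
  have "p holomorphic_on UNIV" unfolding p_def by (intro holomorphic_intros) auto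
  moreover have "cmod (p z) \<le> 2 * G" if z: "cmod z \<le> 2" for z
  proof -
    have "cmod (p z) \<le> (\<Sum>j\<le>n. G * (1/2) ^ j)"
      unfolding p_def
    proof (rule order_trans[OF norm_sum sum_mono])
      fix j assume j: "j \<in> {..n}"
      have "cmod (F j 0 * z ^ j / fact j) = cmod (F j 0) * cmod z ^ j / fact j"
        by (simp add: norm_mult norm_divide norm_power)
      also have "\<dots> \<le> (G * q ^ j * fact j) * 2 ^ j / fact j"
        using j z G q by (intro divide_right_mono mult_mono bound power_mono) auto
      also have "\<dots> = G * (2 * q) ^ j" by (simp add: power_mult_distrib)
      also have "\<dots> \<le> G * (1/2) ^ j" using q Q G by (intro mult_left_mono power_mono) auto
      finally show "cmod (F j 0 * z ^ j / fact j) \<le> G * (1/2) ^ j" .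
    qed
    also have "\<dots> = G * (\<Sum>j\<le>n. (1/2) ^ j)" by (simp add: sum_distrib_left)
    also have "\<dots> \<le> G * 2"
    proof (rule mult_left_mono[OF _ G])
      show "(\<Sum>j\<le>n. (1/2::real) ^ j) \<le> 2" by (subst sum_gp0) (simp add: field_simps)
    qed
    finally show ?thesis by simp
  qed
  moreover have "cmod (f (x + (r * t) *\<^sub>R axis i 1) - p (of_real t)) \<le> G * real (n + 1) * Q ^ (n + 1)"
    if t: "\<bar>t\<bar> \<le> 1" for t
  proof -
    \<comment> \<open>This form of the remainder divides by \<open>fact n\<close> where the
      derivative bound has \<open>fact (Suc n)\<close>; the quotient is the factor
      \<open>n + 1\<close> in the error.\<close>
    have "cmod (F 0 (of_real t) - (\<Sum>j\<le>n. F j 0 * (of_real t - 0) ^ j / fact j)) \<le>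
        (G * q ^ Suc n * fact (Suc n)) * cmod (of_real t - 0) ^ Suc n / fact n"
    proof (rule field_Taylor[where S = \<real>])
      show "convex (\<real> :: complex set)" by (rule convex_Reals)
      fix j z assume "z \<in> (\<real> :: complex set)"
      then obtain u where u: "z = of_real u" by (auto elim: Reals_cases)
      show "(F j has_field_derivative F (Suc j) z) (at z within \<real>)"
        using has_field_derivative_of_Re[OF iter_partial_line_deriv[OF sm, of r j i x u]]
        by (simp add: F_def[abs_def] u del: power_Suc replicate_Suc)
    next
      show "cmod (F (Suc n) z) \<le> G * q ^ Suc n * fact (Suc n)" for z using bound[of "Suc n" z] by simp
    qed auto
    also have "\<dots> \<le> (G * q ^ Suc n * fact (Suc n)) * 1 / fact n"
      using t G q by (intro divide_right_mono mult_left_mono power_le_one) auto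
    also have "\<dots> = G * real (n + 1) * q ^ (n + 1)" by simp
    also have "\<dots> \<le> G * real (n + 1) * Q ^ (n + 1)"
      using q G by (intro mult_left_mono power_mono) auto
    finally show ?thesis by (simp add: F_def p_def iter_partial_def)
  qed
  ultimately show ?thesis by blast
qed

section \<open>Holomorphic approximation of the iterates\<close>

lemma norm_mat2_le:
  fixes X :: "complex^2^2"
  assumes "\<And>a b. cmod (X$a$b) \<le> e" shows "norm X \<le> 2 * e"
proof -
  have e: "e \<ge> 0" using assms[of 1 1] norm_ge_zero by (rule order_trans[rotated])
  have "(cmod (X$a$b))\<^sup>2 \<le> e\<^sup>2" for a b using assms by (intro power_mono) auto
  from this[of 1 1] this[of 1 2] this[of 2 1] this[of 2 2] have "(norm X)\<^sup>2 \<le> (2 * e)\<^sup>2"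
    unfolding norm_mat2 by (simp add: power_mult_distrib)
  then show ?thesis by (rule power2_le_imp_le) (use e in simp)
qed

lemma gevrey_bounded_cocycle:
  assumes "A \<in> gevrey_cocycles s R" and G: "\<And>a b. gevrey_norm s R (\<lambda>x. A x $ a $ b) \<le> G"
  shows "bounded_cocycle (2 * G) A"
proof -
  have e: "(\<lambda>x. A x $ a $ b) \<in> gevrey_space s R" for a b using assms(1) by (simp add: gevrey_cocycles_def)
  have "torus_periodic A"
    using e unfolding gevrey_space_def torus_periodic_def by (simp add: vec_eq_iff)
  moreover have "continuous_on UNIV (\<lambda>x. A x $ a $ b)" for a b
  proof -
    have "smooth (\<lambda>x. A x $ a $ b)" using e by (simp add: gevrey_space_def)
    then have "(\<lambda>x. A x $ a $ b) differentiable (at x)" for x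
      unfolding smooth_def by (metis foldr_Nil iter_partial_def id_apply)
    then show ?thesis by (simp add: continuous_on_eq_continuous_at differentiable_imp_continuous_within)
  qed
  then have "continuous_on UNIV (\<lambda>x. \<chi> a b. A x $ a $ b)" by (intro continuous_on_vec_lambda)
  then have "continuous_on UNIV A" by simp
  moreover have "norm (A x) \<le> 2 * G" for x
    using norm_le_gevrey_norm[OF e] G by (intro norm_mat2_le) (meson order_trans)
  ultimately show ?thesis using assms(1) by (simp add: bounded_cocycle_def gevrey_cocycles_def)
qed

text \<open>On a disc of this radius the Taylor terms of order \<open>N\<close> decay like \<open>(16 G)\<^bsup>-N\<^esup>\<close>, which beats the
  growth \<open>(4 G)\<^bsup>N\<^esup>\<close> of the products.\<close>

definition strip_width :: "real \<Rightarrow> real \<Rightarrow> real \<Rightarrow> nat \<Rightarrow> real" where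
  "strip_width s R G N = 1 / (32 * R * G * real (N + 1) powr (s - 1))"

text \<open>Each factor is replaced by a matrix of Taylor polynomials of degree \<open>N\<close>,
  and the product is compared by telescoping. A replacement has error
  \<open>2 * G * (N + 1) * Q ^ (N + 1)\<close> with \<open>Q = 1 / (16 * G)\<close>, all factors are
  bounded by \<open>4 * G\<close>, and the total is at most
  \<open>N * (N + 1) * (1/4) ^ (N + 1)\<close>. An error of \<open>1/2\<close> suffices because the
  iterates have norm at least 1.\<close>

lemma iterate_holomorphic_approx:
  fixes A :: "real ^ 'd::finite \<Rightarrow> complex ^ 2 ^ 2"
  assumes A: "A \<in> gevrey_cocycles s R" and G: "\<And>a b. gevrey_norm s R (\<lambda>x. A x $ a $ b) \<le> G" "G \<ge> 1"
    and R: "R > 0" and s: "s \<ge> 1"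
  shows "\<exists>P. (\<forall>a b. (\<lambda>z. P z $ a $ b) holomorphic_on UNIV) \<and> (\<forall>z. cmod z \<le> 2 \<longrightarrow> norm (P z) \<le> 2 * (4 * G) ^ N) \<and>
    (\<forall>t. \<bar>t\<bar> \<le> 1 \<longrightarrow> norm (cocycle_iterate A \<omega> N (x + (strip_width s R G N * t) *\<^sub>R axis i 1) - P (of_real t)) \<le> 1/2)"
proof -
  define r where "r = strip_width s R G N"
  define Q where "Q = 1 / (16 * G)"
  have Q: "0 < Q" "Q \<le> 1/2" using G by (auto simp: Q_def field_simps)
  have r: "r > 0" "2 * R * r * real (N + 1) powr (s - 1) \<le> Q"
    using R G by (auto simp: r_def strip_width_def Q_def)
  have e: "(\<lambda>x. A x $ a $ b) \<in> gevrey_space s R" for a b using A by (simp add: gevrey_cocycles_def)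
  have "\<forall>j a b. \<exists>p. p holomorphic_on UNIV \<and> (\<forall>z. cmod z \<le> 2 \<longrightarrow> cmod (p z) \<le> 2 * G) \<and>
     (\<forall>t. \<bar>t\<bar> \<le> 1 \<longrightarrow> cmod (A ((x + real j *\<^sub>R \<omega>) + (r * t) *\<^sub>R axis i 1) $ a $ b - p (of_real t)) \<le> G * real (N + 1) * Q ^ (N + 1))"
    using gevrey_taylor[OF e G(1) R s r(1) r(2) Q(2)] by blast
  then obtain p where p: "\<And>j a b. p j a b holomorphic_on UNIV"
      "\<And>j a b z. cmod z \<le> 2 \<Longrightarrow> cmod (p j a b z) \<le> 2 * G"
      "\<And>j a b t. \<bar>t\<bar> \<le> 1 \<Longrightarrow> cmod (A ((x + real j *\<^sub>R \<omega>) + (r * t) *\<^sub>R axis i 1) $ a $ b - p j a b (of_real t)) \<le> G * real (N + 1) * Q ^ (N + 1)"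
    unfolding choice_iff by blast
  define X where "X j z = (\<chi> a b. p j a b z)" for j z
  define P where "P = rec_nat (\<lambda>z. mat 1) (\<lambda>j Y z. X j z ** Y z)"
  have P: "P 0 z = mat 1" "P (Suc j) z = X j z ** P j z" for j z by (simp_all add: P_def)
  have hol: "(\<lambda>z. P k z $ a $ b) holomorphic_on UNIV" for k a b
  proof (induction k arbitrary: a b)
    case (Suc k)
    then show ?case unfolding P mat2_mult X_def vec_lambda_beta by (intro holomorphic_intros p)
  qed (simp add: P)
  have X: "norm (X j z) \<le> 4 * G" if "cmod z \<le> 2" for j z
    using norm_mat2_le[of "X j z" "2 * G"] p(2)[OF that] by (simp add: X_def)
  have id: "norm (mat 1 :: complex^2^2) \<le> 2"
    by (rule power2_le_imp_le) (simp_all add: norm_mat2 mat_def)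
  have nP: "norm (P k z) \<le> 2 * (4 * G) ^ k" if "cmod z \<le> 2" for k z
  proof (induction k)
    case (Suc k)
    have "norm (P (Suc k) z) \<le> norm (X k z) * norm (P k z)" unfolding P by (rule norm_matrix_mult_le)
    also have "\<dots> \<le> (4 * G) * (2 * (4 * G) ^ k)"
      using X[OF that] Suc G by (intro mult_mono) auto
    finally show ?case by simp
  qed (simp add: P id)
  have err: "norm (cocycle_iterate A \<omega> N (x + (r * t) *\<^sub>R axis i 1) - P N (of_real t)) \<le> 1/2" if t: "\<bar>t\<bar> \<le> 1" for t
  proof -
    define y where "y = x + (r * t) *\<^sub>R axis i (1::real)"
    define \<epsilon> where "\<epsilon> = 2 * (G * real (N + 1) * Q ^ (N + 1))"
    have \<epsilon>: "\<epsilon> \<ge> 0" using G Q by (simp add: \<epsilon>_def)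
    have AX: "norm (A (y + real j *\<^sub>R \<omega>) - X j (of_real t)) \<le> \<epsilon>" for j
    proof -
      have "cmod ((A (y + real j *\<^sub>R \<omega>) - X j (of_real t)) $ a $ b) \<le> G * real (N + 1) * Q ^ (N + 1)" for a b
        using p(3)[OF t, of j a b] by (simp add: y_def X_def algebra_simps)
      from norm_mat2_le[OF this] show ?thesis by (simp add: \<epsilon>_def)
    qed
    have nA: "norm (A z) \<le> 4 * G" for z
      using gevrey_bounded_cocycle[OF A G(1)] G(2) unfolding bounded_cocycle_def by (smt (verit))
    have t2: "cmod (of_real t) \<le> 2" using t by simp
    have "norm (cocycle_iterate A \<omega> k y - P k (of_real t)) \<le> real k * (2 * \<epsilon> * (4 * G) ^ k)" for k
    proof (induction k)
      case (Suc k)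
      let ?a = "A (y + real k *\<^sub>R \<omega>)" and ?I = "cocycle_iterate A \<omega> k y" and ?X = "X k (of_real t)" and ?P = "P k (of_real t)"
      have "?a ** ?I - ?X ** ?P = ?a ** (?I - ?P) + (?a - ?X) ** ?P"
        unfolding vec_eq_iff forall_2 vector_minus_component vector_add_component mat2_mult by (simp add: algebra_simps)
      then have "norm (?a ** ?I - ?X ** ?P) \<le> norm (?a ** (?I - ?P)) + norm ((?a - ?X) ** ?P)"
        by (simp add: norm_triangle_ineq)
      also have "\<dots> \<le> (4 * G) * (real k * (2 * \<epsilon> * (4 * G) ^ k)) + \<epsilon> * (2 * (4 * G) ^ k)"
        using nA AX nP[OF t2] Suc G \<epsilon> by (intro add_mono order_trans[OF norm_matrix_mult_le] mult_mono) auto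
      also have "\<epsilon> * (2 * (4 * G) ^ k) \<le> (4 * G) * (\<epsilon> * (2 * (4 * G) ^ k))"
        using G \<epsilon> mult_right_mono[of 1 "4 * G" "\<epsilon> * (2 * (4 * G) ^ k)"] by simp
      finally show ?case by (simp add: P algebra_simps)
    qed (simp add: P)
    from this[of N] have "norm (cocycle_iterate A \<omega> N y - P N (of_real t)) \<le> real N * (2 * \<epsilon> * (4 * G) ^ N)" .
    also have "\<dots> = real N * real (N + 1) * ((4 * G) * Q) ^ (N + 1)"
      by (simp add: \<epsilon>_def power_mult_distrib)
    also have "(4 * G) * Q = 1/4" using G by (simp add: Q_def)
    also have "real N * real (N + 1) * (1/4) ^ (N + 1) \<le> 1/2"
    proof -
      have 1: "real (N + 1) \<le> 2 ^ N" by (induction N) auto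
      then have "real N * real (N + 1) \<le> 2 ^ N * 2 ^ N" by (intro mult_mono) auto
      also have "\<dots> = 4 ^ N" by (simp add: power_mult_distrib[symmetric])
      also have "\<dots> \<le> 2 * 4 ^ N" by simp
      finally show ?thesis by (simp add: power_divide divide_simps)
    qed
    finally show ?thesis by (simp add: y_def)
  qed
  show ?thesis using hol[of N] nP[of _ N] err unfolding r_def by blast
qed

text \<open>As \<open>a \<ge> 1\<close>, the hypothesis puts \<open>p\<close> between
  \<open>a / 2\<close> and \<open>a + 1/2\<close>, so both the error and the added 1 change the
  logarithm by a bounded amount.\<close>

lemma ln_one_plus_square_approx:
  fixes a p :: real
  assumes a: "a \<ge> 1" and ap: "\<bar>a - p\<bar> \<le> 1/2"
  shows "\<bar>ln (1 + p\<^sup>2) / 2 - ln a\<bar> \<le> 1"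
proof -
  have e: "(2::real) \<le> exp 1" using exp_ge_add_one_self[of 1] by simp
  have p: "a / 2 \<le> p" "p \<le> a + 1/2" using ap a unfolding abs_le_iff by linarith+
  have "p\<^sup>2 \<le> (a + 1/2)\<^sup>2" using p a by (intro power_mono) auto
  also have "(a + 1/2)\<^sup>2 = a\<^sup>2 + a + 1/4" by (simp add: power2_eq_square algebra_simps)
  finally have "1 + p\<^sup>2 \<le> (2 * a)\<^sup>2"
    using a self_le_power[of a 2] by (simp add: power_mult_distrib)
  then have "ln (1 + p\<^sup>2) \<le> ln ((2 * a)\<^sup>2)" by (intro ln_mono) (auto intro: add_pos_nonneg)
  also have "\<dots> = 2 * ln 2 + 2 * ln a"
    using a ln_realpow[of "2 * a" 2] ln_mult_pos[of 2 a] by (simp del: power_mult_distrib)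
  finally have 1: "ln (1 + p\<^sup>2) \<le> 2 * ln 2 + 2 * ln a" .
  have "(a / 2)\<^sup>2 \<le> p\<^sup>2" using p a by (intro power_mono) auto
  then have "ln ((a / 2)\<^sup>2) \<le> ln (1 + p\<^sup>2)" using a by (intro ln_mono) auto
  moreover have "ln ((a / 2)\<^sup>2) = 2 * ln a - 2 * ln 2"
    using a ln_realpow[of "a / 2" 2] ln_div[of a 2] by (simp del: power_divide)
  moreover have "ln 2 \<le> (1::real)" using e by (metis ln_exp ln_mono zero_less_numeral)
  ultimately show ?thesis using 1 by (simp add: abs_le_iff)
qed

lemma log_iter_line_modulus:
  fixes A :: "real ^ 'd::finite \<Rightarrow> complex ^ 2 ^ 2"
  assumes A: "A \<in> gevrey_cocycles s R" and G: "\<And>a b. gevrey_norm s R (\<lambda>x. A x $ a $ b) \<le> G" "G \<ge> 1"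
    and R: "R > 0" and s: "s \<ge> 1" and N: "N \<ge> 1" and h: "0 < h" "h \<le> 1/4"
  defines "r \<equiv> strip_width s R G N"
  shows "integral {-1/4..1/4} (\<lambda>t. \<bar>log_iter A \<omega> N (x + (r * (t + h)) *\<^sub>R axis i 1) - log_iter A \<omega> N (x + (r * t) *\<^sub>R axis i 1)\<bar>)
     \<le> 21 * real N * (1 + ln (4 * G)) * sqrt h + 1"
proof -
  obtain P where P: "\<And>a b. (\<lambda>z. P z $ a $ b) holomorphic_on UNIV" "\<And>z. cmod z \<le> 2 \<Longrightarrow> norm (P z) \<le> 2 * (4 * G) ^ N"
    "\<And>t. \<bar>t\<bar> \<le> 1 \<Longrightarrow> norm (cocycle_iterate A \<omega> N (x + (r * t) *\<^sub>R axis i 1) - P (of_real t)) \<le> 1/2"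
    using iterate_holomorphic_approx[OF A G R s, of N \<omega> x i] unfolding r_def by blast
  define f where "f k z = P z $ fst k $ snd k" for k :: "2 \<times> 2" and z
  have nf: "(\<Sum>k\<in>UNIV. (cmod (f k z))\<^sup>2) = (norm (P z))\<^sup>2" for z
  proof -
    have "(\<Sum>k\<in>UNIV. c k) = (\<Sum>a\<in>UNIV. \<Sum>b\<in>UNIV. c (a, b))" for c :: "2 \<times> 2 \<Rightarrow> real"
      using sum.cartesian_product[of "\<lambda>a b. c (a, b)" UNIV UNIV] by (simp add: case_prod_unfold)
    then show ?thesis by (simp add: norm_mat2 f_def sum_2)
  qed
  define W where "W t = ln (1 + (norm (P (of_real t)))\<^sup>2)" for t :: real
  \<comment> \<open>\<open>1 + (norm (P z))\<^sup>2 \<le> 5 * (4 * G) ^ (2 * N)\<close>, and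
    \<open>ln 5 \<le> 2 \<le> 2 * N\<close>.\<close>
  define S where "S = 2 * real N * (1 + ln (4 * G))"
  have lG: "ln (4 * G) \<ge> 0" using G by simp
  have S: "S > 0" using N lG by (simp add: S_def)
  have W: "integral {-1/4..1/4} (\<lambda>t. \<bar>W (t + h) - W t\<bar>) \<le> 21 * S * sqrt h"
  proof -
    have b: "ln (1 + (\<Sum>k\<in>UNIV. (cmod (f k z))\<^sup>2)) \<le> S" if "cmod z \<le> 2" for z
    proof -
      have "(norm (P z))\<^sup>2 \<le> (2 * (4 * G) ^ N)\<^sup>2" using P(2)[OF that] by (intro power_mono) auto
      also have "\<dots> = 4 * (4 * G) ^ (2 * N)"
        unfolding power_mult_distrib[of 2] power_mult[symmetric] by (simp add: mult.commute)
      finally have "(norm (P z))\<^sup>2 \<le> 4 * (4 * G) ^ (2 * N)" .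
      moreover have "1 \<le> (4 * G) ^ (2 * N)" using G by (intro one_le_power) auto
      ultimately have le: "1 + (norm (P z))\<^sup>2 \<le> 5 * (4 * G) ^ (2 * N)" by linarith
      have "1 + (\<Sum>k\<in>UNIV. (cmod (f k z))\<^sup>2) > 0" by (intro add_pos_nonneg sum_nonneg) auto
      then have "ln (1 + (\<Sum>k\<in>UNIV. (cmod (f k z))\<^sup>2)) \<le> ln (5 * (4 * G) ^ (2 * N))"
        using le unfolding nf by (intro ln_mono) auto
      also have "\<dots> = ln 5 + 2 * real N * ln (4 * G)"
        using G ln_realpow[of "4 * G" "2 * N"] by (simp add: ln_mult_pos distrib_left)
      also have "ln 5 \<le> (2 * 1 :: real)"
      proof -
        have "(5::real) \<le> (1 + 1 + 1\<^sup>2 / 2)\<^sup>2" by (simp add: power2_eq_square)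
        also have "\<dots> \<le> (exp 1)\<^sup>2" by (intro power_mono exp_lower_Taylor_quadratic) auto
        also have "\<dots> = exp (2 * 1)" by (simp only: exp_double)
        finally have "ln 5 \<le> ln (exp (2 * 1 :: real))" by (intro ln_mono) auto
        then show ?thesis by (simp only: ln_exp)
      qed
      also have "2 * 1 + 2 * real N * ln (4 * G) \<le> S" using N by (simp add: S_def algebra_simps)
      finally show ?thesis by simp
    qed
    have "integral {-1/4..1/4} (\<lambda>t. \<bar>ln (1 + (\<Sum>k\<in>UNIV. (cmod (f k (of_real (t + h))))\<^sup>2)) -
            ln (1 + (\<Sum>k\<in>UNIV. (cmod (f k (of_real t)))\<^sup>2))\<bar>) \<le> 21 * S * sqrt h"
      by (rule L1_modulus_log_holomorphic[OF _ b S h]) (auto simp: f_def P)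
    then show ?thesis unfolding nf W_def .
  qed
  have approx: "\<bar>W t / 2 - log_iter A \<omega> N (x + (r * t) *\<^sub>R axis i 1)\<bar> \<le> 1" if "\<bar>t\<bar> \<le> 1" for t
    unfolding W_def log_iter_def
    by (rule ln_one_plus_square_approx[OF cocycle_facts(4)[OF gevrey_bounded_cocycle[OF A G(1)]]])
       (rule order_trans[OF norm_triangle_ineq3 P(3)[OF that]])
  have cW: "continuous_on T (\<lambda>t. W (g t))" if "continuous_on T g" for T g
  proof -
    have "continuous_on UNIV (\<lambda>z. \<chi> a b. P z $ a $ b)" by (intro continuous_on_vec_lambda holomorphic_on_imp_continuous_on P)
    then have "continuous_on UNIV P" by simp
    then have "continuous_on T (\<lambda>t. P (of_real (g t)))"
      by (rule continuous_on_compose2) (auto intro!: continuous_intros that)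
    moreover have "1 + (norm (P z))\<^sup>2 \<noteq> 0" for z by (metis add_pos_nonneg less_irrefl zero_le_power2 zero_less_one)
    ultimately show ?thesis unfolding W_def by (intro continuous_intros) auto
  qed
  have cL: "continuous_on T (\<lambda>t. log_iter A \<omega> N (x + (r * g t) *\<^sub>R axis i 1))" if "continuous_on T g" for T and g :: "real \<Rightarrow> real"
    by (rule continuous_on_compose2[OF log_iter_continuous[OF gevrey_bounded_cocycle[OF A G(1)]]]) (auto intro!: continuous_intros that)
  \<comment> \<open>Replacing \<open>log_iter\<close> by \<open>W / 2\<close> costs 1 at each of the
    two points, and the constant 2 is integrated over a length of \<open>1/2\<close>.\<close>
  have "integral {-1/4..1/4} (\<lambda>t. \<bar>log_iter A \<omega> N (x + (r * (t + h)) *\<^sub>R axis i 1) - log_iter A \<omega> N (x + (r * t) *\<^sub>R axis i 1)\<bar>)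
     \<le> integral {-1/4..1/4} (\<lambda>t. \<bar>W (t + h) - W t\<bar> / 2 + 2)"
  proof (rule integral_le)
    fix t :: real assume "t \<in> {-1/4..1/4}"
    then have "\<bar>t\<bar> \<le> 1" "\<bar>t + h\<bar> \<le> 1" using h by (auto simp: abs_le_iff)
    from approx[OF this(1)] approx[OF this(2)]
    show "\<bar>log_iter A \<omega> N (x + (r * (t + h)) *\<^sub>R axis i 1) - log_iter A \<omega> N (x + (r * t) *\<^sub>R axis i 1)\<bar> \<le> \<bar>W (t + h) - W t\<bar> / 2 + 2"
      by argo
  qed ((intro integrable_continuous_interval continuous_intros cW cL; simp)+)
  also have "\<dots> = integral {-1/4..1/4} (\<lambda>t. \<bar>W (t + h) - W t\<bar>) / 2 + 1"
    by (subst integral_add) (auto intro!: integrable_continuous_interval continuous_intros cW)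
  also have "\<dots> \<le> 21 * real N * (1 + ln (4 * G)) * sqrt h + 1" using W by (simp add: S_def)
  finally show ?thesis .
qed

subsection \<open>Deviation from the mean\<close>

text \<open>The L1 modulus of continuity on the torus. It is even, subadditive and periodic in
  \<open>y\<close>, so an arbitrary translation can be split into an orbit step and a small
  remainder.\<close>

definition translation_osc :: "(real ^ 'd::finite \<Rightarrow> real) \<Rightarrow> real ^ 'd \<Rightarrow> real" where
  "translation_osc L y = integral (cbox 0 1) (\<lambda>x. \<bar>L (x + y) - L x\<bar>)"

lemma content_unit_cube [simp]: "measure lborel (cbox (0 :: real ^ 'd::finite) 1) = 1"
proof -
  have "(0 :: real^'d) \<in> cbox 0 1" by (simp add: mem_box_cart)
  then have "cbox (0 :: real^'d) 1 \<noteq> {}" by blast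
  then show ?thesis by (simp add: content_cbox_cart)
qed

context
  fixes L :: "real ^ 'd::finite \<Rightarrow> real"
  assumes per: "torus_periodic L" and cont: "continuous_on UNIV L"
begin

lemma cont_compose: "continuous_on S f \<Longrightarrow> continuous_on S (\<lambda>x. L (f x))"
  by (rule continuous_on_compose2[OF cont]) auto

lemma osc_shift: "integral (cbox 0 1) (\<lambda>x. \<bar>L (x + y + z) - L (x + z)\<bar>) = translation_osc L y"
proof -
  have "integral (cbox 0 1) (\<lambda>x. (\<lambda>x. \<bar>L (x + y) - L x\<bar>) (x + z)) = integral (cbox 0 1) (\<lambda>x. \<bar>L (x + y) - L x\<bar>)"
  proof (rule torus_integral_shift)
    show "torus_periodic (\<lambda>x. \<bar>L (x + y) - L x\<bar>)"
      using per unfolding torus_periodic_def by (metis add.assoc add.commute)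
    show "continuous_on UNIV (\<lambda>x. \<bar>L (x + y) - L x\<bar>)" by (intro continuous_intros cont_compose)
  qed
  then show ?thesis by (simp add: translation_osc_def add_ac)
qed

lemma osc_add: "translation_osc L (y + z) \<le> translation_osc L y + translation_osc L z"
proof -
  have "translation_osc L (y + z) \<le> integral (cbox 0 1) (\<lambda>x. \<bar>L (x + y + z) - L (x + z)\<bar> + \<bar>L (x + z) - L x\<bar>)"
    unfolding translation_osc_def
    by (intro integral_le integrable_continuous continuous_intros cont_compose) (simp add: add.assoc)
  also have "\<dots> = integral (cbox 0 1) (\<lambda>x. \<bar>L (x + y + z) - L (x + z)\<bar>) + translation_osc L z"
    unfolding translation_osc_def by (intro integral_add integrable_continuous continuous_intros cont_compose)
  finally show ?thesis by (simp add: osc_shift)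
qed

lemma osc_0 [simp]: "translation_osc L 0 = 0" by (simp add: translation_osc_def)

lemma osc_minus: "translation_osc L (- y) = translation_osc L y"
  using osc_shift[of "-y" y] by (simp add: translation_osc_def abs_minus_commute)

lemma osc_sum: "finite S \<Longrightarrow> translation_osc L (\<Sum>i\<in>S. v i) \<le> (\<Sum>i\<in>S. translation_osc L (v i))"
proof (induction S rule: finite_induct)
  case (insert i S)
  then show ?case using osc_add[of "v i" "sum v S"] by simp
qed simp

lemma osc_int: "translation_osc L (y + (\<chi> i. of_int (k i))) = translation_osc L y"
proof -
  have "L (x + (y + (\<chi> i. of_int (k i)))) = L (x + y)" for x
    using per[unfolded torus_periodic_def, rule_format, of "x + y" "\<chi> i. k i"] by (simp add: add.assoc)
  then show ?thesis by (simp add: translation_osc_def)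
qed

lemma osc_le_sup:
  assumes "\<And>x. \<bar>L (x + y) - L x\<bar> \<le> B" shows "translation_osc L y \<le> B"
proof -
  have "translation_osc L y \<le> integral (cbox 0 1) (\<lambda>x::real^'d. B)"
    unfolding translation_osc_def using assms
    by (intro integral_le integrable_continuous continuous_intros cont_compose) auto
  then show ?thesis by simp
qed

text \<open>The mean of \<open>L\<close> is the average of its translates, so the deviation at
  \<open>x\<close> is at most the average over \<open>y\<close> of
  \<open>\<bar>L (x + y) - L x\<bar>\<close>; then exchange the integrals.\<close>

lemma deviation_le_osc:
  assumes B: "\<And>y. translation_osc L y \<le> B"
  shows "integral (cbox 0 1) (\<lambda>x. \<bar>L x - integral (cbox 0 1) L\<bar>) \<le> B"
proof -
  have c: "continuous_on UNIV (\<lambda>x. integral (cbox 0 1) (\<lambda>y. \<bar>L (x + y) - L x\<bar>))"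
    by (rule integral_continuous_on_param)
       (auto simp: case_prod_unfold intro!: continuous_intros cont_compose)
  have "integral (cbox 0 1) (\<lambda>x. \<bar>L x - integral (cbox 0 1) L\<bar>) \<le>
     integral (cbox 0 1) (\<lambda>x::real^'d. integral (cbox 0 1) (\<lambda>y. \<bar>L (x + y) - L x\<bar>))"
  proof (rule integral_le)
    show "(\<lambda>x. \<bar>L x - integral (cbox 0 1) L\<bar>) integrable_on cbox 0 1"
      by (intro integrable_continuous continuous_intros cont_compose)
    show "(\<lambda>x. integral (cbox 0 1) (\<lambda>y. \<bar>L (x + y) - L x\<bar>)) integrable_on cbox 0 1"
      by (intro integrable_continuous continuous_on_subset[OF c]) simp
    fix x :: "real^'d"
    have "integral (cbox 0 1) (\<lambda>y. L (x + y) - L x) = integral (cbox 0 1) (\<lambda>y. L (y + x)) - L x"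
      by (subst integral_diff) (auto intro!: integrable_continuous continuous_intros cont_compose simp: add.commute)
    also have "integral (cbox 0 1) (\<lambda>y. L (y + x)) = integral (cbox 0 1) L" by (rule torus_integral_shift[OF per cont])
    finally have "\<bar>L x - integral (cbox 0 1) L\<bar> = norm (integral (cbox 0 1) (\<lambda>y. L (x + y) - L x))" by simp
    also have "\<dots> \<le> integral (cbox 0 1) (\<lambda>y. \<bar>L (x + y) - L x\<bar>)"
      by (rule integral_norm_bound_integral) (auto intro!: integrable_continuous continuous_intros cont_compose)
    finally show "\<bar>L x - integral (cbox 0 1) L\<bar> \<le> integral (cbox 0 1) (\<lambda>y. \<bar>L (x + y) - L x\<bar>)" .
  qed
  also have "\<dots> = integral (cbox 0 1) (\<lambda>y. translation_osc L y)"
    unfolding translation_osc_def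
    by (rule integral_swap_continuous) (auto simp: case_prod_unfold intro!: continuous_intros cont_compose)
  also have "\<dots> \<le> integral (cbox 0 1) (\<lambda>y::real^'d. B)"
  proof (rule integral_le)
    have "continuous_on UNIV (\<lambda>y. integral (cbox 0 1) (\<lambda>x. \<bar>L (x + y) - L x\<bar>))"
      by (rule integral_continuous_on_param)
         (auto simp: case_prod_unfold intro!: continuous_intros cont_compose)
    then show "translation_osc L integrable_on cbox 0 1"
      unfolding translation_osc_def[abs_def] by (intro integrable_continuous) (rule continuous_on_subset, auto)
  qed (use B in auto)
  finally show ?thesis by simp
qed

text \<open>Translation invariance lets the base point slide along the line. Averaging over the
  parameter interval, of length \<open>1/2\<close>, brings in the line integrals and the factor
  2.\<close>

lemma osc_from_line_integrals:
  assumes B: "\<And>x. integral {-1/4..1/4} (\<lambda>t. \<bar>L (x + (r * (t + h)) *\<^sub>R v) - L (x + (r * t) *\<^sub>R v)\<bar>) \<le> B"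
  shows "translation_osc L ((r * h) *\<^sub>R v) \<le> 2 * B"
proof -
  have "(1/2) * translation_osc L ((r * h) *\<^sub>R v) = integral (cbox (-1/4) (1/4)) (\<lambda>t::real. translation_osc L ((r * h) *\<^sub>R v))"
    by simp
  also have "\<dots> = integral (cbox (-1/4) (1/4)) (\<lambda>t::real. integral (cbox 0 1) (\<lambda>x. \<bar>L (x + (r * (t + h)) *\<^sub>R v) - L (x + (r * t) *\<^sub>R v)\<bar>))"
  proof (rule integral_cong)
    show "translation_osc L ((r * h) *\<^sub>R v) =
        integral (cbox 0 1) (\<lambda>x. \<bar>L (x + (r * (t + h)) *\<^sub>R v) - L (x + (r * t) *\<^sub>R v)\<bar>)" for t
      using osc_shift[of "(r * h) *\<^sub>R v" "(r * t) *\<^sub>R v"] by (simp add: algebra_simps)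
  qed
  also have "\<dots> = integral (cbox 0 1) (\<lambda>x. integral (cbox (-1/4) (1/4)) (\<lambda>t. \<bar>L (x + (r * (t + h)) *\<^sub>R v) - L (x + (r * t) *\<^sub>R v)\<bar>))"
    by (rule integral_swap_continuous) (auto simp: case_prod_unfold intro!: continuous_intros cont_compose)
  also have "\<dots> \<le> integral (cbox 0 1) (\<lambda>x::real^'d. B)"
  proof (rule integral_le)
    have "continuous_on UNIV (\<lambda>x. integral (cbox (-1/4) (1/4)) (\<lambda>t. \<bar>L (x + (r * (t + h)) *\<^sub>R v) - L (x + (r * t) *\<^sub>R v)\<bar>))"
      by (rule integral_continuous_on_param)
         (auto simp: case_prod_unfold intro!: continuous_intros cont_compose)
    then show "(\<lambda>x. integral (cbox (-1/4) (1/4)) (\<lambda>t. \<bar>L (x + (r * (t + h)) *\<^sub>R v) - L (x + (r * t) *\<^sub>R v)\<bar>)) integrable_on cbox 0 1"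
      by (intro integrable_continuous) (rule continuous_on_subset, auto)
  qed (use B in auto)
  finally show ?thesis by simp
qed

end

section \<open>Translations of the logarithms of Gevrey cocycle iterates\<close>

lemma gevrey_small_translation_osc:
  fixes A :: "real ^ 'd::finite \<Rightarrow> complex ^ 2 ^ 2"
  assumes A: "A \<in> gevrey_cocycles s R" and G: "\<And>a b. gevrey_norm s R (\<lambda>x. A x $ a $ b) \<le> G" "G \<ge> 1"
    and R: "R > 0" and s: "s \<ge> 1" and N: "N \<ge> 1"
    and \<eta>: "0 \<le> \<eta>" "\<eta> \<le> strip_width s R G N / 4" and y: "\<And>i. \<bar>y $ i\<bar> \<le> \<eta>"
  shows "translation_osc (log_iter A \<omega> N) y \<le>
     real CARD('d) * (42 * real N * (1 + ln (4 * G)) * sqrt (\<eta> / strip_width s R G N) + 2)"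
proof -
  define L where "L = log_iter A \<omega> N"
  define r where "r = strip_width s R G N"
  have r: "r > 0" using R G by (simp add: r_def strip_width_def)
  note bc = gevrey_bounded_cocycle[OF A G(1)]
  have per: "torus_periodic L" and cont: "continuous_on UNIV L"
    unfolding L_def by (rule log_iter_periodic[OF bc] log_iter_continuous[OF bc])+
  have lG: "ln (4 * G) \<ge> 0" using G by simp
  define B where "B = 42 * real N * (1 + ln (4 * G)) * sqrt (\<eta> / r) + 2"
  have B0: "B \<ge> 0" using lG r \<eta> by (simp add: B_def)
  have pos: "translation_osc L (t *\<^sub>R axis i 1) \<le> B" if t: "0 < t" "t \<le> \<eta>" for t i
  proof -
    \<comment> \<open>The displacement in units of the strip width. The line estimate wants it
      positive and at most \<open>1/4\<close>; negative displacements are treated by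
      evenness.\<close>
    define h where "h = t / r"
    have h: "0 < h" "h \<le> 1/4" "h \<le> \<eta> / r" using t \<eta> r by (auto simp: h_def r_def[symmetric] field_simps)
    have "translation_osc L ((r * h) *\<^sub>R axis i 1) \<le> 2 * (21 * real N * (1 + ln (4 * G)) * sqrt h + 1)"
      unfolding L_def r_def
      by (rule osc_from_line_integrals[OF log_iter_periodic[OF bc] log_iter_continuous[OF bc]])
         (rule log_iter_line_modulus[OF A G R s N h(1,2)])
    also have "\<dots> = 42 * real N * (1 + ln (4 * G)) * sqrt h + 2" by simp
    also have "\<dots> \<le> B"
      unfolding B_def using h lG by (intro add_right_mono mult_left_mono) auto
    finally show ?thesis using r by (simp add: h_def)
  qed
  have ax: "translation_osc L (t *\<^sub>R axis i 1) \<le> B" if t: "\<bar>t\<bar> \<le> \<eta>" for t i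
  proof -
    consider "t > 0" | "t = 0" | "t < 0" by linarith
    then show ?thesis
    proof cases
      case 3
      have "translation_osc L (- ((- t) *\<^sub>R axis i 1)) = translation_osc L ((- t) *\<^sub>R axis i 1)"
        by (rule osc_minus[OF per cont])
      with pos[of "-t" i] 3 t show ?thesis by simp
    qed (use pos t B0 osc_0[OF per cont] in auto)
  qed
  have "translation_osc L y = translation_osc L (\<Sum>i\<in>UNIV. y $ i *\<^sub>R axis i 1)"
    by (simp add: basis_expansion[of y, unfolded scalar_mult_eq_scaleR])
  also have "\<dots> \<le> (\<Sum>i\<in>UNIV. translation_osc L (y $ i *\<^sub>R axis i 1))"
    by (rule osc_sum[OF per cont]) simp
  also have "\<dots> \<le> (\<Sum>i\<in>(UNIV::'d set). B)" using ax y by (intro sum_mono) auto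
  finally show ?thesis by (simp add: B_def L_def r_def)
qed

text \<open>Modulo integers every \<open>y\<close> is \<open>j * \<omega>\<close> plus a vector with
  entries at most \<eta>. The orbit part costs at most \<open>2 * ln (2 * G)\<close> per step, the
  remainder is a small translation.\<close>

lemma log_iter_deviation:
  fixes A :: "real ^ 'd::finite \<Rightarrow> complex ^ 2 ^ 2"
  assumes A: "A \<in> gevrey_cocycles s R" and G: "\<And>a b. gevrey_norm s R (\<lambda>x. A x $ a $ b) \<le> G" "G \<ge> 1"
    and R: "R > 0" and s: "s \<ge> 1" and N: "N \<ge> 1"
    and \<eta>: "0 \<le> \<eta>" "\<eta> \<le> strip_width s R G N / 4"
    and dense: "\<And>y. \<exists>j<K. \<forall>i. \<bar>y$i - real j * \<omega>$i - of_int (round (y$i - real j * \<omega>$i))\<bar> \<le> \<eta>"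
  shows "integral (cbox 0 1) (\<lambda>x. \<bar>log_iter A \<omega> N x - integral (cbox 0 1) (log_iter A \<omega> N)\<bar>) \<le>
     2 * ln (2 * G) * real K + real CARD('d) * (42 * real N * (1 + ln (4 * G)) * sqrt (\<eta> / strip_width s R G N) + 2)"
proof -
  note bc = gevrey_bounded_cocycle[OF A G(1)]
  note pc = log_iter_periodic[OF bc, of \<omega> N] log_iter_continuous[OF bc, of \<omega> N]
  have lG: "ln (2 * G) \<ge> 0" using G by simp
  show ?thesis
  proof (rule deviation_le_osc[OF pc])
    fix y
    obtain j where j: "j < K" "\<And>i. \<bar>y$i - real j * \<omega>$i - of_int (round (y$i - real j * \<omega>$i))\<bar> \<le> \<eta>"
      using dense[of y] by blast
    define k where "k i = round (y$i - real j * \<omega>$i)" for i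
    define z where "z = (\<chi> i. y$i - real j * \<omega>$i - of_int (k i))"
    have y: "y = (z + real j *\<^sub>R \<omega>) + (\<chi> i. of_int (k i))" by (simp add: vec_eq_iff z_def)
    have "translation_osc (log_iter A \<omega> N) y = translation_osc (log_iter A \<omega> N) (real j *\<^sub>R \<omega> + z)"
      unfolding y by (subst osc_int[OF pc]) (simp add: add.commute)
    also have "\<dots> \<le> translation_osc (log_iter A \<omega> N) (real j *\<^sub>R \<omega>) + translation_osc (log_iter A \<omega> N) z"
      by (rule osc_add[OF pc])
    also have "translation_osc (log_iter A \<omega> N) (real j *\<^sub>R \<omega>) \<le> 2 * ln (2 * G) * real j"
      by (intro osc_le_sup[OF pc] log_iter_steps[OF bc])
    also have "\<dots> \<le> 2 * ln (2 * G) * real K" using j(1) lG by (intro mult_left_mono) auto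
    also have "translation_osc (log_iter A \<omega> N) z \<le>
       real CARD('d) * (42 * real N * (1 + ln (4 * G)) * sqrt (\<eta> / strip_width s R G N) + 2)"
      using j(2) by (intro gevrey_small_translation_osc[OF A G R s N \<eta>]) (simp add: z_def k_def)
    finally show "translation_osc (log_iter A \<omega> N) y \<le>
      2 * ln (2 * G) * real K + real CARD('d) * (42 * real N * (1 + ln (4 * G)) * sqrt (\<eta> / strip_width s R G N) + 2)"
      by simp
  qed
qed

text \<open>The scales are \<open>\<eta> \<approx> N\<^bsup>-\<tau>\<^esup>\<close> and \<open>K \<approx> N\<^bsup>1/2\<^esup>\<close>.\<close>

lemma log_iter_L1_deviation:
  fixes \<omega> :: "real ^ 'd::finite"
  assumes dio: "diophantine \<kappa> b \<omega>" and \<kappa>: "\<kappa> > 0" and b: "b > 0" and R: "R > 0" and G: "G \<ge> 1"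
    and s: "1 \<le> s" "s < 1 + 1 / (6 * real CARD('d)) / (1 + b)"
  shows "\<exists>C \<sigma>. 0 < C \<and> 0 < \<sigma> \<and> \<sigma> \<le> 1/2 \<and> (\<forall>A \<in> gevrey_cocycles s R. (\<forall>a b. gevrey_norm s R (\<lambda>x. A x $ a $ b) \<le> G) \<longrightarrow>
     (\<forall>N\<ge>1. integral (cbox 0 1) (\<lambda>x. \<bar>log_iter A \<omega> N x - integral (cbox 0 1) (log_iter A \<omega> N)\<bar>) \<le> C * real N powr (1 - \<sigma>)))"
proof -
  define d where "d = real CARD('d)"
  have d: "d \<ge> 1" by (simp add: d_def Suc_le_eq)
  \<comment> \<open>Chosen so that \<open>3 * (b + d) * \<tau> \<le> 1/2\<close>, which keeps the
    orbit length of order \<open>N powr (1/2)\<close>; the hypothesis on \<open>s\<close> says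
    exactly that \<open>s - 1 < \<tau>\<close>.\<close>
  define \<tau> where "\<tau> = 1 / (6 * d) / (1 + b)"
  have \<tau>: "0 < \<tau>" "s - 1 < \<tau>" using s b d by (auto simp: \<tau>_def d_def)
  have \<tau>h: "3 * (b + d) * \<tau> \<le> 1/2"
  proof -
    have "b + d \<le> d * (1 + b)" using b d mult_right_mono[of 1 d b] by (simp add: algebra_simps)
    then have "3 * (b + d) * \<tau> \<le> 3 * (d * (1 + b)) * \<tau>" using \<tau>(1) by (intro mult_right_mono) auto
    also have "\<dots> = 1/2"
    proof -
      have "d * (1 + b) \<noteq> 0" using b d by simp
      moreover have "\<tau> = 1 / (6 * (d * (1 + b)))" by (simp add: \<tau>_def)
      ultimately show ?thesis by simp
    qed
    finally show ?thesis .
  qed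
  obtain C0 where C0: "C0 > 0" "\<And>\<eta> y K. 0 < \<eta> \<Longrightarrow> \<eta> \<le> 1 \<Longrightarrow> C0 * \<eta> powr (- 3 * (b + d)) \<le> real K \<Longrightarrow>
     (\<exists>j<K. \<forall>i. \<bar>y$i - real j * \<omega>$i - of_int (round (y$i - real j * \<omega>$i))\<bar> \<le> \<eta>)"
    using quantitative_kronecker[OF dio \<kappa> b] unfolding d_def by blast
  define r1 where "r1 = 1 / (32 * R * G * 2 powr (s - 1))"
  have r1: "r1 > 0" using R G by (simp add: r1_def)
  have width: "r1 * real N powr (- (s - 1)) \<le> strip_width s R G N" if N: "N \<ge> 1" for N
  proof -
    have "real (N + 1) powr (s - 1) \<le> (2 * real N) powr (s - 1)" using N s by (intro powr_mono2) auto
    also have "\<dots> = 2 powr (s - 1) * real N powr (s - 1)" by (rule powr_mult)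
    finally have "32 * R * G * real (N + 1) powr (s - 1) \<le> 32 * R * G * (2 powr (s - 1) * real N powr (s - 1))"
      using R G by (intro mult_left_mono) auto
    then have "1 / (32 * R * G * (2 powr (s - 1) * real N powr (s - 1))) \<le> strip_width s R G N"
      unfolding strip_width_def using R G N by (intro divide_left_mono) auto
    moreover have "r1 * real N powr (- (s - 1)) = 1 / (32 * R * G * (2 powr (s - 1) * real N powr (s - 1)))"
      by (simp add: r1_def powr_minus_divide[of _ "s - 1"] del: minus_diff_eq)
    ultimately show ?thesis by simp
  qed
  \<comment> \<open>Keeps \<eta> below 1 for the Kronecker estimate and below a quarter of the strip
    width.\<close>
  define c1 where "c1 = min 1 (r1 / 4)"
  have c1: "0 < c1" "c1 \<le> 1" "c1 \<le> r1 / 4" using r1 by (auto simp: c1_def)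
  \<comment> \<open>The second entry is the decay exponent of \<open>sqrt (\<eta> / r)\<close>, as
    \<open>\<eta> / r\<close> is of order \<open>N powr (- (\<tau> - (s - 1)))\<close>; the first
    entry is what the orbit length allows.\<close>
  define \<sigma> where "\<sigma> = min (1/2) ((\<tau> - (s - 1)) / 2)"
  have \<sigma>: "0 < \<sigma>" "\<sigma> \<le> 1/2" "\<sigma> \<le> (\<tau> - (s - 1)) / 2"
    unfolding \<sigma>_def using \<tau> by (simp_all only: min.cobounded1 min.cobounded2) simp
  define C2 where "C2 = C0 * c1 powr (- 3 * (b + d)) + 1"
  have C2: "C2 > 0" using C0 c1 by (auto simp: C2_def intro: add_pos_pos)
  define C where "C = 2 * ln (2 * G) * C2 + d * (42 * (1 + ln (4 * G)) + 2)"
  have lG: "ln (2 * G) \<ge> 0" "ln (4 * G) \<ge> 0" using G by auto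
  have C: "C > 0"
  proof -
    have "0 \<le> 2 * ln (2 * G) * C2" using lG C2 by simp
    moreover have "0 < d * (42 * (1 + ln (4 * G)) + 2)" using lG d by (intro mult_pos_pos add_nonneg_pos mult_nonneg_nonneg) auto
    ultimately show ?thesis unfolding C_def by linarith
  qed
  have "integral (cbox 0 1) (\<lambda>x. \<bar>log_iter A \<omega> N x - integral (cbox 0 1) (log_iter A \<omega> N)\<bar>) \<le> C * real N powr (1 - \<sigma>)"
    if A: "A \<in> gevrey_cocycles s R" "\<And>a b. gevrey_norm s R (\<lambda>x. A x $ a $ b) \<le> G" and N: "N \<ge> 1" for A N
  proof -
    define n where "n = real N"
    have n: "n \<ge> 1" using N by (simp add: n_def)
    define r where "r = strip_width s R G N"
    have r: "r1 * n powr (- (s - 1)) \<le> r" using width[OF N] by (simp add: r_def n_def)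
    have r0: "r > 0" using r1 n by (intro less_le_trans[OF _ r]) auto
    define \<eta> where "\<eta> = c1 * n powr (- \<tau>)"
    have \<eta>0: "\<eta> > 0" using c1 n by (simp add: \<eta>_def)
    have \<eta>1: "\<eta> \<le> 1"
    proof -
      have "n powr (- \<tau>) \<le> n powr 0" using n \<tau> by (intro powr_mono) auto
      also have "\<dots> = 1" using n by simp
      finally show ?thesis unfolding \<eta>_def using c1 by (intro mult_le_one) auto
    qed
    have "n powr (- \<tau>) \<le> n powr (- (s - 1))" using n \<tau> by (intro powr_mono) auto
    then have "\<eta> \<le> (r1 / 4) * n powr (- (s - 1))"
      unfolding \<eta>_def using c1 by (intro mult_mono) auto
    then have \<eta>r: "\<eta> \<le> r / 4" using r by simp
    define K where "K = nat \<lceil>C0 * \<eta> powr (- 3 * (b + d))\<rceil>"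
    have K1: "C0 * \<eta> powr (- 3 * (b + d)) \<le> real K" unfolding K_def by (rule real_nat_ceiling_ge)
    have "real K \<le> C0 * \<eta> powr (- 3 * (b + d)) + 1"
    proof -
      have "0 \<le> C0 * \<eta> powr (- 3 * (b + d))" using C0 by simp
      then show ?thesis unfolding K_def by linarith
    qed
    also have "\<eta> powr (- 3 * (b + d)) = c1 powr (- 3 * (b + d)) * n powr (3 * (b + d) * \<tau>)"
      unfolding \<eta>_def powr_mult powr_powr by (simp add: algebra_simps)
    also have "C0 * (c1 powr (- 3 * (b + d)) * n powr (3 * (b + d) * \<tau>)) + 1 \<le> C2 * n powr (1 - \<sigma>)"
    proof -
      have 1: "n powr (3 * (b + d) * \<tau>) \<le> n powr (1 - \<sigma>)" using n \<tau>h \<sigma> by (intro powr_mono) auto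
      have 2: "1 \<le> n powr (1 - \<sigma>)" using n \<sigma> by (intro ge_one_powr_ge_zero) auto
      have "C0 * c1 powr (- 3 * (b + d)) * n powr (3 * (b + d) * \<tau>) \<le> C0 * c1 powr (- 3 * (b + d)) * n powr (1 - \<sigma>)"
        using C0 by (intro mult_left_mono 1) auto
      with 2 show ?thesis by (simp add: C2_def algebra_simps)
    qed
    finally have K2: "real K \<le> C2 * n powr (1 - \<sigma>)" .
    have sq: "n * sqrt (\<eta> / r) \<le> n powr (1 - \<sigma>)"
    proof -
      have "\<eta> / r \<le> (c1 * n powr (- \<tau>)) / (r1 * n powr (- (s - 1)))"
        unfolding \<eta>_def using r c1 r1 n r0 by (intro divide_left_mono) auto
      also have "\<dots> = (c1 / r1) * n powr (- (\<tau> - (s - 1)))"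
      proof -
        have "n powr (- \<tau>) / n powr (- (s - 1)) = n powr (- (\<tau> - (s - 1)))"
          by (subst powr_diff[symmetric]) (simp add: algebra_simps)
        then show ?thesis by (simp only: times_divide_times_eq[symmetric])
      qed
      also have "\<dots> \<le> 1 * n powr (- 2 * \<sigma>)"
        using c1 r1 \<sigma> n by (intro mult_mono powr_mono) auto
      finally have "sqrt (\<eta> / r) \<le> sqrt (n powr (- 2 * \<sigma>))" by simp
      also have "\<dots> = n powr (- \<sigma>)" using n by (simp add: powr_half_sqrt[symmetric] powr_powr)
      finally have "n * sqrt (\<eta> / r) \<le> n powr 1 * n powr (- \<sigma>)"
        using n \<eta>0 r0 by (intro mult_mono) auto
      then show ?thesis by (simp only: powr_add[symmetric] add_uminus_conv_diff)
    qed
    have one: "1 \<le> n powr (1 - \<sigma>)" using n \<sigma> by (intro ge_one_powr_ge_zero) auto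
    have "integral (cbox 0 1) (\<lambda>x. \<bar>log_iter A \<omega> N x - integral (cbox 0 1) (log_iter A \<omega> N)\<bar>) \<le>
       2 * ln (2 * G) * real K + d * (42 * n * (1 + ln (4 * G)) * sqrt (\<eta> / r) + 2)"
      unfolding d_def r_def n_def
      by (rule log_iter_deviation[OF A G R s(1) N less_imp_le[OF \<eta>0] \<eta>r[unfolded r_def] C0(2)[OF \<eta>0 \<eta>1 K1]])
    also have "\<dots> = 2 * ln (2 * G) * real K + d * (42 * (1 + ln (4 * G)) * (n * sqrt (\<eta> / r)) + 2 * 1)"
      by simp
    also have "\<dots> \<le> 2 * ln (2 * G) * (C2 * n powr (1 - \<sigma>)) + d * (42 * (1 + ln (4 * G)) * n powr (1 - \<sigma>) + 2 * n powr (1 - \<sigma>))"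
      using K2 sq one lG d by (intro add_mono mult_left_mono) auto
    also have "\<dots> = C * n powr (1 - \<sigma>)" by (simp add: C_def algebra_simps)
    finally show ?thesis by (simp add: n_def)
  qed
  then show ?thesis using C \<sigma> by blast
qed

subsection \<open>The avalanche principle for cocycles\<close>

context
  fixes M :: real and A :: "real ^ 'd::finite \<Rightarrow> complex ^ 2 ^ 2"
  assumes A: "bounded_cocycle M A"
begin

lemma log_iter_integrable: "log_iter A \<omega> N integrable_on cbox 0 1"
  by (intro integrable_continuous continuous_on_subset[OF log_iter_continuous[OF A]]) simp

lemma log_iter_shift: "integral (cbox 0 1) (\<lambda>x. log_iter A \<omega> N (x + y)) = integral (cbox 0 1) (log_iter A \<omega> N)"
  by (rule torus_integral_shift[OF log_iter_periodic[OF A] log_iter_continuous[OF A]])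

lemma log_iter_comp_continuous:
  "continuous_on S f \<Longrightarrow> continuous_on S (\<lambda>x. log_iter A \<omega> N (f x))"
  by (rule continuous_on_compose2[OF log_iter_continuous[OF A]]) auto

lemma integral_log_iter_bounds:
  "0 \<le> integral (cbox 0 1) (log_iter A \<omega> N)" 
  "N \<ge> 1 \<Longrightarrow> integral (cbox 0 1) (log_iter A \<omega> N) \<le> real N * ln M"
proof -
  show "0 \<le> integral (cbox 0 1) (log_iter A \<omega> N)"
    using log_iter_nonneg[OF A] by (intro integral_nonneg log_iter_integrable) auto
  assume "N \<ge> 1"
  then have "integral (cbox 0 1) (log_iter A \<omega> N) \<le> integral (cbox 0 1) (\<lambda>x::real^'d. real N * ln M)"
    using log_iter_le[OF A] by (intro integral_le log_iter_integrable) auto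
  then show "integral (cbox 0 1) (log_iter A \<omega> N) \<le> real N * ln M" by simp
qed

lemma integral_log_iter_add:
  "integral (cbox 0 1) (log_iter A \<omega> (N + K)) \<le> integral (cbox 0 1) (log_iter A \<omega> N) + integral (cbox 0 1) (log_iter A \<omega> K)"
proof -
  have "integral (cbox 0 1) (log_iter A \<omega> (N + K)) \<le>
      integral (cbox 0 1) (\<lambda>x. log_iter A \<omega> K (x + real N *\<^sub>R \<omega>) + log_iter A \<omega> N x)"
    using log_iter_add_le[OF A]
    by (intro integral_le log_iter_integrable integrable_continuous continuous_intros log_iter_comp_continuous) auto
  also have "\<dots> = integral (cbox 0 1) (\<lambda>x. log_iter A \<omega> K (x + real N *\<^sub>R \<omega>)) + integral (cbox 0 1) (log_iter A \<omega> N)"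
    by (intro integral_add log_iter_integrable integrable_continuous continuous_intros log_iter_comp_continuous)
  finally show ?thesis by (simp add: log_iter_shift)
qed

lemma iterate_block:
  "cocycle_iterate A \<omega> (Suc j * N) x = cocycle_iterate A \<omega> N (x + real (j * N) *\<^sub>R \<omega>) ** cocycle_iterate A \<omega> (j * N) x"
  using iterate_add[of A \<omega> "j * N" N x] by (simp add: add.commute)

text \<open>At a point where all blocks are close to their means, the means alone guarantee the
  hypotheses of the avalanche principle: \<open>I1\<close> makes every block large, and
  \<open>2 * I1 - I2\<close> limits the cancellation between neighbours.\<close>

lemma log_iter_avalanche:
  assumes N: "N \<ge> 1" and n: "n \<ge> 2" and g: "g > 0" "g * real N \<ge> 4"
    and I: "I1 \<ge> g * real N" "2 * I1 - I2 \<le> g / 4 * real N"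
    and good: "\<And>j. j < n \<Longrightarrow> \<bar>log_iter A \<omega> N (x + real (j * N) *\<^sub>R \<omega>) - I1\<bar> \<le> g / 16 * real N"
      "\<And>j. j < n \<Longrightarrow> \<bar>log_iter A \<omega> (2 * N) (x + real (j * N) *\<^sub>R \<omega>) - I2\<bar> \<le> g / 16 * real N"
  shows "\<bar>log_iter A \<omega> (n * N) x + (\<Sum>j=1..<n-1. log_iter A \<omega> N (x + real (j * N) *\<^sub>R \<omega>))
     - (\<Sum>j<n-1. log_iter A \<omega> (2 * N) (x + real (j * N) *\<^sub>R \<omega>))\<bar> \<le> real n"
proof -
  define B where "B j = cocycle_iterate A \<omega> N (x + real (j * N) *\<^sub>R \<omega>)" for j
  define P where "P j = cocycle_iterate A \<omega> (j * N) x" for j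
  \<comment> \<open>The loss in a product of neighbours is at most \<open>g/4 + 3 * g/16\<close> per
    unit of \<open>N\<close>, which is below \<open>g/2\<close>. After it a block still has
    logarithm at least \<open>7/16 * g * N\<close>, which exceeds \<open>ln 2\<close> because
    \<open>g * N \<ge> 4\<close>.\<close>
  define k where "k = exp (- (g / 2 * real N))"
  have lB: "ln (norm (B j)) = log_iter A \<omega> N (x + real (j * N) *\<^sub>R \<omega>)" for j by (simp add: B_def log_iter_def)
  have BB: "B (Suc j) ** B j = cocycle_iterate A \<omega> (2 * N) (x + real (j * N) *\<^sub>R \<omega>)" for j
  proof -
    have "x + real (Suc j * N) *\<^sub>R \<omega> = x + real (j * N) *\<^sub>R \<omega> + real N *\<^sub>R \<omega>" by (simp add: algebra_simps)
    then show ?thesis using iterate_add[of A \<omega> N N "x + real (j * N) *\<^sub>R \<omega>"] by (simp only: B_def mult_2)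
  qed
  have lBB: "ln (norm (B (Suc j) ** B j)) = log_iter A \<omega> (2 * N) (x + real (j * N) *\<^sub>R \<omega>)" for j
    by (simp add: BB log_iter_def)
  have pos: "norm (B j) > 0" "norm (B (Suc j) ** B j) > 0" for j
    unfolding BB unfolding B_def using cocycle_facts(4)[OF A] by (meson less_le_trans zero_less_one)+
  have ln2: "ln 2 \<le> (1::real)" using ln_le_minus_one[of 2] by simp
  have "\<bar>ln (norm (P n)) + (\<Sum>j=1..<n-1. ln (norm (B j))) - (\<Sum>j<n-1. ln (norm (B (Suc j) ** B j)))\<bar> \<le> n * ln 2"
  proof (rule avalanche_principle)
    show "P 0 = mat 1" by (simp add: P_def)
    show "P (Suc j) = B j ** P j" for j unfolding P_def B_def by (rule iterate_block)
    show "det (B j) = 1" for j unfolding B_def by (rule det_iterate) (rule cocycle_facts(1)[OF A])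
    show "0 < k" "k \<le> 1" using g by (auto simp: k_def)
    show "k * (norm (B (Suc j)) * norm (B j)) \<le> norm (B (Suc j) ** B j)" if j: "Suc j < n" for j
    proof -
      have "- (g / 2 * real N) + (ln (norm (B (Suc j))) + ln (norm (B j))) \<le> ln (norm (B (Suc j) ** B j))"
        using good(1)[of j] good(1)[of "Suc j"] good(2)[of j] j I(2) g(2) unfolding lB lBB abs_le_iff by (simp add: field_simps)
      then have "exp (- (g / 2 * real N) + (ln (norm (B (Suc j))) + ln (norm (B j)))) \<le> exp (ln (norm (B (Suc j) ** B j)))"
        by (simp only: exp_le_cancel_iff)
      then show ?thesis using pos unfolding k_def exp_add by simp
    qed
    show "2 \<le> k * norm (B j)" if j: "j < n" for j
    proof -
      have "ln 2 \<le> - (g / 2 * real N) + ln (norm (B j))"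
        using good(1)[OF j] I(1) g(2) ln2 unfolding lB abs_le_iff by (simp add: field_simps)
      then have "exp (ln 2) \<le> exp (- (g / 2 * real N) + ln (norm (B j)))" by (simp only: exp_le_cancel_iff)
      then show ?thesis using pos[of j] unfolding k_def exp_add by simp
    qed
  qed (rule n)
  also have "real n * ln 2 \<le> real n * 1" using ln2 by (intro mult_left_mono) auto
  finally show ?thesis unfolding lB lBB by (simp add: P_def log_iter_def)
qed

text \<open>At a bad point some deviation is at least \<open>g * N / 16\<close>, so the last term is
  at least \<open>2 * n * N * ln M\<close>, the trivial bound for the left-hand side. This is the
  origin of 32, and it makes the estimate integrable over the whole torus.\<close>

lemma log_iter_avalanche_pointwise:
  assumes N: "N \<ge> 1" and n: "n \<ge> 2" and g: "g > 0" "g * real N \<ge> 4"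
    and I: "I1 \<ge> g * real N" "2 * I1 - I2 \<le> g / 4 * real N"
  shows "\<bar>log_iter A \<omega> (n * N) x + (\<Sum>j=1..<n-1. log_iter A \<omega> N (x + real (j * N) *\<^sub>R \<omega>))
     - (\<Sum>j<n-1. log_iter A \<omega> (2 * N) (x + real (j * N) *\<^sub>R \<omega>))\<bar> \<le> real n +
     32 * real n * ln M / g * (\<Sum>j<n. \<bar>log_iter A \<omega> N (x + real (j * N) *\<^sub>R \<omega>) - I1\<bar> + \<bar>log_iter A \<omega> (2 * N) (x + real (j * N) *\<^sub>R \<omega>) - I2\<bar>)"
    (is "\<bar>?T + ?U - ?V\<bar> \<le> real n + 32 * real n * ln M / g * ?S")
proof -
  have lM: "ln M \<ge> 0" using bounded_cocycle_ge_1[OF A] by simp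
  have S0: "?S \<ge> 0" by (intro sum_nonneg) auto
  show ?thesis
  proof (cases "\<forall>j<n. \<bar>log_iter A \<omega> N (x + real (j * N) *\<^sub>R \<omega>) - I1\<bar> \<le> g / 16 * real N \<and>
      \<bar>log_iter A \<omega> (2 * N) (x + real (j * N) *\<^sub>R \<omega>) - I2\<bar> \<le> g / 16 * real N")
    case True
    then have "\<bar>?T + ?U - ?V\<bar> \<le> real n" by (intro log_iter_avalanche[OF N n g I]) auto
    moreover have "0 \<le> 32 * real n * ln M / g * ?S" using lM S0 g by simp
    ultimately show ?thesis by linarith
  next
    case False
    then obtain j where j: "j < n" "g / 16 * real N \<le> \<bar>log_iter A \<omega> N (x + real (j * N) *\<^sub>R \<omega>) - I1\<bar> + \<bar>log_iter A \<omega> (2 * N) (x + real (j * N) *\<^sub>R \<omega>) - I2\<bar>"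
      by (auto simp: not_le) (smt (verit))+
    have "\<bar>log_iter A \<omega> N (x + real (j * N) *\<^sub>R \<omega>) - I1\<bar> + \<bar>log_iter A \<omega> (2 * N) (x + real (j * N) *\<^sub>R \<omega>) - I2\<bar> \<le> ?S"
      using j(1) by (intro member_le_sum) auto
    with j have "g / 16 * real N \<le> ?S" by linarith
    then have "32 * real n * ln M / g * (g / 16 * real N) \<le> 32 * real n * ln M / g * ?S"
      using lM g by (intro mult_left_mono) auto
    moreover have "32 * real n * ln M / g * (g / 16 * real N) = 2 * real n * real N * ln M" using g by simp
    ultimately have 1: "2 * real n * real N * ln M \<le> 32 * real n * ln M / g * ?S" by simp
    have T: "0 \<le> ?T" "?T \<le> real n * real N * ln M"
      using log_iter_nonneg[OF A] log_iter_le[OF A, of "n * N"] N n by auto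
    have "?U \<le> (\<Sum>j=1..<n-1. real N * ln M)" by (intro sum_mono log_iter_le[OF A N])
    also have "\<dots> = real (n - 2) * (real N * ln M)" by (simp add: numeral_2_eq_2)
    also have "\<dots> \<le> real n * (real N * ln M)" using lM by (intro mult_right_mono) auto
    finally have U: "0 \<le> ?U" "?U \<le> real n * real N * ln M" using log_iter_nonneg[OF A] by (auto intro: sum_nonneg)
    have "?V \<le> (\<Sum>j<n-1. real (2 * N) * ln M)" using N by (intro sum_mono log_iter_le[OF A]) auto
    also have "\<dots> = real (n - 1) * (real (2 * N) * ln M)" by simp
    also have "\<dots> \<le> real n * (real (2 * N) * ln M)" using lM by (intro mult_right_mono) auto
    finally have V: "0 \<le> ?V" "?V \<le> 2 * real n * real N * ln M" using log_iter_nonneg[OF A] by (auto intro: sum_nonneg)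
    have "\<bar>?T + ?U - ?V\<bar> \<le> 2 * real n * real N * ln M" using T U V by linarith
    with 1 show ?thesis by linarith
  qed
qed

text \<open>Integrate the pointwise avalanche estimate; all shifted blocks have the same integral.
  Divided by \<open>n * N\<close>, the errors are of orders \<open>1 / N\<close>,
  \<open>1 / n\<close> and \<open>n * N powr (- \<sigma>)\<close>, and \<open>n\<close> of order
  \<open>N powr (\<sigma>/2)\<close> balances the last two.\<close>

lemma scale_step:
  assumes dev: "\<And>N. N \<ge> 1 \<Longrightarrow> integral (cbox 0 1) (\<lambda>x. \<bar>log_iter A \<omega> N x - integral (cbox 0 1) (log_iter A \<omega> N)\<bar>) \<le> C * real N powr (1 - \<sigma>)"
    and C: "C > 0" and \<sigma>: "0 < \<sigma>" "\<sigma> \<le> 1/2" and g: "g > 0" "g * real N \<ge> 4" and N: "N \<ge> 1" and n: "n \<ge> 2"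
    and nN: "real N powr (\<sigma>/2) \<le> real n" "real n \<le> 8 * real N powr (\<sigma>/2)"
  defines "l \<equiv> \<lambda>N. integral (cbox 0 1) (log_iter A \<omega> N) / real N"
  assumes l: "l N \<ge> g" "l N - l (2 * N) \<le> g / 8"
  shows "\<bar>l (n * N) + l N - 2 * l (2 * N)\<bar> \<le> (1 + 2 * ln M + 768 * C * ln M / g) * real N powr (- (\<sigma>/2))"
proof -
  define I where "I N = integral (cbox 0 1) (log_iter A \<omega> N)" for N
  have Il: "I K = real K * l K" if "K \<ge> 1" for K using that by (simp add: I_def l_def)
  have lM: "ln M \<ge> 0" using bounded_cocycle_ge_1[OF A] by simp
  have lb: "0 \<le> l K" "l K \<le> ln M" if "K \<ge> 1" for K
    using integral_log_iter_bounds(1)[of \<omega> K] integral_log_iter_bounds(2)[of K \<omega>] that by (auto simp: l_def pos_divide_le_eq mult.commute)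
  define d1 where "d1 x = \<bar>log_iter A \<omega> N x - I N\<bar>" for x
  define d2 where "d2 x = \<bar>log_iter A \<omega> (2 * N) x - I (2 * N)\<bar>" for x
  define y where "y j = real (j * N) *\<^sub>R \<omega>" for j
  note pc = log_iter_periodic[OF A] log_iter_continuous[OF A]
  have per: "torus_periodic d1" "torus_periodic d2"
    using pc(1)[of \<omega>] unfolding torus_periodic_def d1_def d2_def by simp_all
  have cont: "continuous_on UNIV d1" "continuous_on UNIV d2"
    unfolding d1_def d2_def by (intro continuous_intros log_iter_comp_continuous)+
  note cc = log_iter_comp_continuous continuous_on_compose2[OF cont(1)] continuous_on_compose2[OF cont(2)]
  define F where "F x = log_iter A \<omega> (n * N) x + (\<Sum>j=1..<n-1. log_iter A \<omega> N (x + y j)) - (\<Sum>j<n-1. log_iter A \<omega> (2 * N) (x + y j))" for x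
  define c where "c = 32 * real n * ln M / g"
  have c0: "c \<ge> 0" using lM g by (simp add: c_def)
  have cF: "continuous_on UNIV F" unfolding F_def by (auto intro!: continuous_intros cc)
  have IF: "integral (cbox 0 1) F = I (n * N) + real (n - 2) * I N - real (n - 1) * I (2 * N)"
  proof -
    have "integral (cbox 0 1) F = integral (cbox 0 1) (\<lambda>x. log_iter A \<omega> (n * N) x + (\<Sum>j=1..<n-1. log_iter A \<omega> N (x + y j)))
        - integral (cbox 0 1) (\<lambda>x. \<Sum>j<n-1. log_iter A \<omega> (2 * N) (x + y j))"
      unfolding F_def by (auto intro!: integral_diff integrable_continuous continuous_intros cc)
    also have "integral (cbox 0 1) (\<lambda>x. log_iter A \<omega> (n * N) x + (\<Sum>j=1..<n-1. log_iter A \<omega> N (x + y j))) =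
        integral (cbox 0 1) (log_iter A \<omega> (n * N)) + integral (cbox 0 1) (\<lambda>x. \<Sum>j=1..<n-1. log_iter A \<omega> N (x + y j))"
      by (auto intro!: integral_add integrable_continuous continuous_intros cc)
    finally show ?thesis by (simp add: integral_sum_shifts[OF pc] I_def numeral_2_eq_2)
  qed
  have "\<bar>integral (cbox 0 1) F\<bar> \<le> integral (cbox 0 1) (\<lambda>x. real n + c * (\<Sum>j<n. d1 (x + y j) + d2 (x + y j)))"
  proof (rule integral_norm_bound_integral[where f = F, unfolded real_norm_def])
    show "F integrable_on cbox 0 1" by (intro integrable_continuous continuous_on_subset[OF cF]) auto
    show "(\<lambda>x. real n + c * (\<Sum>j<n. d1 (x + y j) + d2 (x + y j))) integrable_on cbox 0 1"
      by (auto intro!: integrable_continuous continuous_intros cc)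
    show "\<bar>F x\<bar> \<le> real n + c * (\<Sum>j<n. d1 (x + y j) + d2 (x + y j))" for x
      unfolding F_def c_def d1_def d2_def y_def
    proof (rule log_iter_avalanche_pointwise[OF N n g])
      show "g * real N \<le> I N" using l(1) N by (simp add: Il mult.commute mult_left_mono)
      have "2 * I N - I (2 * N) = real N * (2 * (l N - l (2 * N)))" using N by (simp add: Il algebra_simps)
      also have "\<dots> \<le> real N * (2 * (g / 8))" using l(2) by (intro mult_left_mono) auto
      finally show "2 * I N - I (2 * N) \<le> g / 4 * real N" by (simp add: mult.commute)
    qed
  qed
  also have "\<dots> = real n + c * integral (cbox 0 1) (\<lambda>x. \<Sum>j<n. d1 (x + y j) + d2 (x + y j))"
    by (subst integral_add) (auto intro!: integrable_continuous continuous_intros cc)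
  also have "integral (cbox 0 1) (\<lambda>x. \<Sum>j<n. d1 (x + y j) + d2 (x + y j)) = 
      real n * (integral (cbox 0 1) d1 + integral (cbox 0 1) d2)"
  proof -
    have "integral (cbox 0 1) (\<lambda>x. \<Sum>j<n. d1 (x + y j) + d2 (x + y j)) =
      integral (cbox 0 1) (\<lambda>x. (\<Sum>j<n. d1 (x + y j)) + (\<Sum>j<n. d2 (x + y j)))" by (simp add: sum.distrib)
    also have "\<dots> = integral (cbox 0 1) (\<lambda>x. \<Sum>j<n. d1 (x + y j)) + integral (cbox 0 1) (\<lambda>x. \<Sum>j<n. d2 (x + y j))"
      by (auto intro!: integral_add integrable_continuous continuous_intros cc)
    finally show ?thesis
      by (simp add: integral_sum_shifts[OF per(1) cont(1)] integral_sum_shifts[OF per(2) cont(2)] distrib_left)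
  qed
  also have "real n + c * (real n * (integral (cbox 0 1) d1 + integral (cbox 0 1) d2)) \<le>
      real n + c * (real n * (3 * C * real N powr (1 - \<sigma>)))"
  proof -
    have "integral (cbox 0 1) d1 \<le> C * real N powr (1 - \<sigma>)"
      using dev[OF N] unfolding d1_def I_def .
    moreover have "integral (cbox 0 1) d2 \<le> C * real (2 * N) powr (1 - \<sigma>)"
      using dev[of "2 * N"] N unfolding d2_def I_def by simp
    moreover have "C * real (2 * N) powr (1 - \<sigma>) \<le> 2 * C * real N powr (1 - \<sigma>)"
    proof -
      have "real (2 * N) powr (1 - \<sigma>) = 2 powr (1 - \<sigma>) * real N powr (1 - \<sigma>)" by (simp add: powr_mult)
      also have "\<dots> \<le> 2 powr 1 * real N powr (1 - \<sigma>)" using \<sigma> by (intro mult_right_mono powr_mono) auto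
      finally show ?thesis using C by (simp add: mult.assoc mult.left_commute)
    qed
    ultimately have "integral (cbox 0 1) d1 + integral (cbox 0 1) d2 \<le> 3 * C * real N powr (1 - \<sigma>)" by linarith
    then show ?thesis using c0 by (intro add_left_mono mult_left_mono) auto
  qed
  finally have main: "\<bar>I (n * N) + real (n - 2) * I N - real (n - 1) * I (2 * N)\<bar> \<le> real n + c * (real n * (3 * C * real N powr (1 - \<sigma>)))"
    unfolding IF .
  define t where "t = real N powr (- (\<sigma>/2))"
  have N0: "real N > 0" and n0: "real n > 0" using N n by auto
  have tn: "1 \<le> real n * t"
  proof -
    have "1 = real N powr (\<sigma>/2) * t" using N0 by (simp add: t_def powr_add[symmetric])
    also have "\<dots> \<le> real n * t" using nN by (intro mult_right_mono) (auto simp: t_def)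
    finally show ?thesis .
  qed
  have tN: "1 \<le> real N * t"
  proof -
    have "1 \<le> real N powr (1 - \<sigma>/2)" using N \<sigma> by (intro ge_one_powr_ge_zero) auto
    also have "\<dots> = real N powr 1 * t" unfolding t_def by (simp only: powr_add[symmetric] add_uminus_conv_diff)
    finally show ?thesis by simp
  qed
  have nt: "real n * real N powr (1 - \<sigma>) \<le> 8 * real N * t"
  proof -
    have "real n * real N powr (1 - \<sigma>) \<le> (8 * real N powr (\<sigma>/2)) * real N powr (1 - \<sigma>)" using nN by (intro mult_right_mono) auto
    also have "\<dots> = 8 * real N powr (\<sigma>/2 + (1 - \<sigma>))" by (simp only: powr_add mult.assoc)
    also have "\<sigma>/2 + (1 - \<sigma>) = 1 + (- (\<sigma>/2))" by simp
    also have "8 * real N powr (1 + (- (\<sigma>/2))) = 8 * real N * t" unfolding powr_add t_def using N0 by simp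
    finally show ?thesis .
  qed
  \<comment> \<open>The sums have \<open>n - 2\<close> and \<open>n - 1\<close> terms where
    \<open>n\<close> would be convenient; the correction is the last term, at most
    \<open>2 * N * ln M\<close>.\<close>
  have X: "I (n * N) + real (n - 2) * I N - real (n - 1) * I (2 * N) =
     real n * real N * (l (n * N) + l N - 2 * l (2 * N)) - 2 * real N * (l N - l (2 * N))"
    using N n by (simp add: Il of_nat_diff algebra_simps)
  have "\<bar>l N - l (2 * N)\<bar> \<le> ln M" using lb[of N] lb[of "2 * N"] N by (simp add: abs_le_iff)
  then have "\<bar>2 * real N * (l N - l (2 * N))\<bar> \<le> 2 * real N * ln M" using N0 by (simp add: abs_mult)
  with main have "\<bar>real n * real N * (l (n * N) + l N - 2 * l (2 * N))\<bar> \<le>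
      real n + c * (real n * (3 * C * real N powr (1 - \<sigma>))) + 2 * real N * ln M"
    unfolding X by linarith
  also have "\<dots> = real n * 1 + 96 * C * ln M / g * real n * (real n * real N powr (1 - \<sigma>)) + 2 * real N * ln M * 1"
    by (simp add: c_def)
  also have "\<dots> \<le> real n * (real N * t) + 96 * C * ln M / g * real n * (8 * real N * t) + 2 * real N * ln M * (real n * t)"
    using tn tN nt lM C g by (intro add_mono mult_left_mono) auto
  also have "\<dots> = real n * real N * ((1 + 2 * ln M + 768 * C * ln M / g) * t)" by (simp add: algebra_simps)
  finally have "real n * real N * \<bar>l (n * N) + l N - 2 * l (2 * N)\<bar> \<le> real n * real N * ((1 + 2 * ln M + 768 * C * ln M / g) * t)"
    using N0 n0 by (simp add: abs_mult)
  then have "\<bar>l (n * N) + l N - 2 * l (2 * N)\<bar> \<le> (1 + 2 * ln M + 768 * C * ln M / g) * t"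
    using N0 n0 by simp
  then show ?thesis by (simp add: t_def)
qed

end

subsection \<open>Continuity of the Lyapunov exponent\<close>

text \<open>The matrix with first column \<open>v\<close> reduces the first bound to
  submultiplicativity of the Frobenius norm. For the second, each of the four entries is at most the
  operator norm.\<close>

lemma onorm_matrix_bounds:
  fixes X :: "complex^2^2"
  shows "onorm ((*v) X) \<le> norm X" "norm X \<le> 2 * onorm ((*v) X)"
proof -
  have bl: "bounded_linear ((*v) X)" by simp
  show "onorm ((*v) X) \<le> norm X"
  proof (rule onorm_le)
    fix v :: "complex^2"
    define V :: "complex^2^2" where "V = (\<chi> i j. if j = 1 then v$i else 0)"
    have V: "V$1$1 = v$1" "V$2$1 = v$2" "V$1$2 = 0" "V$2$2 = 0" by (simp_all add: V_def)
    have "(norm V)\<^sup>2 = (norm v)\<^sup>2" by (simp add: norm_mat2 norm_vec2 V)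
    then have 1: "norm V = norm v" by (simp add: power2_eq_iff_nonneg)
    have "(norm (X ** V))\<^sup>2 = (norm (X *v v))\<^sup>2"
      by (simp add: norm_mat2 norm_vec2 mat2_mult V matrix_vector_mult_def sum_2)
    then have 2: "norm (X ** V) = norm (X *v v)" by (simp add: power2_eq_iff_nonneg)
    show "norm (X *v v) \<le> norm X * norm v" using norm_matrix_mult_le[of X V] by (simp add: 1 2)
  qed
  have "cmod (X $ a $ b) \<le> onorm ((*v) X)" for a b
  proof -
    have "(X *v axis b 1) $ a = X $ a $ b"
      by (simp add: matrix_vector_mult_def axis_def if_distrib[of "\<lambda>z. _ * z"] cong: if_cong)
    then have "cmod (X $ a $ b) \<le> norm (X *v axis b 1)"
      using Finite_Cartesian_Product.norm_nth_le[of "X *v axis b 1" a] by simp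
    also have "\<dots> \<le> onorm ((*v) X) * norm (axis b 1 :: complex^2)" by (rule onorm[OF bl])
    finally show ?thesis by simp
  qed
  then show "norm X \<le> 2 * onorm ((*v) X)" by (rule norm_mat2_le)
qed

lemma continuous_on_onorm_matrix:
  fixes f :: "'a::topological_space \<Rightarrow> complex^2^2"
  assumes "continuous_on S f" shows "continuous_on S (\<lambda>x. onorm ((*v) (f x)))"
proof -
  have le: "onorm ((*v) X) \<le> onorm ((*v) Y) + norm (X - Y)" for X Y :: "complex^2^2"
  proof -
    have "(*v) X = (\<lambda>v. (X - Y) *v v + Y *v v)" by (simp add: fun_eq_iff matrix_vector_mult_diff_rdistrib)
    then have "onorm ((*v) X) \<le> onorm ((*v) (X - Y)) + onorm ((*v) Y)" by (metis onorm_triangle matrix_vector_mul_bounded_linear)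
    then show ?thesis using onorm_matrix_bounds(1)[of "X - Y"] by linarith
  qed
  have "continuous_on UNIV (\<lambda>X :: complex^2^2. onorm ((*v) X))"
    unfolding continuous_on_iff
  proof (intro ballI allI impI)
    fix X :: "complex^2^2" and e :: real assume "e > 0"
    moreover have "dist (onorm ((*v) Y)) (onorm ((*v) X)) \<le> dist Y X" for Y
      using le[of X Y] le[of Y X] by (simp add: dist_real_def dist_norm abs_le_iff norm_minus_commute)
    ultimately show "\<exists>d>0. \<forall>Y\<in>UNIV. dist Y X < d \<longrightarrow> dist (onorm ((*v) Y)) (onorm ((*v) X)) < e"
      by (meson order.strict_trans1)
  qed
  then show ?thesis by (rule continuous_on_compose2[OF _ assms]) auto
qed

context
  fixes M :: real and A :: "real ^ 'd::finite \<Rightarrow> complex ^ 2 ^ 2"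
  assumes A: "bounded_cocycle M A"
begin

text \<open>Passes from the \<open>lim\<close> of Lebesgue integrals in the definition to gauge
  integrals of \<open>log_iter\<close>: the integrands differ by at most \<open>ln 2\<close>, which
  vanishes after division by \<open>N\<close>. Fekete's lemma then gives existence of the limit and
  the bound by each term.\<close>

lemma lyapunov_limit:
  "0 \<le> lyapunov A \<omega>"
  "(\<lambda>N. integral (cbox 0 1) (log_iter A \<omega> N) / real N) \<longlonglongrightarrow> lyapunov A \<omega>"
  "N \<ge> 1 \<Longrightarrow> lyapunov A \<omega> \<le> integral (cbox 0 1) (log_iter A \<omega> N) / real N"
proof -
  define I where "I N = integral (cbox 0 1) (log_iter A \<omega> N)" for N
  obtain L where L: "L \<ge> 0" "(\<lambda>N. I N / real N) \<longlonglongrightarrow> L" "\<And>N. N \<ge> 1 \<Longrightarrow> L \<le> I N / real N"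
    using fekete[of I] integral_log_iter_add[OF A] integral_log_iter_bounds(1)[OF A] unfolding I_def by blast
  define f where "f N x = ln (onorm ((*v) (cocycle_iterate A \<omega> N x)))" for N x
  define J where "J N = set_lebesgue_integral lborel (cbox 0 1) (f N)" for N
  have ge1: "norm (cocycle_iterate A \<omega> N x) \<ge> 1" for N x by (rule cocycle_facts(4)[OF A])
  have op: "onorm ((*v) (cocycle_iterate A \<omega> N x)) > 0" for N x
    using onorm_matrix_bounds(2)[of "cocycle_iterate A \<omega> N x"] ge1[of N x] by linarith
  have fb: "\<bar>f N x - log_iter A \<omega> N x\<bar> \<le> ln 2" for N x
  proof -
    let ?X = "cocycle_iterate A \<omega> N x"
    have "ln (onorm ((*v) ?X)) \<le> ln (norm ?X)" using op onorm_matrix_bounds(1) by (intro ln_mono) auto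
    moreover have "ln (norm ?X) \<le> ln (2 * onorm ((*v) ?X))"
      using onorm_matrix_bounds(2)[of ?X] ge1[of N x] by (intro ln_mono) auto
    moreover have "ln (2 * onorm ((*v) ?X)) = ln 2 + ln (onorm ((*v) ?X))" using op[of N x] by (simp add: ln_mult_pos)
    moreover have "ln 2 \<ge> (0::real)" by simp
    ultimately show ?thesis unfolding f_def log_iter_def abs_le_iff by linarith
  qed
  have fc: "continuous_on S (f N)" for S N
  proof -
    have "onorm ((*v) (cocycle_iterate A \<omega> N x)) \<noteq> 0" for x using op[of N x] by simp
    moreover have "continuous_on UNIV (cocycle_iterate A \<omega> N)"
      using A by (intro continuous_iterate) (simp add: bounded_cocycle_def)
    ultimately have "continuous_on UNIV (f N)"
      unfolding f_def[abs_def] by (intro continuous_intros continuous_on_onorm_matrix) auto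
    then show ?thesis by (rule continuous_on_subset) simp
  qed
  have J: "J N = integral (cbox 0 1) (f N)" for N
    unfolding J_def
    by (rule set_borel_integral_eq_integral, unfold set_integrable_def, rule borel_integrable_compact[OF compact_cbox fc])
  have JI: "\<bar>J N - I N\<bar> \<le> ln 2" for N
  proof -
    have "J N - I N = integral (cbox 0 1) (\<lambda>x. f N x - log_iter A \<omega> N x)"
      unfolding J I_def by (intro integral_diff[symmetric] integrable_continuous fc log_iter_comp_continuous[OF A]) auto
    also have "\<bar>\<dots>\<bar> \<le> integral (cbox 0 1) (\<lambda>x::real^'d. ln 2)"
      unfolding real_norm_def[symmetric] by (rule integral_norm_bound_integral)
         (auto intro!: integrable_continuous continuous_intros fc log_iter_comp_continuous[OF A] fb)
    finally show ?thesis by simp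
  qed
  have "(\<lambda>N. J N / real N - I N / real N) \<longlonglongrightarrow> 0"
  proof (rule Lim_null_comparison)
    show "\<forall>\<^sub>F N in sequentially. norm (J N / real N - I N / real N) \<le> ln 2 / real N"
    proof (rule always_eventually, rule allI)
      fix N
      have "norm (J N / real N - I N / real N) = \<bar>J N - I N\<bar> / real N"
        by (simp add: diff_divide_distrib[symmetric])
      also have "\<dots> \<le> ln 2 / real N" by (intro divide_right_mono JI) simp
      finally show "norm (J N / real N - I N / real N) \<le> ln 2 / real N" .
    qed
    show "(\<lambda>N. ln 2 / real N) \<longlonglongrightarrow> 0" by (rule lim_const_over_n)
  qed
  from tendsto_add[OF this L(2)] have "(\<lambda>N. 1 / real N * J N) \<longlonglongrightarrow> L" by simp
  then have "lyapunov A \<omega> = L" unfolding lyapunov_def J_def f_def by (rule limI)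
  with L show "0 \<le> lyapunov A \<omega>" "(\<lambda>N. integral (cbox 0 1) (log_iter A \<omega> N) / real N) \<longlonglongrightarrow> lyapunov A \<omega>"
    "N \<ge> 1 \<Longrightarrow> lyapunov A \<omega> \<le> integral (cbox 0 1) (log_iter A \<omega> N) / real N"
    by (simp_all add: I_def)
qed

end

text \<open>The constant is exponential in \<open>N\<close>; this is harmless because cocycles are
  only compared at finitely many lengths, fixed before the distance.\<close>

lemma iterate_close:
  assumes A: "bounded_cocycle M A" and B: "bounded_cocycle M B" and \<epsilon>: "\<And>x. norm (A x - B x) \<le> \<epsilon>"
  shows "norm (cocycle_iterate A \<omega> N x - cocycle_iterate B \<omega> N x) \<le> real N * (2 * M ^ N) * \<epsilon>"
proof (induction N)
  case (Suc N)
  have M: "M \<ge> 1" by (rule bounded_cocycle_ge_1[OF A])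
  have id: "norm (mat 1 :: complex^2^2) \<le> 2"
    by (rule power2_le_imp_le) (simp_all add: norm_mat2 mat_def)
  have nB: "norm (cocycle_iterate B \<omega> K x) \<le> 2 * M ^ K" for K
  proof (induction K)
    case (Suc K)
    have "norm (cocycle_iterate B \<omega> (Suc K) x) \<le> norm (B (x + real K *\<^sub>R \<omega>)) * norm (cocycle_iterate B \<omega> K x)"
      by (simp add: norm_matrix_mult_le)
    also have "\<dots> \<le> M * (2 * M ^ K)" using Suc cocycle_facts(2)[OF B] M by (intro mult_mono) auto
    finally show ?case by simp
  qed (simp add: id)
  have \<epsilon>0: "\<epsilon> \<ge> 0" using \<epsilon>[of x] norm_ge_zero by (rule order_trans[rotated])
  let ?a = "A (x + real N *\<^sub>R \<omega>)" and ?b = "B (x + real N *\<^sub>R \<omega>)"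
  let ?I = "cocycle_iterate A \<omega> N x" and ?J = "cocycle_iterate B \<omega> N x"
  have "?a ** ?I - ?b ** ?J = ?a ** (?I - ?J) + (?a - ?b) ** ?J"
    unfolding vec_eq_iff forall_2 vector_minus_component vector_add_component mat2_mult by (simp add: algebra_simps)
  then have "norm (?a ** ?I - ?b ** ?J) \<le> norm (?a ** (?I - ?J)) + norm ((?a - ?b) ** ?J)"
    by (simp add: norm_triangle_ineq)
  also have "\<dots> \<le> M * (real N * (2 * M ^ N) * \<epsilon>) + \<epsilon> * (2 * M ^ N)"
    using cocycle_facts(2)[OF A] \<epsilon> nB Suc M \<epsilon>0 by (intro add_mono order_trans[OF norm_matrix_mult_le] mult_mono) auto
  also have "\<epsilon> * (2 * M ^ N) \<le> M * (\<epsilon> * (2 * M ^ N))"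
    using mult_right_mono[OF M, of "\<epsilon> * (2 * M ^ N)"] \<epsilon>0 M by simp
  finally show ?case by (simp add: algebra_simps)
qed simp

text \<open>Norms of unimodular matrices are at least 1, and there \<open>ln\<close> is
  1-Lipschitz.\<close>

lemma integral_log_iter_close:
  assumes A: "bounded_cocycle M A" and B: "bounded_cocycle M B" and \<epsilon>: "\<And>x. norm (A x - B x) \<le> \<epsilon>"
  shows "\<bar>integral (cbox 0 1) (log_iter A \<omega> N) - integral (cbox 0 1) (log_iter B \<omega> N)\<bar> \<le> real N * (2 * M ^ N) * \<epsilon>"
proof -
  have lip: "ln a - ln b \<le> \<bar>a - b\<bar>" if "a \<ge> 1" "b \<ge> 1" for a b :: real
  proof -
    have "ln a - ln b = ln (a / b)" using that by (simp add: ln_div)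
    also have "\<dots> \<le> a / b - 1" using that by (intro ln_le_minus_one) auto
    also have "\<dots> = (a - b) / b" using that by (simp add: field_simps)
    also have "\<dots> \<le> \<bar>a - b\<bar> / b" using that by (intro divide_right_mono) auto
    also have "\<dots> \<le> \<bar>a - b\<bar> / 1" using that by (intro divide_left_mono) auto
    finally show ?thesis by simp
  qed
  have pt: "\<bar>log_iter A \<omega> N x - log_iter B \<omega> N x\<bar> \<le> real N * (2 * M ^ N) * \<epsilon>" for x
  proof -
    let ?a = "norm (cocycle_iterate A \<omega> N x)" and ?b = "norm (cocycle_iterate B \<omega> N x)"
    have "\<bar>?a - ?b\<bar> \<le> real N * (2 * M ^ N) * \<epsilon>"
      by (rule order_trans[OF norm_triangle_ineq3 iterate_close[OF A B \<epsilon>]])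
    moreover have "\<bar>ln ?a - ln ?b\<bar> \<le> \<bar>?a - ?b\<bar>"
      using lip[of ?a ?b] lip[of ?b ?a] cocycle_facts(4)[OF A] cocycle_facts(4)[OF B] by (simp add: abs_le_iff abs_minus_commute)
    ultimately show ?thesis unfolding log_iter_def by linarith
  qed
  have "integral (cbox 0 1) (log_iter A \<omega> N) - integral (cbox 0 1) (log_iter B \<omega> N) =
      integral (cbox 0 1) (\<lambda>x. log_iter A \<omega> N x - log_iter B \<omega> N x)"
    by (intro integral_diff[symmetric] log_iter_integrable[OF A] log_iter_integrable[OF B])
  also have "\<bar>\<dots>\<bar> \<le> integral (cbox 0 1) (\<lambda>x::real^'a. real N * (2 * M ^ N) * \<epsilon>)"
    unfolding real_norm_def[symmetric] by (rule integral_norm_bound_integral)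
       (auto intro!: integrable_diff log_iter_integrable[OF A] log_iter_integrable[OF B] pt)
  finally show ?thesis by simp
qed

lemma lyapunov_continuous_at:
  fixes \<omega> :: "real ^ 'd::finite"
  assumes dio: "diophantine \<kappa> b \<omega>" and \<kappa>: "\<kappa> > 0" and b: "b > 0" and R: "R > 0"
    and s: "1 \<le> s" "s < 1 + 1 / (6 * real CARD('d)) / (1 + b)"
    and A: "A \<in> gevrey_cocycles s R" and \<epsilon>: "\<epsilon> > 0"
  shows "\<exists>\<delta>>0. \<forall>B \<in> gevrey_cocycles s R. cocycle_dist s R A B < \<delta> \<longrightarrow> \<bar>lyapunov A \<omega> - lyapunov B \<omega>\<bar> < \<epsilon>"
proof -
  have entry: "(\<lambda>x. X x $ i $ j) \<in> gevrey_space s R"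
    if "X \<in> gevrey_cocycles s R" for X :: "real ^ 'd \<Rightarrow> complex ^ 2 ^ 2" and i j
    using that by (simp add: gevrey_cocycles_def)
  define a where "a i j = gevrey_norm s R (\<lambda>x. A x $ i $ j)" for i j
  have a0: "a i j \<ge> 0" for i j unfolding a_def by (rule gevrey_norm_nonneg[OF R entry[OF A]])
  \<comment> \<open>With the added 1 this bounds the Gevrey norms of all entries on the whole unit
    ball around \<open>A\<close>, so the constants of the deviation estimate are uniform
    there.\<close>
  define G where "G = 1 + (\<Sum>i\<in>UNIV. \<Sum>j\<in>UNIV. a i j)"
  define M where "M = 2 * G"
  have aG: "a i j \<le> G - 1" for i j
  proof -
    have "a i j \<le> (\<Sum>j\<in>UNIV. a i j)" using a0 by (intro member_le_sum) auto
    also have "\<dots> \<le> (\<Sum>i\<in>UNIV. \<Sum>j\<in>UNIV. a i j)"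
      using a0 by (intro member_le_sum[of i UNIV "\<lambda>i. \<Sum>j\<in>UNIV. a i j"] sum_nonneg) auto
    finally show ?thesis by (simp add: G_def)
  qed
  have G: "G \<ge> 1" using aG[of 1 1] a0[of 1 1] by linarith
  have AG: "gevrey_norm s R (\<lambda>x. A x $ i $ j) \<le> G" for i j using aG[of i j] by (simp add: a_def)
  have dist_entry: "gevrey_norm s R (\<lambda>x. A x $ i $ j - B x $ i $ j) \<le> cocycle_dist s R A B"
    if B: "B \<in> gevrey_cocycles s R" for B i j
  proof -
    define e where "e i j = gevrey_norm s R (\<lambda>x. A x $ i $ j - B x $ i $ j)" for i j
    have e0: "e i j \<ge> 0" for i j
      unfolding e_def by (intro gevrey_norm_nonneg[OF R] gevrey_space_diff(1)[OF R] entry A B)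
    have "e i j \<le> (\<Sum>j\<in>UNIV. e i j)" using e0 by (intro member_le_sum) auto
    also have "\<dots> \<le> (\<Sum>i\<in>UNIV. \<Sum>j\<in>UNIV. e i j)"
      using e0 by (intro member_le_sum[of i UNIV "\<lambda>i. \<Sum>j\<in>UNIV. e i j"] sum_nonneg) auto
    finally show ?thesis using A B by (simp add: e_def cocycle_dist_def)
  qed
  have BG: "gevrey_norm s R (\<lambda>x. B x $ i $ j) \<le> G"
    if B: "B \<in> gevrey_cocycles s R" "cocycle_dist s R A B < 1" for B i j
  proof -
    have "gevrey_norm s R (\<lambda>x. A x $ i $ j - (A x $ i $ j - B x $ i $ j)) \<le>
      gevrey_norm s R (\<lambda>x. A x $ i $ j) + gevrey_norm s R (\<lambda>x. A x $ i $ j - B x $ i $ j)"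
      by (intro gevrey_space_diff[OF R] entry A B)
    then show ?thesis using aG[of i j] dist_entry[OF B(1), of i j] B(2) by (simp add: a_def)
  qed
  have bcA: "bounded_cocycle M A" unfolding M_def by (rule gevrey_bounded_cocycle[OF A AG])
  have M: "M \<ge> 1" using G by (simp add: M_def)
  have lM: "ln M \<ge> 0" using M by simp
  define l where "l B N = integral (cbox 0 1) (log_iter B \<omega> N) / real N" for B N
  have close: "\<bar>l A N - l B N\<bar> \<le> 4 * M ^ N * cocycle_dist s R A B"
    if B: "B \<in> gevrey_cocycles s R" "cocycle_dist s R A B < 1" and N: "N \<ge> 1" for B N
  proof -
    have bcB: "bounded_cocycle M B" unfolding M_def by (rule gevrey_bounded_cocycle[OF B(1) BG[OF B]])
    have "cmod ((A x - B x) $ i $ j) \<le> cocycle_dist s R A B" for x i j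
    proof -
      have "cmod (A x $ i $ j - B x $ i $ j) \<le> gevrey_norm s R (\<lambda>x. A x $ i $ j - B x $ i $ j)"
        by (intro norm_le_gevrey_norm[of "\<lambda>x. A x $ i $ j - B x $ i $ j"] gevrey_space_diff(1)[OF R] entry A B)
      also note dist_entry[OF B(1), of i j]
      finally show ?thesis by simp
    qed
    then have "norm (A x - B x) \<le> 2 * cocycle_dist s R A B" for x by (rule norm_mat2_le)
    from integral_log_iter_close[OF bcA bcB this, of \<omega> N]
    have "\<bar>integral (cbox 0 1) (log_iter A \<omega> N) - integral (cbox 0 1) (log_iter B \<omega> N)\<bar> / real N
        \<le> (real N * (2 * M ^ N) * (2 * cocycle_dist s R A B)) / real N"
      by (rule divide_right_mono) simp
    then show ?thesis using N by (simp add: l_def diff_divide_distrib[symmetric])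
  qed
  have lyA: "l A \<longlonglongrightarrow> lyapunov A \<omega>" unfolding l_def[abs_def] by (rule lyapunov_limit(2)[OF bcA])
  show ?thesis
  proof (cases "lyapunov A \<omega> = 0")
    case True
    \<comment> \<open>Upper semicontinuity: one finite-length average that is small at
      \<open>A\<close> stays small nearby and bounds the exponent from above, while the exponent is
      never negative.\<close>
    then have "\<forall>\<^sub>F N in sequentially. l A N < \<epsilon> / 2" using order_tendstoD(2)[OF lyA, of "\<epsilon>/2"] \<epsilon> by simp
    then have "\<forall>\<^sub>F N in sequentially. l A N < \<epsilon> / 2 \<and> N \<ge> 1" using eventually_ge_at_top[of 1] by eventually_elim simp
    from eventually_happens'[OF sequentially_bot this] obtain N where N: "l A N < \<epsilon> / 2" "N \<ge> 1" by blast
    define \<delta> where "\<delta> = min 1 (\<epsilon> / (8 * M ^ N))"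
    have \<delta>: "\<delta> > 0" "\<delta> \<le> 1" "\<delta> \<le> \<epsilon> / (8 * M ^ N)" using \<epsilon> M by (auto simp: \<delta>_def)
    have "\<bar>lyapunov A \<omega> - lyapunov B \<omega>\<bar> < \<epsilon>" if B: "B \<in> gevrey_cocycles s R" "cocycle_dist s R A B < \<delta>" for B
    proof -
      have B1: "cocycle_dist s R A B < 1" using B \<delta> by linarith
      have bcB: "bounded_cocycle M B" unfolding M_def by (rule gevrey_bounded_cocycle[OF B(1) BG[OF B(1) B1]])
      have "4 * M ^ N * cocycle_dist s R A B \<le> 4 * M ^ N * (\<epsilon> / (8 * M ^ N))"
        using B \<delta> M by (intro mult_left_mono) auto
      also have "\<dots> = \<epsilon> / 2" using M by simp
      finally have "\<bar>l A N - l B N\<bar> \<le> \<epsilon> / 2" using close[OF B(1) B1 N(2)] by linarith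
      moreover have "lyapunov B \<omega> \<le> l B N" unfolding l_def by (rule lyapunov_limit(3)[OF bcB N(2)])
      moreover have "lyapunov B \<omega> \<ge> 0" by (rule lyapunov_limit(1)[OF bcB])
      ultimately show ?thesis using True N(1) by linarith
    qed
    with \<delta> show ?thesis by blast
  next
    case False
    define L where "L = lyapunov A \<omega>"
    have L: "L > 0" using False lyapunov_limit(1)[OF bcA, of \<omega>] by (simp add: L_def)
    obtain C \<sigma> where C: "0 < C" and \<sigma>: "0 < \<sigma>" "\<sigma> \<le> 1/2"
      and dev: "\<And>B N. B \<in> gevrey_cocycles s R \<Longrightarrow> (\<And>i j. gevrey_norm s R (\<lambda>x. B x $ i $ j) \<le> G) \<Longrightarrow> N \<ge> 1 \<Longrightarrow>
        integral (cbox 0 1) (\<lambda>x. \<bar>log_iter B \<omega> N x - integral (cbox 0 1) (log_iter B \<omega> N)\<bar>) \<le> C * real N powr (1 - \<sigma>)"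
      using log_iter_L1_deviation[OF dio \<kappa> b R G s] by blast
    define g where "g = L / 4"
    define \<beta> where "\<beta> = \<sigma> / 2"
    define D where "D = 1 + 2 * ln M + 768 * C * ln M / g"
    have g: "g > 0" and \<beta>: "\<beta> > 0" using L \<sigma> by (auto simp: g_def \<beta>_def)
    have D: "D \<ge> 0" using lM C g by (simp add: D_def)
    \<comment> \<open>At \<open>B\<close> both averages are within \<open>2 * \<epsilon>'\<close> of
      \<open>L\<close>, so the gap is at most \<open>4 * \<epsilon>'\<close> and the two-scale bound
      at most \<open>9 * \<epsilon>'\<close>. This has to be at most \<open>g / 4 = L / 16\<close>;
      the total distance \<open>11 * \<epsilon>'\<close> has to be below \<epsilon>.\<close>
    define \<epsilon>' where "\<epsilon>' = min (\<epsilon> / 12) (L / 200)"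
    have \<epsilon>': "\<epsilon>' > 0" "\<epsilon>' \<le> \<epsilon> / 12" "\<epsilon>' \<le> L / 200" using \<epsilon> L unfolding \<epsilon>'_def by simp_all
    have "\<forall>\<^sub>F N in sequentially. \<bar>l A N - L\<bar> < \<epsilon>'"
      using lyA \<epsilon>' unfolding L_def tendsto_iff dist_real_def by blast
    moreover have "\<forall>\<^sub>F N in sequentially. \<bar>l A (2 * N) - L\<bar> < \<epsilon>'"
    proof -
      have "filterlim (\<lambda>N::nat. 2 * N) at_top sequentially" by (rule filterlim_subseq) (auto simp: strict_mono_def)
      from filterlim_compose[OF lyA this] show ?thesis
        using \<epsilon>' unfolding L_def tendsto_iff dist_real_def by blast
    qed
    moreover have "\<forall>\<^sub>F N in sequentially. 5 * D * real N powr (- \<beta>) / (1 - 2 powr (- \<beta>)) < \<epsilon>'"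
    proof -
      have "((\<lambda>N. real N powr (- \<beta>)) \<longlongrightarrow> 0) sequentially"
        using \<beta> by (intro tendsto_neg_powr filterlim_real_sequentially) auto
      then have "((\<lambda>N. 5 * D * real N powr (- \<beta>) / (1 - 2 powr (- \<beta>))) \<longlongrightarrow> 5 * D * 0 / (1 - 2 powr (- \<beta>))) sequentially"
        unfolding divide_inverse by (intro tendsto_intros)
      then show ?thesis using \<epsilon>' by (intro order_tendstoD(2)) auto
    qed
    moreover have "\<forall>\<^sub>F N in sequentially. 4 / g \<le> real N"
      using filterlim_real_sequentially unfolding filterlim_at_top by blast
    moreover have "\<forall>\<^sub>F N in sequentially. N \<ge> (1::nat)" by (rule eventually_ge_at_top)
    ultimately have "\<forall>\<^sub>F N in sequentially. \<bar>l A N - L\<bar> < \<epsilon>' \<and> \<bar>l A (2 * N) - L\<bar> < \<epsilon>' \<and>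
        5 * D * real N powr (- \<beta>) / (1 - 2 powr (- \<beta>)) < \<epsilon>' \<and> 4 / g \<le> real N \<and> N \<ge> 1"
      by eventually_elim simp
    from eventually_happens'[OF sequentially_bot this]
    obtain N where N: "\<bar>l A N - L\<bar> < \<epsilon>'" "\<bar>l A (2 * N) - L\<bar> < \<epsilon>'"
        "5 * D * real N powr (- \<beta>) / (1 - 2 powr (- \<beta>)) < \<epsilon>'" "4 / g \<le> real N" "N \<ge> 1"
      by blast
    \<comment> \<open>Chosen after \<open>N\<close>, so that averages of \<open>A\<close> and
      \<open>B\<close> differ by at most \<open>\<epsilon>'\<close> at both lengths \<open>N\<close>
      and \<open>2 * N\<close>. Everything at larger scales is governed by the uniform two-scale
      relation.\<close>
    define \<delta> where "\<delta> = min 1 (\<epsilon>' / (4 * M ^ (2 * N)))"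
    have \<delta>: "\<delta> > 0" "\<delta> \<le> 1" "\<delta> \<le> \<epsilon>' / (4 * M ^ (2 * N))" using \<epsilon>' M by (auto simp: \<delta>_def)
    have "\<bar>lyapunov A \<omega> - lyapunov B \<omega>\<bar> < \<epsilon>" if B: "B \<in> gevrey_cocycles s R" "cocycle_dist s R A B < \<delta>" for B
    proof -
      have B1: "cocycle_dist s R A B < 1" using B \<delta> by linarith
      have bcB: "bounded_cocycle M B" unfolding M_def by (rule gevrey_bounded_cocycle[OF B(1) BG[OF B(1) B1]])
      have near: "\<bar>l A K - l B K\<bar> \<le> \<epsilon>'" if K: "K \<ge> 1" "K \<le> 2 * N" for K
      proof -
        have d0: "0 \<le> cocycle_dist s R A B"
          using Metric_space.nonneg[OF Metric_space_cocycles[OF R]] .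
        have "4 * M ^ K * cocycle_dist s R A B \<le> 4 * M ^ (2 * N) * (\<epsilon>' / (4 * M ^ (2 * N)))"
          using B \<delta> M K d0 by (intro mult_mono power_increasing) auto
        also have "\<dots> = \<epsilon>'" using M by simp
        finally show ?thesis using close[OF B(1) B1 K(1)] by linarith
      qed
      have l1: "\<bar>l B N - L\<bar> \<le> 2 * \<epsilon>'" using near[of N] N by linarith
      have l2: "\<bar>l B (2 * N) - L\<bar> \<le> 2 * \<epsilon>'" using near[of "2 * N"] N by linarith
      have gap: "\<bar>l B N - l B (2 * N)\<bar> \<le> 4 * \<epsilon>'" using l1 l2 by linarith
      have "\<bar>lyapunov B \<omega> - l B N\<bar> \<le> 2 * \<bar>l B N - l B (2 * N)\<bar> + 5 * D * real N powr (- \<beta>) / (1 - 2 powr (- \<beta>))"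
      proof (rule two_scale_limit[where g = g])
        fix K n
        assume K: "N \<le> K" and lK: "g \<le> l B K" "l B K - l B (2 * K) \<le> g / 8"
          and n: "2 \<le> n" "real K powr \<beta> \<le> real n" "real n \<le> 8 * real K powr \<beta>"
        have "4 / g \<le> real K" using N(4) K by linarith
        then have gK: "4 \<le> g * real K" using g by (simp add: pos_divide_le_eq mult.commute)
        have K1: "K \<ge> 1" using K N by linarith
        show "\<bar>l B (n * K) + l B K - 2 * l B (2 * K)\<bar> \<le> D * real K powr (- \<beta>)"
          unfolding l_def D_def \<beta>_def
          by (rule scale_step[OF bcB dev[OF B(1) BG[OF B(1) B1]] C \<sigma> g gK K1 n(1) n(2,3)[unfolded \<beta>_def] lK[unfolded l_def]])
      next
        show "l B \<longlonglongrightarrow> lyapunov B \<omega>" unfolding l_def[abs_def] by (rule lyapunov_limit(2)[OF bcB])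
        show "2 * g \<le> l B N" using l1 \<epsilon>' unfolding g_def abs_le_iff by linarith
        show "2 * \<bar>l B N - l B (2 * N)\<bar> + 5 * D * real N powr (- \<beta>) / (1 - 2 powr (- \<beta>)) \<le> g / 4"
        proof -
          have "x + y \<le> L / 4 / 4" if "x \<le> 2 * (4 * \<epsilon>')" "y < \<epsilon>'" for x y using that \<epsilon>' by linarith
          from this[OF mult_left_mono[OF gap] N(3)] show ?thesis by (simp add: g_def)
        qed
      qed (use \<beta> D N in auto)
      also have "\<dots> \<le> 2 * (4 * \<epsilon>') + \<epsilon>'" using N(3) by (intro add_mono mult_left_mono gap) auto
      finally have "\<bar>lyapunov B \<omega> - l B N\<bar> \<le> 9 * \<epsilon>'" by simp
      then have "\<bar>L - lyapunov B \<omega>\<bar> \<le> 11 * \<epsilon>'" using l1 unfolding abs_le_iff by linarith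
      then show ?thesis using \<epsilon>' unfolding L_def by linarith
    qed
    with \<delta> show ?thesis by blast
  qed
qed

theorem theorem3:
  "\<exists>c::real. 0 < c \<and> c \<le> 1 \<and>
     (\<forall>b>0. \<forall>\<kappa>>0. \<forall>\<omega> :: real ^ 'd::finite. diophantine \<kappa> b \<omega> \<longrightarrow>
        (\<forall>s. 1 \<le> s \<and> s < 1 + c / (1 + b) \<longrightarrow>
           gevrey_continuous s (\<lambda>A. lyapunov A \<omega>)))"
proof (intro exI conjI allI impI)
  have d: "real CARD('d) \<ge> 1" by (simp add: Suc_le_eq)
  then have d6: "0 < 6 * real CARD('d)" "1 \<le> 6 * real CARD('d)" by linarith+
  show "0 < 1 / (6 * real CARD('d))" using d6(1) by (rule divide_pos_pos[OF zero_less_one])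
  show "1 / (6 * real CARD('d)) \<le> 1" by (rule divide_le_eq_1_pos[THEN iffD2, OF d6])
  fix b \<kappa> s :: real and \<omega> :: "real ^ 'd"
  assume *: "0 < b" "0 < \<kappa>" "diophantine \<kappa> b \<omega>" "1 \<le> s \<and> s < 1 + 1 / (6 * real CARD('d)) / (1 + b)"
  show "gevrey_continuous s (\<lambda>A. lyapunov A \<omega>)"
    unfolding gevrey_continuous_def
  proof (intro allI impI)
    fix R :: real assume R: "R > 0"
    interpret Metric_space "gevrey_cocycles s R :: (real ^ 'd \<Rightarrow> complex ^ 2 ^ 2) set" "cocycle_dist s R"
      by (rule Metric_space_cocycles[OF R])
    show "continuous_map mtopology euclideanreal (\<lambda>A. lyapunov A \<omega>)"
      unfolding mtopology_is_euclidean[symmetric] metric_continuous_map[OF Met_TC.Metric_space_axioms]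
    proof (intro conjI ballI allI impI)
      fix A :: "real ^ 'd \<Rightarrow> complex ^ 2 ^ 2" and \<epsilon> :: real
      assume "A \<in> gevrey_cocycles s R" "\<epsilon> > 0"
      from lyapunov_continuous_at[OF *(3,2,1) R conjunct1[OF *(4)] conjunct2[OF *(4)] this]
      show "\<exists>\<delta>>0. \<forall>B. B \<in> gevrey_cocycles s R \<and> cocycle_dist s R A B < \<delta> \<longrightarrow> dist (lyapunov A \<omega>) (lyapunov B \<omega>) < \<epsilon>"
        unfolding dist_real_def by blast
    qed simp
  qed
qed

end
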